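(* Let $F$ be a field of characteristic $2$. Assume $a\in F$ and $b,c\in F^\times$ are such that $a\,\mathrm{dlog}(b)\wedge\mathrm{dlog}(c)$ is a non-trivial symbol in $H^3_2(F)$, and let $Q$ be the quaternion algebra $Q=[a,c)$ over $F$. Then the $5$-dimensional quadratic form \[\varphi_1=c[1,a+b]\perp b[1,a]\perp\langle 1\rangle\] is anisotropic over $F$, and becomes isotropic over $F_Q$. If in addition $[a,b)\otimes_F[b,c)$ is a division algebra over $F$, then $\varphi_1$ is $F_Q$-minimal.
   Context: Let $F$ be a field of characteristic $2$. Quaternion algebras: for $\alpha\in F$, $\beta\in F^\times$, $[\alpha,\beta)$ is the quaternion $F$-algebra generated by $i,j$ with $i^2-i=\alpha$, $j^2=\beta$, $jij^{-1}=i-1$. Quadratic forms: $[1,\alpha]$ denotes the binary form $x^2+xy+\alpha y^2$; for $\lambda\in F^\times$, $\lambda[1,\alpha]$ is the form multiplied by the scalar $\lambda$; $\langle\lambda\rangle$ denotes the one-dimensional form $\lambda x^2$; $\perp$ is orthogonal sum. A subform of a quadratic form is its restriction to a linear subspace, and it is strict if the subspace is proper. Function field: for a quaternion division algebra $Q=[\alpha,\beta)$, $F_Q$ denotes the function field of its Severi-Brauer variety, which is the projective conic $x^2+xy+\alpha y^2+\beta z^2=0$ (defined by a codimension $1$ subform of the norm form $[1,\alpha]\perp\beta[1,\alpha]$ of $Q$). Minimality: a quadratic form $\varphi$ over $F$ is $F_Q$-minimal if $\varphi$ is anisotropic, $\varphi_{F_Q}$ is isotropic, and $\varphi$ does not contain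 any strict subform which becomes isotropic over $F_Q$. Kato-Milne cohomology: $\Omega_F^n$ is the space of $n$-fold (absolute Kähler) differentials of $F$, $\mathrm{dlog}(\beta)=\beta^{-1}d\beta$ for $\beta\in F^\times$, and $H_2^{n+1}(F)$ is the cokernel of the Artin-Schreier map $\wp:\Omega_F^n\to\Omega_F^n/d\Omega_F^{n-1}$ given by $\alpha\,\mathrm{dlog}(\beta_1)\wedge\dots\wedge\mathrm{dlog}(\beta_n)\mapsto(\alpha^2-\alpha)\,\mathrm{dlog}(\beta_1)\wedge\dots\wedge\mathrm{dlog}(\beta_n)$. The class of $a\,\mathrm{dlog}(b)\wedge\mathrm{dlog}(c)$ is considered in $H^3_2(F)$ (the case $n=2$). *)

theory Defs
  imports
    "HOL-Analysis.Cartesian_Space"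
    "HOL-Computational_Algebra.Polynomial"
    "HOL-Library.Poly_Mapping"
    "HOL-Algebra.Coset"
    "HOL-Algebra.Generated_Groups"
begin

section \<open>Quadratic forms\<close>

text \<open>
  In characteristic 2 a quadratic form is not determined by its polar form. The matrix \<open>A\<close> below is
  not required to be symmetric; it stands for the form \<open>\<Sum>\<^sub>i\<^sub>j A\<^sub>i\<^sub>j x\<^sub>i x\<^sub>j\<close>.
\<close>

definition qform :: "'a::comm_ring_1 ^ 'n ^ 'n \<Rightarrow> 'a ^ 'n \<Rightarrow> 'a"
  where "qform A x = (\<Sum>i\<in>UNIV. \<Sum>j\<in>UNIV. A $ i $ j * x $ i * x $ j)"

definition binary_form :: "'a::comm_ring_1 \<Rightarrow> 'a ^ 2 ^ 2"
  where "binary_form \<alpha> = vector [vector [1, 1], vector [0, \<alpha>]]"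

definition unary_form :: "'a::comm_ring_1 \<Rightarrow> 'a ^ 1 ^ 1"
  where "unary_form c = (\<chi> i j. c)"

definition scale_form :: "'a::comm_ring_1 \<Rightarrow> 'a ^ 'n ^ 'n \<Rightarrow> 'a ^ 'n ^ 'n"
  where "scale_form c A = (\<chi> i j. c * A $ i $ j)"

definition orth_sum ::
    "'a::comm_ring_1 ^ 'n ^ 'n \<Rightarrow> 'a ^ 'm ^ 'm \<Rightarrow> 'a ^ ('n + 'm) ^ ('n + 'm)"  (infixl \<open>\<bottom>\<bottom>\<close> 65)
  where "A \<bottom>\<bottom> B = (\<chi> i j. case (i, j) of
      (Inl k, Inl l) \<Rightarrow> A $ k $ l
    | (Inr k, Inr l) \<Rightarrow> B $ k $ l
    | _ \<Rightarrow> 0)"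

definition isotropic :: "'a::comm_ring_1 ^ 'n ^ 'n \<Rightarrow> bool"
  where "isotropic A \<longleftrightarrow> (\<exists>x. x \<noteq> 0 \<and> qform A x = 0)"

abbreviation anisotropic :: "'a::comm_ring_1 ^ 'n ^ 'n \<Rightarrow> bool"
  where "anisotropic A \<equiv> \<not> isotropic A"

definition base_change :: "('a::comm_ring_1 \<Rightarrow> 'b::comm_ring_1) \<Rightarrow> 'a ^ 'n ^ 'n \<Rightarrow> 'b ^ 'n ^ 'n"
  where "base_change \<iota> A = (\<chi> i j. \<iota> (A $ i $ j))"

text \<open>
  For a field extension \<open>\<iota>\<close> from \<open>F\<close> to \<open>K\<close> and a subspace \<open>W\<close> of \<open>F^n\<close>, the scalar extension of
  \<open>W\<close> is realised as the \<open>K\<close>-span of the image of \<open>W\<close> in \<open>K^n\<close>.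
\<close>

definition subform_becomes_isotropic ::
    "('a::field \<Rightarrow> 'b::field) \<Rightarrow> 'a ^ 'n ^ 'n \<Rightarrow> ('a ^ 'n) set \<Rightarrow> bool"
  where "subform_becomes_isotropic \<iota> A W \<longleftrightarrow>
    (\<exists>v \<in> vec.span ((\<lambda>w. \<chi> i. \<iota> (w $ i)) ` W). v \<noteq> 0 \<and> qform (base_change \<iota> A) v = 0)"

definition minimal_form :: "('a::field \<Rightarrow> 'b::field) \<Rightarrow> 'a ^ 'n ^ 'n \<Rightarrow> bool"
  where "minimal_form \<iota> A \<longleftrightarrow>
    anisotropic A \<and> isotropic (base_change \<iota> A) \<and>
    (\<forall>W. vec.subspace W \<and> W \<noteq> UNIV \<longrightarrow> \<not> subform_becomes_isotropic \<iota> A W)"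


section \<open>Algebras given by structure constants\<close>

text \<open>
  \<open>T i j\<close> is the product of the basis vectors \<open>e\<^sub>i\<close> and \<open>e\<^sub>j\<close> of the algebra with underlying space
  \<open>F^n\<close>.
\<close>

type_synonym ('a, 'n) mult_table = "'n \<Rightarrow> 'n \<Rightarrow> 'a ^ 'n"

definition alg_mult :: "('a::field, 'n::finite) mult_table \<Rightarrow> 'a ^ 'n \<Rightarrow> 'a ^ 'n \<Rightarrow> 'a ^ 'n"
  where "alg_mult T x y = (\<Sum>i\<in>UNIV. \<Sum>j\<in>UNIV. (x $ i * y $ j) *s T i j)"

definition division_algebra :: "('a::field, 'n::finite) mult_table \<Rightarrow> bool"
  where "division_algebra T \<longleftrightarrow>
    (\<exists>e. e \<noteq> 0 \<and> (\<forall>x. alg_mult T e x = x \<and> alg_mult T x e = x) \<and>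
      (\<forall>x. x \<noteq> 0 \<longrightarrow> (\<exists>y. alg_mult T x y = e \<and> alg_mult T y x = e)))"

text \<open>The basis vector of the tensor product indexed by \<open>(i, i')\<close> is \<open>e\<^sub>i \<otimes> e\<^sub>i\<^sub>'\<close>.\<close>

definition tensor_table ::
    "('a::field, 'n::finite) mult_table \<Rightarrow> ('a, 'm::finite) mult_table \<Rightarrow> ('a, 'n \<times> 'm) mult_table"
  where "tensor_table S T = (\<lambda>(i, i') (j, j'). \<chi> k. S i j $ fst k * T i' j' $ snd k)"

datatype quat_basis = Q1 | Qi | Qj | Qij

lemma UNIV_quat_basis: "UNIV = {Q1, Qi, Qj, Qij}"
  using quat_basis.exhaust by auto

instance quat_basis :: finite
  by standard (simp add: UNIV_quat_basis)

text \<open>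
  The quaternion algebra \<open>[\<alpha>, \<beta>)\<close> on the basis \<open>1, i, j, ij\<close>. The table follows from
  \<open>i\<^sup>2 = i + \<alpha>\<close>, \<open>j\<^sup>2 = \<beta>\<close> and \<open>j i = (i - 1) j\<close>.
\<close>

fun quaternion :: "'a::field \<Rightarrow> 'a \<Rightarrow> ('a, quat_basis) mult_table"
  where
    "quaternion \<alpha> \<beta> Q1  y   = axis y 1"
  | "quaternion \<alpha> \<beta> x   Q1  = axis x 1"
  | "quaternion \<alpha> \<beta> Qi  Qi  = axis Qi 1 + axis Q1 \<alpha>"
  | "quaternion \<alpha> \<beta> Qi  Qj  = axis Qij 1"
  | "quaternion \<alpha> \<beta> Qi  Qij = axis Qij 1 + axis Qj \<alpha>"
  | "quaternion \<alpha> \<beta> Qj  Qi  = axis Qij 1 - axis Qj 1"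
  | "quaternion \<alpha> \<beta> Qj  Qj  = axis Q1 \<beta>"
  | "quaternion \<alpha> \<beta> Qj  Qij = axis Qi \<beta> - axis Q1 \<beta>"
  | "quaternion \<alpha> \<beta> Qij Qi  = axis Qj \<alpha>"
  | "quaternion \<alpha> \<beta> Qij Qj  = axis Qi \<beta>"
  | "quaternion \<alpha> \<beta> Qij Qij = axis Q1 (\<alpha> * \<beta>)"

lemma alg_mult_quaternion_assoc:
  assumes "CHAR('a) = 2"
  shows "alg_mult (quaternion \<alpha> (\<beta> :: 'a::field)) (alg_mult (quaternion \<alpha> \<beta>) x y) z =
    alg_mult (quaternion \<alpha> \<beta>) x (alg_mult (quaternion \<alpha> \<beta>) y z)"
proof -
  have two: "2 = (0 :: 'a)"
    using of_nat_CHAR[where ?'a = 'a] assms by simp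
  show ?thesis
    by (simp add: vec_eq_iff alg_mult_def UNIV_quat_basis axis_def)
       (auto simp: algebra_simps two)
qed


section \<open>The function field of the conic of a quaternion algebra\<close>

text \<open>
  The polynomial \<open>x\<^sup>2 + x y + \<alpha> y\<^sup>2 + \<beta>\<close>, i.e. the equation of the projective conic
  \<open>x\<^sup>2 + x y + \<alpha> y\<^sup>2 + \<beta> z\<^sup>2 = 0\<close> in the affine chart \<open>z = 1\<close>, as a polynomial in \<open>y\<close> with
  coefficients in \<open>F[x]\<close>.
\<close>

definition conic_poly :: "'a::field \<Rightarrow> 'a \<Rightarrow> 'a poly poly"
  where "conic_poly \<alpha> \<beta> = [:[:\<beta>, 0, 1:], [:0, 1:], [:\<alpha>:]:]"

definition eval2 :: "('a::field \<Rightarrow> 'b::field) \<Rightarrow> 'b \<Rightarrow> 'b \<Rightarrow> 'a poly poly \<Rightarrow> 'b"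
  where "eval2 \<iota> x y p = poly (map_poly (\<lambda>q. poly (map_poly \<iota> q) x) p) y"

definition field_hom :: "('a::field \<Rightarrow> 'b::field) \<Rightarrow> bool"
  where "field_hom \<iota> \<longleftrightarrow>
    \<iota> 1 = 1 \<and> (\<forall>x y. \<iota> (x + y) = \<iota> x + \<iota> y) \<and> (\<forall>x y. \<iota> (x * y) = \<iota> x * \<iota> y)"

text \<open>
  \<open>\<iota> : F \<rightarrow> K\<close> exhibits \<open>K\<close> as the function field \<open>F\<^sub>Q\<close> for \<open>Q = [\<alpha>, \<beta>)\<close>: the coordinate ring
  \<open>F[x, y] / (x\<^sup>2 + x y + \<alpha> y\<^sup>2 + \<beta>)\<close> of the dense affine chart embeds into \<open>K\<close> over \<open>F\<close>, and \<open>K\<close> is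
  its field of fractions. This determines \<open>K\<close> up to \<open>F\<close>-isomorphism.
\<close>

definition is_function_field :: "'a::field \<Rightarrow> 'a \<Rightarrow> ('a \<Rightarrow> 'b::field) \<Rightarrow> bool"
  where "is_function_field \<alpha> \<beta> \<iota> \<longleftrightarrow> field_hom \<iota> \<and>
    (\<exists>x y. (\<forall>p. eval2 \<iota> x y p = 0 \<longleftrightarrow> conic_poly \<alpha> \<beta> dvd p) \<and>
           (\<forall>k. \<exists>p q. eval2 \<iota> x y q \<noteq> 0 \<and> k = eval2 \<iota> x y p / eval2 \<iota> x y q))"


section \<open>Differentials and Kato-Milne cohomology\<close>

text \<open>
  The free \<open>F\<close>-module on the words \<open>[x\<^sub>1, \<dots>, x\<^sub>n]\<close> of length \<open>n\<close>, as an additive group;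
  \<open>Poly_Mapping.single [x\<^sub>1, \<dots>, x\<^sub>n] f\<close> is the formal expression \<open>f dx\<^sub>1 \<and> \<dots> \<and> dx\<^sub>n\<close>.
\<close>

definition formal_forms :: "nat \<Rightarrow> ('a::field list \<Rightarrow>\<^sub>0 'a) monoid"
  where "formal_forms n =
    \<lparr>carrier = {p. Poly_Mapping.keys p \<subseteq> {xs. length xs = n}}, mult = (+), one = 0\<rparr>"

text \<open>
  The relations presenting the \<open>n\<close>-th exterior power of the module of absolute Kaehler
  differentials: additivity and the Leibniz rule in each slot, and the alternating law. All
  \<open>F\<close>-multiples of each relation are included, so the subgroup they generate is a submodule.
\<close>

inductive_set kaehler_relations :: "nat \<Rightarrow> ('a::field list \<Rightarrow>\<^sub>0 'a) set" for n :: nat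
  where
    add: "length (us @ x # vs) = n \<Longrightarrow>
      Poly_Mapping.single (us @ (x + y) # vs) f
        - Poly_Mapping.single (us @ x # vs) f - Poly_Mapping.single (us @ y # vs) f
      \<in> kaehler_relations n"
  | leibniz: "length (us @ x # vs) = n \<Longrightarrow>
      Poly_Mapping.single (us @ (x * y) # vs) f
        - Poly_Mapping.single (us @ y # vs) (f * x) - Poly_Mapping.single (us @ x # vs) (f * y)
      \<in> kaehler_relations n"
  | alternating: "length (us @ x # vs @ x # ws) = n \<Longrightarrow>
      Poly_Mapping.single (us @ x # vs @ x # ws) f \<in> kaehler_relations n"

definition null_forms :: "nat \<Rightarrow> ('a::field list \<Rightarrow>\<^sub>0 'a) set"
  where "null_forms n = generate (formal_forms n) (kaehler_relations n)"

definition Omega :: "nat \<Rightarrow> ('a::field list \<Rightarrow>\<^sub>0 'a) set monoid"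
  where "Omega n = formal_forms n Mod null_forms n"

text \<open>\<open>form f [x\<^sub>1, \<dots>, x\<^sub>n]\<close> is the differential \<open>f dx\<^sub>1 \<and> \<dots> \<and> dx\<^sub>n\<close>.\<close>

definition form :: "'a::field \<Rightarrow> 'a list \<Rightarrow> ('a list \<Rightarrow>\<^sub>0 'a) set"
  where "form f xs = null_forms (length xs) #>\<^bsub>formal_forms (length xs)\<^esub> Poly_Mapping.single xs f"

definition dlog_form :: "'a::field \<Rightarrow> 'a list \<Rightarrow> ('a list \<Rightarrow>\<^sub>0 'a) set"
  where "dlog_form \<alpha> bs = form (\<alpha> * prod_list (map inverse bs)) bs"

text \<open>
  \<open>d\<Omega>\<^sup>n\<^sup>-\<^sup>1\<close>: as \<open>d\<close> is additive and sends \<open>f dx\<^sub>1 \<and> \<dots> \<and> dx\<^sub>n\<^sub>-\<^sub>1\<close> to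
  \<open>df \<and> dx\<^sub>1 \<and> \<dots> \<and> dx\<^sub>n\<^sub>-\<^sub>1\<close>, its image is the subgroup generated by the latter elements.
\<close>

definition exact_forms :: "nat \<Rightarrow> ('a::field list \<Rightarrow>\<^sub>0 'a) set set"
  where "exact_forms n = generate (Omega n) {form 1 (f # xs) | f xs. length (f # xs) = n}"

definition Omega_mod_exact :: "nat \<Rightarrow> ('a::field list \<Rightarrow>\<^sub>0 'a) set set monoid"
  where "Omega_mod_exact n = Omega n Mod exact_forms n"

text \<open>
  The image of the Artin-Schreier map. The map is additive and the elements
  \<open>\<alpha> dlog \<beta>\<^sub>1 \<and> \<dots> \<and> dlog \<beta>\<^sub>n\<close> generate \<open>\<Omega>\<^sup>n\<close> as a group, so the image is generated by the values on
  these elements.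
\<close>

definition artin_schreier_image :: "nat \<Rightarrow> ('a::field list \<Rightarrow>\<^sub>0 'a) set set set"
  where "artin_schreier_image n = generate (Omega_mod_exact n)
    {exact_forms n #>\<^bsub>Omega n\<^esub> dlog_form (\<alpha>\<^sup>2 - \<alpha>) bs | \<alpha> bs. length bs = n \<and> 0 \<notin> set bs}"

text \<open>
  \<open>kato_milne n\<close> is \<open>H\<^sub>2\<^sup>n\<^sup>+\<^sup>1(F)\<close>; note the shift. \<open>kato_milne_symbol \<alpha> [\<beta>\<^sub>1, \<dots>, \<beta>\<^sub>n]\<close> is the class in
  it of \<open>\<alpha> dlog \<beta>\<^sub>1 \<and> \<dots> \<and> dlog \<beta>\<^sub>n\<close>.
\<close>

definition kato_milne :: "nat \<Rightarrow> ('a::field list \<Rightarrow>\<^sub>0 'a) set set set monoid"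
  where "kato_milne n = Omega_mod_exact n Mod artin_schreier_image n"

definition kato_milne_symbol :: "'a::field \<Rightarrow> 'a list \<Rightarrow> ('a list \<Rightarrow>\<^sub>0 'a) set set set"
  where "kato_milne_symbol \<alpha> bs = artin_schreier_image (length bs)
    #>\<^bsub>Omega_mod_exact (length bs)\<^esub> (exact_forms (length bs) #>\<^bsub>Omega (length bs)\<^esub> dlog_form \<alpha> bs)"

lemma comm_group_formal_forms: "comm_group (formal_forms n :: ('a::field list \<Rightarrow>\<^sub>0 'a) monoid)"
proof (rule comm_groupI, goal_cases)
  case (1 x y)
  then show ?case using Poly_Mapping.keys_add[of x y] by (auto simp: formal_forms_def)
next
  case (6 x)
  then show ?case by (auto simp: formal_forms_def intro!: exI[of _ "- x"])
qed (auto simp: formal_forms_def algebra_simps)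

lemma kaehler_relations_subset: "kaehler_relations n \<subseteq> carrier (formal_forms n)"
proof -
  have diff: "p - q \<in> carrier (formal_forms m)"
    if "p \<in> carrier (formal_forms m)" "q \<in> carrier (formal_forms m)"
    for m and p q :: "'a list \<Rightarrow>\<^sub>0 'a"
    using that Poly_Mapping.keys_diff[of p q] by (auto simp: formal_forms_def)
  have single: "Poly_Mapping.single xs f \<in> carrier (formal_forms m)" if "length xs = m"
    for m and xs :: "'a list" and f
    using that by (auto simp: formal_forms_def)
  show ?thesis
    by (auto elim!: kaehler_relations.cases intro!: diff single)
qed

lemma comm_group_Mod_generate:
  assumes "comm_group G" "S \<subseteq> carrier G"
  shows "comm_group (G Mod generate G S)"
  using assms comm_group.abelian_FactGroup group.generate_is_subgroup comm_group.axioms(2) by blast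

lemma comm_group_Omega: "comm_group (Omega n)"
  unfolding Omega_def null_forms_def
  by (intro comm_group_Mod_generate comm_group_formal_forms kaehler_relations_subset)

lemma form_in_Omega: "length xs = n \<Longrightarrow> form f xs \<in> carrier (Omega n)"
  by (auto simp: form_def Omega_def carrier_FactGroup formal_forms_def)

lemma comm_group_Omega_mod_exact: "comm_group (Omega_mod_exact n)"
  unfolding Omega_mod_exact_def exact_forms_def
  by (intro comm_group_Mod_generate comm_group_Omega) (auto intro!: form_in_Omega)

lemma comm_group_kato_milne: "comm_group (kato_milne n)"
  unfolding kato_milne_def artin_schreier_image_def
  by (intro comm_group_Mod_generate comm_group_Omega_mod_exact)
     (auto simp: Omega_mod_exact_def carrier_FactGroup dlog_form_def intro!: imageI form_in_Omega)

lemma kato_milne_symbol_in_carrier: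
  "length bs = n \<Longrightarrow> kato_milne_symbol \<alpha> bs \<in> carrier (kato_milne n)"
  by (auto simp: kato_milne_symbol_def kato_milne_def Omega_mod_exact_def carrier_FactGroup
      dlog_form_def intro!: imageI form_in_Omega)

end

theory Submission
  imports Defs
begin

text \<open>
  Write \<open>N = [1, a]\<close>, \<open>n\<^sub>Q = N \<perp> cN\<close> and \<open>\<pi> = n\<^sub>Q \<perp> b n\<^sub>Q\<close>. The form \<open>\<phi>\<^sub>1\<close> is a subform of the
  Pfister form \<open>\<pi>\<close>. An isotropic vector of \<open>\<pi>\<close> writes \<open>c\<close> as a quotient of norms from \<open>[a, b)\<close>, which
  kills the symbol because \<open>a dlog n\<close> vanishes for values \<open>n\<close> of \<open>N\<close>; so \<open>\<phi>\<^sub>1\<close> is anisotropic. A point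
  of the conic gives an explicit isotropic vector over \<open>F\<^sub>Q\<close>.

  For minimality it suffices to consider a hyperplane, that is, a form \<open>q\<close> of dimension 4. As
  \<open>F\<^sub>Q = F(s)(\<rho>)\<close> with \<open>\<rho>\<^sup>2 = c(s\<^sup>2 + s + a)\<close>, an isotropic vector is a pair of polynomial vectors.
  Rost's degree reduction replaces a plane \<open>\<lambda>N\<close> of \<open>q\<close> by \<open>c\<lambda>N\<close> and lowers the degree, and a count of
  isotropic subspaces shows that in dimension 4 it never has to be used: \<open>q\<close> contains a multiple of
  \<open>N \<perp> \<langle>c\<rangle>\<close>. The same count in \<open>\<pi> \<perp> m n\<^sub>Q\<close> shows that a multiple of \<open>n\<^sub>Q\<close> and the complement of \<open>\<phi>\<^sub>1\<close>
  in \<open>\<pi>\<close>, the pure part of the norm form of \<open>[a + b, bc)\<close>, share a plane. Then elements of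
  \<open>[a, c)\<close> and \<open>[a + b, bc)\<close> have equal trace and norm, and \<open>[a, b) \<otimes> [b, c) \<cong> [a, c) \<otimes> [a + b, bc)\<close>
  has zero divisors.
\<close>

section \<open>Triviality of symbols in Kato-Milne cohomology\<close>

text \<open>The degree reduction has a price: it changes the form, so a conic found by induction
  lies in the twisted form \<open>B\<close> and not in the given form \<open>A\<close>. Dimension 4
  removes this obstacle. The conic has dimension 3 and the twisted plane dimension 2, so they meet,
  which makes the scalar of the conic a value of \<open>l n\<^sub>Q\<close>. Hence
  \<open>B \<perp> l n\<^sub>Q\<close> has an isotropic 3-space, while \<open>A\<close> is what
  remains of it after an isotropic plane is divided out; a vector survives and \<open>A\<close>
  would be isotropic. In the second count, \<open>\<pi> \<perp> m n\<^sub>Q\<close> contains a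
  6-space built from an isotropic 3-space and the complement of \<open>\<phi>\<^sub>1\<close>.
  Dividing out an isotropic 4-space leaves a multiple of \<open>n\<^sub>Q\<close>, in which at least
  2 dimensions of the complement survive. Polar forms in odd dimension are degenerate in
  characteristic 2, so both counts are phrased through a pairing of two subspaces that may be
  degenerate.\<close>

lemma comm_group_Mod_coset:
  assumes "comm_group G" "S \<subseteq> carrier G"
  shows "(\<lambda>x. generate G S #>\<^bsub>G\<^esub> x) \<in> hom G (G Mod generate G S)"
    and "x \<in> S \<Longrightarrow> generate G S #>\<^bsub>G\<^esub> x = \<one>\<^bsub>G Mod generate G S\<^esub>"
proof -
  interpret comm_group G by fact
  have sub: "subgroup (generate G S) G"
    using assms(2) by (rule generate_is_subgroup)
  then interpret normal "generate G S" G
    by (simp add: subgroup_imp_normal)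
  show "(\<lambda>x. generate G S #>\<^bsub>G\<^esub> x) \<in> hom G (G Mod generate G S)"
    by (rule r_coset_hom_Mod)
  show "x \<in> S \<Longrightarrow> generate G S #>\<^bsub>G\<^esub> x = \<one>\<^bsub>G Mod generate G S\<^esub>"
    using coset_join2[OF _ sub, of x] assms(2) by (auto simp: FactGroup_def intro: generate.incl)
qed

text \<open>The composite of the three quotient maps. Triviality of a class becomes membership of a
  formal sum in one kernel, and nested cosets never have to be manipulated.\<close>

definition kato_milne_class :: "nat \<Rightarrow> ('a::field list \<Rightarrow>\<^sub>0 'a) \<Rightarrow> ('a list \<Rightarrow>\<^sub>0 'a) set set set"
  where "kato_milne_class n p = artin_schreier_image n #>\<^bsub>Omega_mod_exact n\<^esub>
    (exact_forms n #>\<^bsub>Omega n\<^esub> (null_forms n #>\<^bsub>formal_forms n\<^esub> p))"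

lemma null_coset_hom:
  "(\<lambda>p. null_forms n #>\<^bsub>formal_forms n\<^esub> p) \<in> hom (formal_forms n) (Omega n)"
  and null_coset_one: "p \<in> kaehler_relations n \<Longrightarrow> null_forms n #>\<^bsub>formal_forms n\<^esub> p = \<one>\<^bsub>Omega n\<^esub>"
  unfolding Omega_def null_forms_def
  by (rule comm_group_Mod_coset[OF comm_group_formal_forms kaehler_relations_subset]; assumption)+

lemma exact_coset_hom:
  "(\<lambda>p. exact_forms n #>\<^bsub>Omega n\<^esub> p) \<in> hom (Omega n) (Omega_mod_exact n)"
  and exact_coset_one:
  "length (f # xs) = n \<Longrightarrow> exact_forms n #>\<^bsub>Omega n\<^esub> form 1 (f # xs) = \<one>\<^bsub>Omega_mod_exact n\<^esub>"
proof -
  let ?S = "{form 1 (f # xs) | f xs. length (f # xs) = n}"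
  have S: "?S \<subseteq> carrier (Omega n)"
    by (auto intro!: form_in_Omega)
  note * = comm_group_Mod_coset[OF comm_group_Omega S]
  show "(\<lambda>p. exact_forms n #>\<^bsub>Omega n\<^esub> p) \<in> hom (Omega n) (Omega_mod_exact n)"
    unfolding Omega_mod_exact_def exact_forms_def by (rule *)
  show "length (f # xs) = n \<Longrightarrow> exact_forms n #>\<^bsub>Omega n\<^esub> form 1 (f # xs) = \<one>\<^bsub>Omega_mod_exact n\<^esub>"
    unfolding Omega_mod_exact_def exact_forms_def by (rule *) auto
qed

lemma artin_schreier_coset_hom:
  "(\<lambda>p. artin_schreier_image n #>\<^bsub>Omega_mod_exact n\<^esub> p) \<in> hom (Omega_mod_exact n) (kato_milne n)"
  and artin_schreier_coset_one:
  "length bs = n \<Longrightarrow> 0 \<notin> set bs \<Longrightarrow> artin_schreier_image n #>\<^bsub>Omega_mod_exact n\<^esub>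
     (exact_forms n #>\<^bsub>Omega n\<^esub> dlog_form (\<alpha>\<^sup>2 - \<alpha>) bs) = \<one>\<^bsub>kato_milne n\<^esub>"
proof -
  let ?S = "{exact_forms n #>\<^bsub>Omega n\<^esub> dlog_form (\<alpha>\<^sup>2 - \<alpha>) bs | \<alpha> bs. length bs = n \<and> 0 \<notin> set bs}"
  have S: "?S \<subseteq> carrier (Omega_mod_exact n)"
    using exact_coset_hom by (auto simp: dlog_form_def hom_def intro!: form_in_Omega)
  note * = comm_group_Mod_coset[OF comm_group_Omega_mod_exact S]
  show "(\<lambda>p. artin_schreier_image n #>\<^bsub>Omega_mod_exact n\<^esub> p) \<in> hom (Omega_mod_exact n) (kato_milne n)"
    unfolding kato_milne_def artin_schreier_image_def by (rule *)
  show "length bs = n \<Longrightarrow> 0 \<notin> set bs \<Longrightarrow> artin_schreier_image n #>\<^bsub>Omega_mod_exact n\<^esub>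
     (exact_forms n #>\<^bsub>Omega n\<^esub> dlog_form (\<alpha>\<^sup>2 - \<alpha>) bs) = \<one>\<^bsub>kato_milne n\<^esub>"
    unfolding kato_milne_def artin_schreier_image_def by (rule *) auto
qed

lemma kato_milne_class_hom: "group_hom (formal_forms n) (kato_milne n) (kato_milne_class n)"
proof -
  have "kato_milne_class n \<in> hom (formal_forms n) (kato_milne n)"
    using hom_compose[OF hom_compose[OF null_coset_hom exact_coset_hom] artin_schreier_coset_hom]
    by (simp add: comp_def kato_milne_class_def[abs_def])
  then show ?thesis
    using comm_group_formal_forms comm_group_kato_milne
    by (auto simp: group_hom_def group_hom_axioms_def comm_group_def)
qed

definition null_class :: "nat \<Rightarrow> ('a::field list \<Rightarrow>\<^sub>0 'a) \<Rightarrow> bool"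
  where "null_class n p \<longleftrightarrow> p \<in> kernel (formal_forms n) (kato_milne n) (kato_milne_class n)"

lemma null_class_subgroup: "subgroup {p. null_class n p} (formal_forms n)"
  unfolding null_class_def using group_hom.subgroup_kernel[OF kato_milne_class_hom] by simp

lemma null_class_add: "null_class n p \<Longrightarrow> null_class n q \<Longrightarrow> null_class n (p + q)"
  using subgroup.m_closed[OF null_class_subgroup, of p n q] by (simp add: formal_forms_def)

lemma null_class_uminus: "null_class n p \<Longrightarrow> null_class n (- p)"
proof -
  assume p: "null_class n p"
  interpret comm_group "formal_forms n :: ('a list \<Rightarrow>\<^sub>0 'a) monoid"
    by (rule comm_group_formal_forms)
  have "p \<in> carrier (formal_forms n)"
    using p by (simp add: null_class_def kernel_def)
  then have "inv\<^bsub>formal_forms n\<^esub> p = - p"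
    by (intro inv_equality) (auto simp: formal_forms_def)
  then show "null_class n (- p)"
    using subgroup.m_inv_closed[OF null_class_subgroup, of p n] p by simp
qed

lemma null_class_diff: "null_class n p \<Longrightarrow> null_class n q \<Longrightarrow> null_class n (p - q)"
  using null_class_add[OF _ null_class_uminus, of n p q] by simp

lemma null_class_relation:
  assumes "p \<in> kaehler_relations n" shows "null_class n p"
proof -
  have "kato_milne_class n p = \<one>\<^bsub>kato_milne n\<^esub>"
    by (simp add: kato_milne_class_def null_coset_one[OF assms] hom_one[OF exact_coset_hom]
        hom_one[OF artin_schreier_coset_hom] comm_group.axioms(2) comm_group_Omega
        comm_group_Omega_mod_exact comm_group_kato_milne)
  then show ?thesis
    using assms kaehler_relations_subset by (auto simp: null_class_def kernel_def)
qed

lemma null_class_exact: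
  assumes "length (f # xs) = n"
  shows "null_class n (Poly_Mapping.single (f # xs) 1)"
proof -
  have "kato_milne_class n (Poly_Mapping.single (f # xs) 1) = \<one>\<^bsub>kato_milne n\<^esub>"
    using exact_coset_one[OF assms] assms
    by (auto simp: kato_milne_class_def form_def hom_one[OF artin_schreier_coset_hom]
        comm_group.axioms(2) comm_group_Omega_mod_exact comm_group_kato_milne)
  then show ?thesis
    using assms by (auto simp: null_class_def kernel_def formal_forms_def)
qed

lemma kato_milne_symbol_eq_class:
  "kato_milne_symbol \<alpha> bs =
    kato_milne_class (length bs) (Poly_Mapping.single bs (\<alpha> * prod_list (map inverse bs)))"
  by (simp add: kato_milne_symbol_def kato_milne_class_def dlog_form_def form_def)

lemma null_class_symbol:
  "null_class (length bs) (Poly_Mapping.single bs (\<alpha> * prod_list (map inverse bs))) \<longleftrightarrow>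
    kato_milne_symbol \<alpha> bs = \<one>\<^bsub>kato_milne (length bs)\<^esub>"
  by (auto simp: kato_milne_symbol_eq_class null_class_def kernel_def formal_forms_def)

lemma kato_milne_symbol_artin_schreier:
  "0 \<notin> set bs \<Longrightarrow> kato_milne_symbol (\<alpha>\<^sup>2 - \<alpha>) bs = \<one>\<^bsub>kato_milne (length bs)\<^esub>"
  by (simp add: kato_milne_symbol_def artin_schreier_coset_one)


section \<open>Calculus of symbols in \<open>H\<^sub>2\<^sup>3(F)\<close>\<close>

lemma null_class_slot1_add:
  "null_class 2 (Poly_Mapping.single [x + x', y] f
    - Poly_Mapping.single [x, y] f - Poly_Mapping.single [x', y] f)"
  using null_class_relation[OF kaehler_relations.add[of "[]" x "[y]" 2 x' f]] by simp

lemma null_class_slot2_add: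
  "null_class 2 (Poly_Mapping.single [x, y + y'] f
    - Poly_Mapping.single [x, y] f - Poly_Mapping.single [x, y'] f)"
  using null_class_relation[OF kaehler_relations.add[of "[x]" y "[]" 2 y' f]] by simp

lemma null_class_slot1_mult:
  "null_class 2 (Poly_Mapping.single [x * x', y] f
    - Poly_Mapping.single [x', y] (f * x) - Poly_Mapping.single [x, y] (f * x'))"
  using null_class_relation[OF kaehler_relations.leibniz[of "[]" x "[y]" 2 x' f]] by simp

lemma null_class_slot2_mult:
  "null_class 2 (Poly_Mapping.single [x, y * y'] f
    - Poly_Mapping.single [x, y'] (f * y) - Poly_Mapping.single [x, y] (f * y'))"
  using null_class_relation[OF kaehler_relations.leibniz[of "[x]" y "[]" 2 y' f]] by simp

lemma null_class_alternating: "null_class 2 (Poly_Mapping.single [x, x] f)"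
  using null_class_relation[OF kaehler_relations.alternating[of "[]" x "[]" "[]" 2 f]] by simp

text \<open>Two out of three: additivity and the Leibniz rule both have the shape
  \<open>p - q - r\<close>.\<close>

lemma null_class_cancel:
  assumes "null_class n (p - q - r)"
  shows "null_class n q \<Longrightarrow> null_class n r \<Longrightarrow> null_class n p"
    and "null_class n p \<Longrightarrow> null_class n q \<Longrightarrow> null_class n r"
    and "null_class n p \<Longrightarrow> null_class n r \<Longrightarrow> null_class n q"
  using null_class_add[OF null_class_add[OF assms], of q r]
    null_class_diff[OF null_class_diff[OF _ assms], of p q]
    null_class_diff[OF null_class_diff[OF _ assms], of p r]
  by (simp_all add: algebra_simps)

text \<open>\<open>d1 = 0\<close>: the Leibniz rule for \<open>1 * 1\<close> has the shape
  \<open>X - X - X\<close>.\<close>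

lemma null_class_one: "null_class 2 (Poly_Mapping.single [1, y] f)"
  "null_class 2 (Poly_Mapping.single [x, 1] f)"
  using null_class_uminus[OF null_class_slot1_mult[of 1 1 y f]]
    null_class_uminus[OF null_class_slot2_mult[of x 1 1 f]]
  by simp_all

text \<open>The usual polarisation of the alternating law, carried out by moving between
  \<open>x\<close>, \<open>y\<close> and \<open>x + y\<close> one slot at a time.\<close>

lemma null_class_swap:
  assumes "null_class 2 (Poly_Mapping.single [x, y] f)"
  shows "null_class 2 (Poly_Mapping.single [y, x] f)"
proof -
  have "null_class 2 (Poly_Mapping.single [x, x + y] f)"
    by (rule null_class_cancel(1)[OF null_class_slot2_add null_class_alternating assms])
  then have "null_class 2 (Poly_Mapping.single [y, x + y] f)"
    by (rule null_class_cancel(2)[OF null_class_slot1_add null_class_alternating])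
  then show ?thesis
    by (rule null_class_cancel(3)[OF null_class_slot2_add _ null_class_alternating])
qed

text \<open>Triviality of \<open>f dlog x \<and> dlog y\<close>. Division by zero gives the
  coefficient 0, so a symbol with a zero entry counts as trivial.\<close>

definition trivial_symbol :: "'a::field \<Rightarrow> 'a \<Rightarrow> 'a \<Rightarrow> bool"
  where "trivial_symbol f x y \<longleftrightarrow> null_class 2 (Poly_Mapping.single [x, y] (f / (x * y)))"

lemma trivial_symbol_iff:
  "trivial_symbol \<alpha> x y \<longleftrightarrow> kato_milne_symbol \<alpha> [x, y] = \<one>\<^bsub>kato_milne 2\<^esub>"
  using null_class_symbol[of "[x, y]" \<alpha>]
  by (simp add: trivial_symbol_def field_simps numeral_2_eq_2)

lemma trivial_symbol_swap: "trivial_symbol f x y \<Longrightarrow> trivial_symbol f y x"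
  using null_class_swap by (auto simp: trivial_symbol_def mult.commute)

lemma trivial_symbol_same: "trivial_symbol f x x"
  by (simp add: trivial_symbol_def null_class_alternating)

lemma trivial_symbol_add:
  assumes "trivial_symbol f x y" "trivial_symbol g x y"
  shows "trivial_symbol (f + g) x y"
  using null_class_add[OF assms[unfolded trivial_symbol_def]]
  by (simp add: trivial_symbol_def single_add[symmetric] add_divide_distrib)

lemma trivial_symbol_mult:
  assumes "x \<noteq> 0" "x' \<noteq> 0"
  shows "trivial_symbol f x y \<Longrightarrow> trivial_symbol f x' y \<Longrightarrow> trivial_symbol f (x * x') y"
    and "trivial_symbol f (x * x') y \<Longrightarrow> trivial_symbol f x y \<Longrightarrow> trivial_symbol f x' y"
    and "trivial_symbol f (x * x') y \<Longrightarrow> trivial_symbol f x' y \<Longrightarrow> trivial_symbol f x y"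
proof -
  have "null_class 2 (Poly_Mapping.single [x * x', y] (f / (x * x' * y))
    - Poly_Mapping.single [x', y] (f / (x' * y)) - Poly_Mapping.single [x, y] (f / (x * y)))"
    using null_class_slot1_mult[of x x' y "f / (x * x' * y)"] assms by simp
  note * = null_class_cancel[OF this]
  show "trivial_symbol f x y \<Longrightarrow> trivial_symbol f x' y \<Longrightarrow> trivial_symbol f (x * x') y"
    "trivial_symbol f (x * x') y \<Longrightarrow> trivial_symbol f x y \<Longrightarrow> trivial_symbol f x' y"
    "trivial_symbol f (x * x') y \<Longrightarrow> trivial_symbol f x' y \<Longrightarrow> trivial_symbol f x y"
    unfolding trivial_symbol_def by (rule *; assumption)+
qed

lemma trivial_symbol_mult2:
  assumes "y \<noteq> 0" "y' \<noteq> 0"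
  shows "trivial_symbol f x y \<Longrightarrow> trivial_symbol f x y' \<Longrightarrow> trivial_symbol f x (y * y')"
    and "trivial_symbol f x (y * y') \<Longrightarrow> trivial_symbol f x y \<Longrightarrow> trivial_symbol f x y'"
    and "trivial_symbol f x (y * y') \<Longrightarrow> trivial_symbol f x y' \<Longrightarrow> trivial_symbol f x y"
  using trivial_symbol_mult[OF assms, of f x] trivial_symbol_swap by blast+

text \<open>\<open>d(1 + x) = dx\<close>, so the form is a multiple of
  \<open>dx \<and> dx\<close>.\<close>

lemma trivial_symbol_one_plus:
  "trivial_symbol f x (1 + x)"
  unfolding trivial_symbol_def
  by (rule null_class_cancel(1)[OF null_class_slot2_add null_class_one(2) null_class_alternating])

lemma trivial_symbol_artin_schreier:
  "x \<noteq> 0 \<Longrightarrow> y \<noteq> 0 \<Longrightarrow> trivial_symbol (t\<^sup>2 - t) x y"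
  using kato_milne_symbol_artin_schreier[of "[x, y]" t] by (simp add: trivial_symbol_iff numeral_2_eq_2)

text \<open>\<open>x dlog x \<and> dlog y = y^-1 dx \<and> dy\<close> differs from the exact form
  \<open>d(x y^-1) \<and> dy\<close> by a multiple of \<open>d(y^-1) \<and> dy\<close>, and the
  latter vanishes by the Leibniz rule for \<open>y y^-1 = 1\<close>.\<close>

lemma trivial_symbol_exact:
  assumes "x \<noteq> 0" "y \<noteq> 0"
  shows "trivial_symbol x x y"
proof -
  have "null_class 2 (Poly_Mapping.single [y * inverse y, y] (x * inverse y))"
    using assms by (simp add: null_class_one)
  then have "null_class 2 (Poly_Mapping.single [inverse y, y] (x * inverse y * y))"
    by (rule null_class_cancel(3)[OF null_class_slot1_mult _ null_class_alternating])
  then have inv: "null_class 2 (Poly_Mapping.single [inverse y, y] x)"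
    using assms by (simp add: mult.assoc)
  have ex: "null_class 2 (Poly_Mapping.single [x * inverse y, y] 1)"
    by (rule null_class_exact) simp
  have "null_class 2 (Poly_Mapping.single [x, y] (1 * inverse y))"
    by (rule null_class_cancel(2)[OF null_class_slot1_mult ex]) (simp add: inv)
  then show ?thesis
    using assms by (simp add: trivial_symbol_def field_simps)
qed


section \<open>Symbols with norms as entries\<close>

definition nform :: "'a::comm_ring_1 \<Rightarrow> 'a \<Rightarrow> 'a \<Rightarrow> 'a"
  where "nform a x y = x\<^sup>2 + x * y + a * y\<^sup>2"

lemma char2_simps:
  fixes x y :: "'a::comm_ring_1"
  assumes "(2::'a) = 0"
  shows "x + x = 0" "x + (x + y) = y" "- x = x" "x - y = x + y"
proof -
  show *: "x + x = 0" for x :: 'a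
    using assms mult_2[of x] by simp
  show "x + (x + y) = y"
    by (simp add: add.assoc[symmetric] *)
  show **: "- x = x" for x :: 'a
    using *[of x] by (simp add: minus_unique)
  show "x - y = x + y"
    using **[of y] diff_conv_add_uminus[of x y] by simp
qed

lemma trivial_symbol_square:
  assumes two: "(2::'a::field) = 0"
  shows "trivial_symbol f (x * x :: 'a) y"
proof (cases "x = 0")
  case False
  let ?S = "Poly_Mapping.single [x, y] (f / (x * y))"
  have "null_class 2 (Poly_Mapping.single [x * x, y] (f / (x * x * y)) - ?S - ?S)"
    using null_class_slot1_mult[of x x y "f / (x * x * y)"] False by simp
  moreover have "?S + ?S = 0"
    by (simp add: single_add[symmetric] char2_simps(1)[OF two] del: mult_2)
  ultimately show ?thesis
    by (simp add: trivial_symbol_def diff_diff_eq)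
qed (use trivial_symbol_same[of f 0] in \<open>simp add: trivial_symbol_def\<close>)

lemma trivial_symbol_if_nform_isotropic:
  assumes two: "(2::'a::field) = 0"
    and "nform a u v = 0" "u \<noteq> 0 \<or> v \<noteq> 0" and xy: "x \<noteq> 0" "y \<noteq> (0::'a)"
  shows "trivial_symbol a x y"
proof -
  have v: "v \<noteq> 0"
    using assms by (auto simp: nform_def)
  have "a = (u / v)\<^sup>2 - u / v"
    using v assms(2) eq_neg_iff_add_eq_0[of "u * u" "u * v + a * (v * v)"]
    by (simp add: nform_def field_simps power2_eq_square char2_simps[OF two])
  then show ?thesis
    using trivial_symbol_artin_schreier xy by metis
qed

text \<open>Up to the square \<open>v^2\<close>, a value of \<open>N\<close> is
  \<open>a' = a + (t^2 - t)\<close>. Then \<open>a dlog a' = a' dlog a' + (t^2 - t) dlog a'\<close>,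
  which after wedging with \<open>dlog z\<close> is an exact form plus an Artin-Schreier
  value.\<close>

lemma trivial_symbol_nform:
  assumes two: "(2::'a::field) = 0"
    and n: "nform a u v \<noteq> 0" and z: "z \<noteq> (0::'a)"
  shows "trivial_symbol a (nform a u v) z"
proof (cases "v = 0")
  case True
  then show ?thesis
    using trivial_symbol_square[OF two, of a u z] by (simp add: nform_def power2_eq_square)
next
  case False
  note two_simps = char2_simps[OF two]
  define t a' where "t = u / v" and "a' = a + (t\<^sup>2 - t)"
  have n_eq: "nform a u v = (v * v) * a'"
    using False by (simp add: nform_def a'_def t_def field_simps power2_eq_square two_simps)
  then have a': "a' \<noteq> 0"
    using n by auto
  have "a = a' + (t\<^sup>2 - t)"
    by (simp add: a'_def algebra_simps two_simps)
  then have "trivial_symbol a a' z"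
    using trivial_symbol_add[OF trivial_symbol_exact trivial_symbol_artin_schreier] a' z by metis
  then show ?thesis
    unfolding n_eq using False a' by (intro trivial_symbol_mult(1) trivial_symbol_square two) auto
qed

text \<open>In the generic case write \<open>n + b m = n (1 + b')\<close> with
  \<open>b' = b m / n\<close>. Values of \<open>N\<close> contribute nothing to either slot, so the
  symbol reduces to \<open>a dlog b' \<and> dlog (1 + b')\<close>.\<close>

lemma trivial_symbol_quaternion_norm:
  assumes two: "(2::'a::field) = 0" and b: "b \<noteq> 0"
    and n: "nform a u v + b * nform a u' v' \<noteq> (0::'a)" (is "?d \<noteq> 0")
  shows "trivial_symbol a b ?d"
proof -
  let ?n = "nform a u v" and ?m = "nform a u' v'"
  consider "?m = 0" | "?m \<noteq> 0" "?n = 0" | "?m \<noteq> 0" "?n \<noteq> 0"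
    by blast
  then show ?thesis
  proof cases
    case 1
    then show ?thesis
      using trivial_symbol_swap[OF trivial_symbol_nform[OF two _ b]] n by simp
  next
    case 2
    then show ?thesis
      using trivial_symbol_mult2(1)[OF b 2(1) trivial_symbol_same
          trivial_symbol_swap[OF trivial_symbol_nform[OF two 2(1) b]]] by simp
  next
    case 3
    define b' where "b' = b * ?m / ?n"
    have b': "b' \<noteq> 0" and d: "(1 + b') * ?n = ?d"
      using 3 b by (simp_all add: b'_def field_simps)
    have "trivial_symbol a b' ((1 + b') * ?n)"
      using d n 3 b'
      by (intro trivial_symbol_mult2(1) trivial_symbol_one_plus
          trivial_symbol_swap[OF trivial_symbol_nform[OF two]]) auto
    then have "trivial_symbol a (b' * ?n) ?d"
      using b' 3 n trivial_symbol_mult(1) trivial_symbol_nform[OF two] d by metis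
    then have "trivial_symbol a (b * ?m) ?d"
      using 3 by (simp add: b'_def)
    then show ?thesis
      using b 3 n trivial_symbol_mult(3) trivial_symbol_nform[OF two] by metis
  qed
qed

theorem pfister_isotropic_imp_trivial_symbol:
  fixes a b c :: "'a::field"
  assumes two: "(2::'a) = 0" and b: "b \<noteq> 0" and c: "c \<noteq> 0"
    and z: "nform a x0 x1 + b * nform a x2 x3 + c * (nform a x4 x5 + b * nform a x6 x7) = 0"
    and nz: "(x0, x1, x2, x3, x4, x5, x6, x7) \<noteq> (0, 0, 0, 0, 0, 0, 0, 0)"
  shows "trivial_symbol a b c"
proof (cases "nform a x4 x5 + b * nform a x6 x7 = 0")
  case False
  let ?d1 = "nform a x0 x1 + b * nform a x2 x3" and ?d2 = "nform a x4 x5 + b * nform a x6 x7"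
  have d1: "?d1 = c * ?d2"
    using z char2_simps(3)[OF two] by (simp add: eq_neg_iff_add_eq_0[symmetric])
  then have "?d1 \<noteq> 0"
    using False c by simp
  from trivial_symbol_quaternion_norm[OF two b this]
  have "trivial_symbol a b (c * ?d2)"
    unfolding d1 .
  then show ?thesis
    using trivial_symbol_quaternion_norm[OF two b False] trivial_symbol_mult2(3) False c by metis
next
  \<comment> \<open>Both quaternion norms vanish here, so nothing is learnt about \<open>c\<close>.
    Instead either \<open>b\<close> is a quotient of values of \<open>N\<close>, or \<open>N\<close>
    is isotropic and \<open>a\<close> has the form \<open>t^2 - t\<close>.\<close>
  case True
  have key: "trivial_symbol a b c"
    if 0: "nform a u v + b * nform a u' v' = 0" and nz: "(u, v, u', v') \<noteq> (0, 0, 0, 0)"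
    for u v u' v'
  proof (cases "nform a u' v' = 0")
    case True
    then have "nform a u v = 0"
      using 0 by simp
    then show ?thesis
      using trivial_symbol_if_nform_isotropic[OF two _ _ b c, of a] True nz by blast
  next
    case False
    have "nform a u v = b * nform a u' v'"
      using 0 char2_simps(3)[OF two] by (simp add: eq_neg_iff_add_eq_0[symmetric])
    then show ?thesis
      using trivial_symbol_nform[OF two _ c, of a u v] trivial_symbol_nform[OF two False c]
        trivial_symbol_mult(3)[OF b False] False b by simp
  qed
  show ?thesis
    using key[OF True] key[of x0 x1 x2 x3] z True nz by auto
qed

section \<open>Linear algebra of a pairing of subspaces\<close>

context vector_space
begin

text \<open>Each element of \<open>W\<close> imposes one linear condition and therefore costs at
  most one dimension.\<close>

lemma ex_independent_annihilated:
  assumes "finite W" "finite B" "independent B"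
    and "\<And>w x y. w \<in> W \<Longrightarrow> \<beta> (x + y) w = \<beta> x w + \<beta> y w"
    and "\<And>w r x. w \<in> W \<Longrightarrow> \<beta> (scale r x) w = r * \<beta> x w"
  shows "\<exists>C. finite C \<and> C \<subseteq> span B \<and> independent C \<and> card B \<le> card C + card W \<and>
    (\<forall>x\<in>C. \<forall>w\<in>W. \<beta> x w = 0)"
  using assms(1,4,5)
proof (induction W rule: finite_induct)
  case empty
  then show ?case
    using assms(2,3) span_superset by auto
next
  case (insert w W)
  then obtain C where C: "finite C" "C \<subseteq> span B" "independent C" "card B \<le> card C + card W"
    "\<And>x w. x \<in> C \<Longrightarrow> w \<in> W \<Longrightarrow> \<beta> x w = 0"
    by (metis insertI2)
  show ?case
  proof (cases "\<exists>e\<in>C. \<beta> e w \<noteq> 0")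
    case False
    then show ?thesis
      using C insert.hyps by (intro exI[of _ C]) auto
  next
    case True
    then obtain e where e: "e \<in> C" "\<beta> e w \<noteq> 0"
      by blast
    \<comment> \<open>The projection along \<open>e\<close> onto the kernel of
      \<open>\<lambda>x. \<beta> x w\<close>. It respects the conditions already imposed by
      \<open>W\<close>, since \<open>e\<close> satisfies them.\<close>
    define g where "g x = x + scale (- (\<beta> x w / \<beta> e w)) e" for x
    obtain D where D: "D \<subseteq> g ` C" "independent D" "g ` C \<subseteq> span D"
      using maximal_independent_subset by blast
    have fin: "finite D"
      using D(1) C(1) finite_subset by blast
    have "C \<subseteq> span (insert e D)"
    proof
      fix x assume "x \<in> C"
      then have "g x \<in> span (insert e D)"
        using D(3) span_mono[of D "insert e D"] by blast
      then have "g x + scale (\<beta> x w / \<beta> e w) e \<in> span (insert e D)"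
        by (intro span_add span_scale) (auto intro: span_base)
      then show "x \<in> span (insert e D)"
        by (simp add: g_def)
    qed
    then have "card C \<le> card D + 1"
      using independent_span_bound[of "insert e D" C] fin C(3)
      by (simp add: card_insert_if split: if_splits)
    moreover have "D \<subseteq> span B"
    proof
      fix x assume "x \<in> D"
      then obtain y where y: "y \<in> C" "x = g y"
        using D(1) by blast
      have "y \<in> span B" "e \<in> span B"
        using C(2) e y by auto
      then show "x \<in> span B"
        unfolding y g_def by (intro span_add span_scale)
    qed
    moreover have "\<beta> x v = 0" if "x \<in> D" "v \<in> insert w W" for x v
    proof -
      obtain y where "y \<in> C" "x = g y"
        using D(1) \<open>x \<in> D\<close> by blast
      moreover have "\<beta> (g y) v = \<beta> y v - \<beta> y w / \<beta> e w * \<beta> e v"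
        unfolding g_def insert.prems[OF \<open>v \<in> insert w W\<close>] by simp
      ultimately show ?thesis
        using that C(5) e by auto
    qed
    ultimately show ?thesis
      using C(4) D(2) fin insert.hyps by (intro exI[of _ D]) auto
  qed
qed

text \<open>
  A pairing of subspaces \<open>P\<close> and \<open>J\<close> that vanishes on \<open>P \<times> (P \<inter> J)\<close> descends to
  \<open>P/(P \<inter> J) \<times> J/(P \<inter> J)\<close>, so its left kernel has dimension at least
  \<open>dim P - dim J\<close> modulo \<open>J\<close>.
\<close>

lemma ex_independent_orthogonal_mod:
  assumes P: "finite P" "independent P" and J: "finite J"
    and add: "\<And>x y z. \<beta> (x + y) z = \<beta> x z + \<beta> y z" "\<And>x y z. \<beta> x (y + z) = \<beta> x y + \<beta> x z"
    and scale: "\<And>r x y. \<beta> (scale r x) y = r * \<beta> x y" "\<And>r x y. \<beta> x (scale r y) = r * \<beta> x y"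
    and orth: "\<And>x y. x \<in> span P \<Longrightarrow> y \<in> span P \<Longrightarrow> y \<in> span J \<Longrightarrow> \<beta> x y = 0"
  shows "\<exists>C. finite C \<and> C \<subseteq> span P \<and> independent C \<and> card P \<le> card C + card J \<and>
    span C \<inter> span J = {0} \<and> (\<forall>x\<in>span C. \<forall>y\<in>span J. \<beta> x y = 0)"
proof -
  obtain B0 where B0: "B0 \<subseteq> span P \<inter> span J" "independent B0" "span P \<inter> span J \<subseteq> span B0"
    using maximal_independent_subset by blast
  obtain B1 where B1: "B0 \<subseteq> B1" "B1 \<subseteq> span P" "independent B1" "span P \<subseteq> span B1"
    using maximal_independent_subset_extend[of B0 "span P"] B0 by blast
  obtain B2 where B2: "B0 \<subseteq> B2" "B2 \<subseteq> span J" "independent B2" "span J \<subseteq> span B2"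
    using maximal_independent_subset_extend[of B0 "span J"] B0 by blast
  have fin: "finite B1" "finite B2" and cardJ: "card B2 \<le> card J"
    using independent_span_bound[OF P(1) B1(3,2)] independent_span_bound[OF J B2(3,2)] by auto
  have cardP: "card P \<le> card B1"
    using independent_span_bound[OF fin(1) P(2)] span_superset[of P] B1(4) by auto
  have fin0: "finite B0"
    using fin B1(1) finite_subset by blast
  have ind1: "independent (B1 - B0)"
    using B1(3) independent_mono by blast
  \<comment> \<open>By \<open>orth\<close> the vectors of \<open>B0\<close> impose no condition, so
    the complement \<open>B1 - B0\<close> is only subject to the conditions from
    \<open>B2 - B0\<close>. The two copies of \<open>card B0\<close> cancel in the count.\<close>
  obtain C where C: "finite C" "C \<subseteq> span (B1 - B0)" "independent C"
    "card (B1 - B0) \<le> card C + card (B2 - B0)" "\<And>x w. x \<in> C \<Longrightarrow> w \<in> B2 - B0 \<Longrightarrow> \<beta> x w = 0"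
    using ex_independent_annihilated[of "B2 - B0" "B1 - B0" \<beta>] fin ind1 add scale by auto
  have sub: "span C \<subseteq> span (B1 - B0)" "span C \<subseteq> span P"
    using C(2) B1(2) by (meson span_minimal subspace_span Diff_subset subset_trans)+
  have "card P \<le> card C + card J"
    using C(4) cardP cardJ card_Diff_subset[OF fin0 B1(1)] card_Diff_subset[OF fin0 B2(1)]
      card_mono[OF fin(1) B1(1)] card_mono[OF fin(2) B2(1)] by linarith
  moreover have "span C \<inter> span J = {0}"
  proof -
    have "x = 0" if "x \<in> span C" "x \<in> span J" for x
    proof -
      have x: "x \<in> span B0" "x \<in> span (B1 - B0)"
        using that sub B0(3) by auto
      then have "representation B1 x = representation B0 x"
        "representation B1 x = representation (B1 - B0) x"
        by (intro representation_extend[OF B1(3)]; use B1(1) in auto)+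
      then have "representation B1 x b = 0" for b
        using representation_ne_zero[of B0 x b] representation_ne_zero[of "B1 - B0" x b]
        by (metis DiffD2)
      then show "x = 0"
        using sum_nonzero_representation_eq[OF B1(3), of x] x(2) span_mono[of "B1 - B0" B1]
        by auto
    qed
    then show ?thesis
      using span_zero[of C] span_zero[of J] by auto
  qed
  moreover have "\<beta> x y = 0" if x: "x \<in> span C" and y: "y \<in> span J" for x y
  proof -
    have zero: "\<beta> x 0 = 0" "\<beta> 0 x = 0" for x
      using scale(2)[of x 0 0] scale(1)[of 0 0 x] by simp_all
    have "\<beta> x w = 0" if "w \<in> B2" for w
    proof (cases "w \<in> B0")
      case True
      then show ?thesis
        using orth[of x w] sub x B0(1) by auto
    next
      case False
      have "\<beta> x w = 0" using x
        by (induction rule: span_induct_alt) (use False that C(5) add scale zero in auto)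
      then show ?thesis .
    qed
    note w = this
    have "y \<in> span B2"
      using y B2(4) by blast
    then show ?thesis
      by (induction rule: span_induct_alt) (use w add scale zero in auto)
  qed
  moreover have "C \<subseteq> span P"
    using sub(2) span_superset by blast
  ultimately show ?thesis
    using C(1,3) by blast
qed

end

section \<open>Zero divisors in a tensor product of quaternion algebras\<close>

lemma alg_mult_nth: "alg_mult T x y $ k = (\<Sum>i\<in>UNIV. \<Sum>j\<in>UNIV. x $ i * y $ j * T i j $ k)"
  by (simp add: alg_mult_def)

lemma alg_mult_add_left: "alg_mult T (x + y) z = alg_mult T x z + alg_mult T y z"
  by (simp add: vec_eq_iff alg_mult_nth algebra_simps sum.distrib)

lemma alg_mult_add_right: "alg_mult T x (y + z) = alg_mult T x y + alg_mult T x z"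
  by (simp add: vec_eq_iff alg_mult_nth algebra_simps sum.distrib)

lemma alg_mult_zero: "alg_mult T 0 y = 0" "alg_mult T x 0 = 0"
  by (simp_all add: vec_eq_iff alg_mult_nth)

lemma alg_mult_axis_left: "alg_mult T (axis i 1) y $ k = (\<Sum>j\<in>UNIV. y $ j * T i j $ k)"
proof -
  have "alg_mult T (axis i 1) y $ k = (\<Sum>l\<in>UNIV. if l = i then (\<Sum>j\<in>UNIV. y $ j * T l j $ k) else 0)"
    unfolding alg_mult_nth by (rule sum.cong) (auto simp: axis_def)
  then show ?thesis by simp
qed

lemma alg_mult_axis_right: "alg_mult T x (axis j 1) $ k = (\<Sum>i\<in>UNIV. x $ i * T i j $ k)"
proof -
  have "(\<Sum>l\<in>UNIV. x $ i * axis j 1 $ l * T i l $ k) = (\<Sum>l\<in>UNIV. if l = j then x $ i * T i l $ k else 0)"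
    for i
    by (rule sum.cong) (auto simp: axis_def)
  then show ?thesis
    by (simp add: alg_mult_nth)
qed

lemma alg_mult_axis: "alg_mult T (axis i 1) (axis j 1) = T i j"
proof -
  have "alg_mult T (axis i 1) (axis j 1) $ k = (\<Sum>l\<in>UNIV. if l = j then T i l $ k else 0)" for k
    unfolding alg_mult_axis_left by (rule sum.cong) (auto simp: axis_def)
  then show ?thesis
    by (simp add: vec_eq_iff)
qed

text \<open>Associativity on basis vectors, as an identity between structure constants. In this
  shape both sides factor over a tensor product.\<close>

definition assoc_table :: "('a::field, 'n::finite) mult_table \<Rightarrow> bool"
  where "assoc_table T \<longleftrightarrow>
    (\<forall>i j k m. (\<Sum>l\<in>UNIV. T i j $ l * T l k $ m) = (\<Sum>l\<in>UNIV. T j k $ l * T i l $ m))"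

lemma assoc_table_iff:
  "assoc_table T \<longleftrightarrow> (\<forall>x y z. alg_mult T (alg_mult T x y) z = alg_mult T x (alg_mult T y z))"
proof safe
  assume *: "\<forall>x y z. alg_mult T (alg_mult T x y) z = alg_mult T x (alg_mult T y z)"
  have "(\<Sum>l\<in>UNIV. T i j $ l * T l k $ m) = (\<Sum>l\<in>UNIV. T j k $ l * T i l $ m)" for i j k m
    using arg_cong[OF *[rule_format, of "axis i 1" "axis j 1" "axis k 1"], of "\<lambda>v. v $ m"]
    by (simp add: alg_mult_axis alg_mult_axis_left alg_mult_axis_right)
  then show "assoc_table T"
    by (simp add: assoc_table_def)
next
  fix x y z
  assume T: "assoc_table T"
  let ?U = UNIV
  have "alg_mult T (alg_mult T x y) z $ m = alg_mult T x (alg_mult T y z) $ m" for m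
  proof -
    have "alg_mult T (alg_mult T x y) z $ m =
        (\<Sum>l\<in>?U. \<Sum>k\<in>?U. \<Sum>i\<in>?U. \<Sum>j\<in>?U. x $ i * y $ j * z $ k * (T i j $ l * T l k $ m))"
      by (simp only: alg_mult_nth sum_distrib_right sum_distrib_left, intro sum.cong refl) (simp only: mult_ac)
    also have "\<dots> = (\<Sum>k\<in>?U. \<Sum>l\<in>?U. \<Sum>i\<in>?U. \<Sum>j\<in>?U. x $ i * y $ j * z $ k * (T i j $ l * T l k $ m))"
      by (rule sum.swap)
    also have "\<dots> = (\<Sum>k\<in>?U. \<Sum>i\<in>?U. \<Sum>l\<in>?U. \<Sum>j\<in>?U. x $ i * y $ j * z $ k * (T i j $ l * T l k $ m))"
      by (intro sum.cong refl sum.swap)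
    also have "\<dots> = (\<Sum>k\<in>?U. \<Sum>i\<in>?U. \<Sum>j\<in>?U. \<Sum>l\<in>?U. x $ i * y $ j * z $ k * (T i j $ l * T l k $ m))"
      by (intro sum.cong refl sum.swap)
    also have "\<dots> = (\<Sum>k\<in>?U. \<Sum>i\<in>?U. \<Sum>j\<in>?U. x $ i * y $ j * z $ k * (\<Sum>l\<in>?U. T i j $ l * T l k $ m))"
      by (simp add: sum_distrib_left)
    also have "\<dots> = (\<Sum>k\<in>?U. \<Sum>i\<in>?U. \<Sum>j\<in>?U. x $ i * y $ j * z $ k * (\<Sum>l\<in>?U. T j k $ l * T i l $ m))"
      using T by (simp add: assoc_table_def)
    also have "\<dots> = (\<Sum>k\<in>?U. \<Sum>i\<in>?U. \<Sum>j\<in>?U. \<Sum>l\<in>?U. x $ i * y $ j * z $ k * (T j k $ l * T i l $ m))"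
      by (simp add: sum_distrib_left)
    also have "\<dots> = (\<Sum>i\<in>?U. \<Sum>k\<in>?U. \<Sum>j\<in>?U. \<Sum>l\<in>?U. x $ i * y $ j * z $ k * (T j k $ l * T i l $ m))"
      by (rule sum.swap)
    also have "\<dots> = (\<Sum>i\<in>?U. \<Sum>j\<in>?U. \<Sum>k\<in>?U. \<Sum>l\<in>?U. x $ i * y $ j * z $ k * (T j k $ l * T i l $ m))"
      by (intro sum.cong refl sum.swap)
    also have "\<dots> = (\<Sum>i\<in>?U. \<Sum>j\<in>?U. \<Sum>l\<in>?U. \<Sum>k\<in>?U. x $ i * y $ j * z $ k * (T j k $ l * T i l $ m))"
      by (intro sum.cong refl sum.swap)
    also have "\<dots> = (\<Sum>i\<in>?U. \<Sum>l\<in>?U. \<Sum>j\<in>?U. \<Sum>k\<in>?U. x $ i * y $ j * z $ k * (T j k $ l * T i l $ m))"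
      by (intro sum.cong refl sum.swap)
    also have "\<dots> = alg_mult T x (alg_mult T y z) $ m"
      by (simp only: alg_mult_nth sum_distrib_right sum_distrib_left, intro sum.cong refl) (simp only: mult_ac)
    finally show ?thesis .
  qed
  then show "alg_mult T (alg_mult T x y) z = alg_mult T x (alg_mult T y z)"
    by (simp add: vec_eq_iff)
qed

definition tensor_vec :: "'a::field ^ 'n::finite \<Rightarrow> 'a ^ 'm::finite \<Rightarrow> 'a ^ ('n \<times> 'm)"  (infixl \<open>\<otimes>\<^sub>v\<close> 70)
  where "x \<otimes>\<^sub>v y = (\<chi> k. x $ fst k * y $ snd k)"

lemma tensor_vec_nth [simp]: "(x \<otimes>\<^sub>v y) $ (i, j) = x $ i * y $ j"
  by (simp add: tensor_vec_def)

lemma tensor_vec_eq_iff: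
  fixes x y :: "('a, 'n::finite \<times> 'm::finite) vec"
  shows "x = y \<longleftrightarrow> (\<forall>i j. x $ (i, j) = y $ (i, j))"
  unfolding vec_eq_iff by (rule split_paired_All)

lemma sum_UNIV_prod: "(\<Sum>k\<in>UNIV. f k) = (\<Sum>i\<in>UNIV. \<Sum>j\<in>UNIV. f (i, j))"
  for f :: "'n::finite \<times> 'm::finite \<Rightarrow> 'a::comm_monoid_add"
proof -
  have "(\<Sum>i\<in>UNIV. \<Sum>j\<in>UNIV. f (i, j)) = (\<Sum>k\<in>UNIV \<times> UNIV. case k of (i, j) \<Rightarrow> f (i, j))"
    by (rule sum.cartesian_product)
  then show ?thesis
    by (simp only: UNIV_Times_UNIV case_prod_beta prod.collapse)
qed

lemma tensor_table_nth: "tensor_table S T (i, i') (j, j') $ (k, k') = S i j $ k * T i' j' $ k'"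
  by (simp add: tensor_table_def)

lemma assoc_tensor_table:
  fixes S :: "('f::field, 'n::finite) mult_table" and T :: "('f, 'm::finite) mult_table"
  assumes "assoc_table S" "assoc_table T"
  shows "assoc_table (tensor_table S T)"
proof -
  have fact: "(\<Sum>i\<in>UNIV. \<Sum>j\<in>UNIV. f i * f' j * (g i * g' j)) = (\<Sum>i\<in>UNIV. f i * g i) * (\<Sum>j\<in>UNIV. f' j * g' j)"
    for f g :: "'n \<Rightarrow> 'f" and f' g' :: "'m \<Rightarrow> 'f"
    by (simp only: sum_product, intro sum.cong refl) (simp only: mult_ac)
  show ?thesis
    unfolding assoc_table_def split_paired_All sum_UNIV_prod tensor_table_nth fact
    using assms by (simp add: assoc_table_def)
qed

lemma alg_mult_tensor_vec:
  "alg_mult (tensor_table S T) (x \<otimes>\<^sub>v y) (x' \<otimes>\<^sub>v y') = alg_mult S x x' \<otimes>\<^sub>v alg_mult T y y'"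
proof -
  have "alg_mult (tensor_table S T) (x \<otimes>\<^sub>v y) (x' \<otimes>\<^sub>v y') $ (k, l) =
    (\<Sum>i\<in>UNIV. \<Sum>j\<in>UNIV. x $ i * x' $ j * S i j $ k) * (\<Sum>i\<in>UNIV. \<Sum>j\<in>UNIV. y $ i * y' $ j * T i j $ l)"
    for k l
    by (simp only: alg_mult_nth sum_UNIV_prod tensor_table_nth sum_product tensor_vec_nth)
      (intro sum.cong refl, simp only: mult_ac)
  then show ?thesis
    by (simp add: tensor_vec_eq_iff alg_mult_nth)
qed


lemma tensor_vec_linear:
  "(x + x') \<otimes>\<^sub>v y = x \<otimes>\<^sub>v y + x' \<otimes>\<^sub>v y" "x \<otimes>\<^sub>v (y + y') = x \<otimes>\<^sub>v y + x \<otimes>\<^sub>v y'"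
  "(r *s x) \<otimes>\<^sub>v y = r *s (x \<otimes>\<^sub>v y)" "x \<otimes>\<^sub>v (r *s y) = r *s (x \<otimes>\<^sub>v y)"
  by (simp_all add: tensor_vec_eq_iff algebra_simps)

lemma zero_divisor_imp_not_division_algebra:
  assumes T: "assoc_table T" and "alg_mult T x y = 0" "x \<noteq> 0" "y \<noteq> 0"
  shows "\<not> division_algebra T"
proof
  assume "division_algebra T"
  then obtain e z where e: "\<And>x. alg_mult T e x = x" and "alg_mult T z x = e"
    unfolding division_algebra_def using \<open>x \<noteq> 0\<close> by metis
  then have "y = alg_mult T z (alg_mult T x y)"
    using T[unfolded assoc_table_iff] by metis
  then show False
    using assms by (simp add: alg_mult_zero)
qed

section \<open>Quaternions in coordinates and the Albert form\<close>

definition quat_vec :: "'a \<Rightarrow> 'a \<Rightarrow> 'a \<Rightarrow> 'a \<Rightarrow> 'a::field ^ quat_basis"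
  where "quat_vec x0 x1 x2 x3 = (\<chi> i. case i of Q1 \<Rightarrow> x0 | Qi \<Rightarrow> x1 | Qj \<Rightarrow> x2 | Qij \<Rightarrow> x3)"

lemma quat_vec_nth [simp]:
  "quat_vec x0 x1 x2 x3 $ Q1 = x0" "quat_vec x0 x1 x2 x3 $ Qi = x1"
  "quat_vec x0 x1 x2 x3 $ Qj = x2" "quat_vec x0 x1 x2 x3 $ Qij = x3"
  by (simp_all add: quat_vec_def)

lemma all_quat_basis: "(\<forall>i. P i) \<longleftrightarrow> P Q1 \<and> P Qi \<and> P Qj \<and> P Qij"
proof safe
  fix i assume "P Q1" "P Qi" "P Qj" "P Qij"
  then show "P i" by (cases i) simp_all
qed blast+

lemma quat_vec_eq_iff: "x = y \<longleftrightarrow> x $ Q1 = y $ Q1 \<and> x $ Qi = y $ Qi \<and> x $ Qj = y $ Qj \<and> x $ Qij = y $ Qij"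
  unfolding vec_eq_iff by (rule all_quat_basis)

lemma sum_quat_basis: "(\<Sum>i\<in>UNIV. f i) = f Q1 + f Qi + f Qj + f Qij"
  for f :: "quat_basis \<Rightarrow> 'a::comm_monoid_add"
  by (simp add: UNIV_quat_basis add.assoc)

lemma axis_quat_vec:
  "axis Q1 x = quat_vec x 0 0 0" "axis Qi x = quat_vec 0 x 0 0"
  "axis Qj x = quat_vec 0 0 x 0" "axis Qij x = quat_vec 0 0 0 x"
  by (simp_all add: quat_vec_eq_iff axis_def)

lemma quaternion_conj_mult:
  fixes \<alpha> \<beta> :: "'a::field"
  assumes two: "(2::'a) = 0"
  shows "alg_mult (quaternion \<alpha> \<beta>) (quat_vec x0 x1 x2 x3) (quat_vec (x0 + x1) x1 x2 x3) =
    (nform \<alpha> x0 x1 + \<beta> * nform \<alpha> x2 x3) *s quat_vec 1 0 0 0"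
  by (simp add: quat_vec_eq_iff alg_mult_nth sum_quat_basis axis_quat_vec nform_def algebra_simps
      power2_eq_square char2_simps[OF two])

lemma quaternion_square:
  fixes \<alpha> \<beta> :: "'a::field"
  assumes two: "(2::'a) = 0"
  shows "alg_mult (quaternion \<alpha> \<beta>) (quat_vec x0 x1 x2 x3) (quat_vec x0 x1 x2 x3) =
    x1 *s quat_vec x0 x1 x2 x3 + (nform \<alpha> x0 x1 + \<beta> * nform \<alpha> x2 x3) *s quat_vec 1 0 0 0"
  by (simp add: quat_vec_eq_iff alg_mult_nth sum_quat_basis axis_quat_vec nform_def algebra_simps
      power2_eq_square char2_simps[OF two])

lemma quaternion_one:
  "alg_mult (quaternion \<alpha> \<beta>) (quat_vec 1 0 0 0) y = y"
  "alg_mult (quaternion \<alpha> \<beta>) y (quat_vec 1 0 0 0) = y"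
  by (simp_all add: quat_vec_eq_iff alg_mult_nth sum_quat_basis axis_quat_vec)

text \<open>A zero of the Albert form \<open>[1, a + b] \<perp> b[1, a] \<perp> c[1, b]\<close> is a
  pair \<open>x\<close> in \<open>[a, b)\<close>, \<open>y\<close> in \<open>[b, c)\<close> with
  equal trace \<open>t\<close> and equal norm \<open>n\<close>. With \<open>x'\<close> the conjugate
  of \<open>x\<close>, the product of \<open>x \<otimes> 1 + 1 \<otimes> y\<close> and
  \<open>x' \<otimes> 1 + 1 \<otimes> y\<close> is \<open>n + t y + y^2\<close>, which vanishes
  because \<open>y^2 = t y + n\<close> in characteristic 2.\<close>

lemma albert_isotropic_imp_not_division_algebra:
  fixes a b c :: "'a::field"
  assumes char: "CHAR('a) = 2"
    and z: "nform (a + b) x0 x1 + b * nform a x2 x3 + c * nform b x4 x5 = 0"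
    and nz: "(x0, x1, x2, x3, x4, x5) \<noteq> (0, 0, 0, 0, 0, 0)"
  shows "\<not> division_algebra (tensor_table (quaternion a b) (quaternion b c))"
proof (rule zero_divisor_imp_not_division_algebra)
  let ?S = "quaternion a b" and ?T = "quaternion b c" and ?one = "quat_vec 1 0 0 0"
  \<comment> \<open>The scalar parts of \<open>x\<close> and \<open>y\<close> enter
    \<open>x \<otimes> 1 + 1 \<otimes> y\<close> only through their sum, so that of \<open>y\<close>
    is set to 0. Equality of traces is the common coordinate \<open>x1\<close>; the norm of
    \<open>y\<close> then contributes the \<open>b x1^2\<close> that turns \<open>[1, a]\<close>
    into \<open>[1, a + b]\<close>.\<close>
  let ?x = "quat_vec x0 x1 x2 x3" and ?x' = "quat_vec (x0 + x1) x1 x2 x3" and ?y = "quat_vec 0 x1 x4 x5"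
  have two: "(2::'a) = 0"
    using of_nat_CHAR[where ?'a = 'a] char by simp
  show "assoc_table (tensor_table ?S ?T)"
    by (intro assoc_tensor_table; simp add: assoc_table_iff alg_mult_quaternion_assoc char)
  note two_simps = char2_simps[OF two]
  let ?n = "nform a x0 x1 + b * nform a x2 x3" and ?m = "nform b 0 x1 + c * nform b x4 x5"
  have "?n + ?m = 0"
    using z by (simp add: nform_def algebra_simps power2_eq_square)
  then have norm: "?m = ?n"
    using two_simps(3) by (metis add_eq_0_iff)
  have conj: "?x + ?x' = x1 *s ?one"
    by (simp add: quat_vec_eq_iff two_simps)
  have "alg_mult (tensor_table ?S ?T) (?x \<otimes>\<^sub>v ?one + ?one \<otimes>\<^sub>v ?y) (?x' \<otimes>\<^sub>v ?one + ?one \<otimes>\<^sub>v ?y) =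
    (?n *s ?one) \<otimes>\<^sub>v ?one + (?x + ?x') \<otimes>\<^sub>v ?y + ?one \<otimes>\<^sub>v (x1 *s ?y + ?n *s ?one)"
    unfolding alg_mult_add_left alg_mult_add_right alg_mult_tensor_vec quaternion_one
      quaternion_conj_mult[OF two] quaternion_square[OF two] norm tensor_vec_linear
    by (simp add: add_ac)
  also have "\<dots> = 0"
    unfolding conj tensor_vec_linear by (simp add: vec_eq_iff two_simps two add_ac)
  finally show "alg_mult (tensor_table ?S ?T) (?x \<otimes>\<^sub>v ?one + ?one \<otimes>\<^sub>v ?y) (?x' \<otimes>\<^sub>v ?one + ?one \<otimes>\<^sub>v ?y) = 0" .
  have nonzero: "quat_vec y0 y1 y2 y3 \<otimes>\<^sub>v ?one + ?one \<otimes>\<^sub>v quat_vec 0 y1 y4 y5 \<noteq> (0 :: 'a ^ (quat_basis \<times> quat_basis))" (is "?z \<noteq> 0")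
    if "(y0, y1, y2, y3, y4, y5) \<noteq> (0, 0, 0, 0, 0, 0)" for y0 y1 y2 y3 y4 y5 :: 'a
  proof
    assume "?z = 0"
    then have "?z $ k = 0" for k
      by simp
    from this[of "(Q1, Q1)"] this[of "(Qi, Q1)"] this[of "(Qj, Q1)"] this[of "(Qij, Q1)"]
      this[of "(Q1, Qj)"] this[of "(Q1, Qij)"] that
    show False
      by simp
  qed
  show "?x \<otimes>\<^sub>v ?one + ?one \<otimes>\<^sub>v ?y \<noteq> 0" "?x' \<otimes>\<^sub>v ?one + ?one \<otimes>\<^sub>v ?y \<noteq> 0"
    by (rule nonzero; use nz in auto)+
qed

section \<open>Quaternion norms\<close>

text \<open>The arguments on the left are the coordinates of \<open>(x0 + x1 i)(y0 + y1 i)\<close>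
  with \<open>i^2 = i + a\<close>.\<close>

lemma nform_mult:
  fixes a :: "'a::comm_ring_1"
  assumes two: "(2::'a) = 0"
  shows "nform a (x0 * y0 + a * x1 * y1) (x0 * y1 + x1 * y0 + x1 * y1) = nform a x0 x1 * nform a y0 y1"
  by (simp add: nform_def power2_eq_square algebra_simps char2_simps[OF two] two)

lemma nform_zero [simp]: "nform a 0 0 = 0"
  by (simp add: nform_def)

lemma nform_scale: "nform a (r * x) (r * y) = r\<^sup>2 * nform a x y"
  by (simp add: nform_def power2_eq_square algebra_simps)

type_synonym 'a quat = "'a \<times> 'a \<times> 'a \<times> 'a"

text \<open>The quadruple \<open>(x\<^sub>0, x\<^sub>1, x\<^sub>2, x\<^sub>3)\<close> stands for \<open>x\<^sub>0 + x\<^sub>1 i + (x\<^sub>2 + x\<^sub>3 i) j\<close> in \<open>[a, c)\<close>.\<close>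

fun qnorm :: "'a::comm_ring_1 \<Rightarrow> 'a \<Rightarrow> 'a quat \<Rightarrow> 'a"
  where "qnorm a c (x0, x1, x2, x3) = nform a x0 x1 + c * nform a x2 x3"

fun qpolar :: "'a::comm_ring_1 \<Rightarrow> 'a quat \<Rightarrow> 'a quat \<Rightarrow> 'a"
  where "qpolar c (x0, x1, x2, x3) (y0, y1, y2, y3) = x0 * y1 + x1 * y0 + c * (x2 * y3 + x3 * y2)"

fun qmult :: "'a::comm_ring_1 \<Rightarrow> 'a \<Rightarrow> 'a quat \<Rightarrow> 'a quat \<Rightarrow> 'a quat"
  where "qmult a c (x0, x1, x2, x3) (y0, y1, y2, y3) =
    (x0 * y0 + a * x1 * y1 + c * (x2 * (y2 + y3) + a * x3 * y3),
     x0 * y1 + x1 * y0 + x1 * y1 + c * (x2 * y3 + x3 * y2),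
     x0 * y2 + a * x1 * y3 + x2 * (y0 + y1) + a * x3 * y1,
     x0 * y3 + x1 * y2 + x1 * y3 + x2 * y1 + x3 * y0)"

fun qconj :: "'a::comm_ring_1 quat \<Rightarrow> 'a quat"
  where "qconj (x0, x1, x2, x3) = (x0 + x1, x1, x2, x3)"

fun qscale :: "'a::comm_ring_1 \<Rightarrow> 'a quat \<Rightarrow> 'a quat"
  where "qscale r (x0, x1, x2, x3) = (r * x0, r * x1, r * x2, r * x3)"

lemma vector_space_qscale: "vector_space (qscale :: 'a::field \<Rightarrow> _)"
  by unfold_locales (auto simp: algebra_simps)

lemma qmult_linear:
  "qmult a c (x + x') y = qmult a c x y + qmult a c x' y"
  "qmult a c x (y + y') = qmult a c x y + qmult a c x y'"
  "qmult a c (qscale r x) y = qscale r (qmult a c x y)"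
  "qmult a c x (qscale r y) = qscale r (qmult a c x y)"
  by (cases x; cases x'; cases y; cases y'; simp add: algebra_simps)+

lemma qpolar_linear:
  "qpolar c (x + x') y = qpolar c x y + qpolar c x' y"
  "qpolar c x (y + y') = qpolar c x y + qpolar c x y'"
  "qpolar c (qscale r x) y = r * qpolar c x y"
  "qpolar c x (qscale r y) = r * qpolar c x y"
  by (cases x; cases x'; cases y; cases y'; simp add: algebra_simps)+

lemma qnorm_scale: "qnorm a c (qscale r x) = r\<^sup>2 * qnorm a c x"
  by (cases x) (simp add: nform_def power2_eq_square algebra_simps)

lemma qpolar_commute: "qpolar c x y = qpolar c y x"
  by (cases x; cases y; simp add: algebra_simps)

context
  fixes a c :: "'a::comm_ring_1"
  assumes two: "(2::'a) = 0"
begin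

private lemmas two_simps = char2_simps[OF two] two

lemma qpolar_self: "qpolar c x x = 0"
  by (cases x) (simp add: algebra_simps two_simps)

lemma qnorm_add: "qnorm a c (x + y) = qnorm a c x + qnorm a c y + qpolar c x y"
  by (cases x; cases y; simp add: nform_def power2_eq_square algebra_simps two_simps)

lemma qnorm_mult: "qnorm a c (qmult a c x y) = qnorm a c x * qnorm a c y"
  by (cases x; cases y; simp add: nform_def power2_eq_square algebra_simps two_simps)

lemma qnorm_conj: "qnorm a c (qconj x) = qnorm a c x"
  by (cases x; simp add: nform_def power2_eq_square algebra_simps two_simps)

lemma qmult_assoc: "qmult a c (qmult a c x y) z = qmult a c x (qmult a c y z)"
  by (cases x; cases y; cases z; simp add: algebra_simps two_simps)

lemma qmult_conj: "qmult a c x (qconj x) = (qnorm a c x, 0, 0, 0)"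
  "qmult a c (qconj x) x = (qnorm a c x, 0, 0, 0)"
  by (cases x; simp add: nform_def power2_eq_square algebra_simps two_simps)+

lemma qmult_scalar: "qmult a c (r, 0, 0, 0) x = qscale r x" "qmult a c x (r, 0, 0, 0) = qscale r x"
  by (cases x; simp add: algebra_simps two_simps)+

lemma qpolar_mult_right: "qpolar c (qmult a c y x) (qmult a c z x) = qpolar c y z * qnorm a c x"
  by (cases x; cases y; cases z; simp add: nform_def power2_eq_square algebra_simps two_simps)

lemma qpolar_adjoint: "qpolar c (qmult a c x y) z = qpolar c x (qmult a c z (qconj y))"
  by (cases x; cases y; cases z; simp add: algebra_simps two_simps)

lemma qmult_conj_trace: "fst (snd (qmult a c x (qconj y))) = qpolar c x y"
  by (cases x; cases y; simp add: algebra_simps two_simps)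

end

section \<open>Polar forms and twisting a plane\<close>

definition bform :: "'a::comm_ring_1 ^ 'n ^ 'n \<Rightarrow> 'a ^ 'n \<Rightarrow> 'a ^ 'n \<Rightarrow> 'a"
  where "bform A x y = (\<Sum>i\<in>UNIV. x $ i * (\<Sum>j\<in>UNIV. (A $ i $ j + A $ j $ i) * y $ j))"

lemma bform_linear:
  "bform A (x + x') y = bform A x y + bform A x' y"
  "bform A x (y + y') = bform A x y + bform A x y'"
  "bform A (r *s x) y = r * bform A x y"
  "bform A x (r *s y) = r * bform A x y"
  "bform A 0 y = 0" "bform A x 0 = 0"
  by (simp_all add: bform_def algebra_simps sum.distrib sum_distrib_left)

lemma bform_eq: "bform A x y = (\<Sum>i\<in>UNIV. \<Sum>j\<in>UNIV. A $ i $ j * (x $ i * y $ j + x $ j * y $ i))"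
proof -
  have "(\<Sum>i\<in>UNIV. \<Sum>j\<in>UNIV. A $ j $ i * (x $ i * y $ j)) = (\<Sum>i\<in>UNIV. \<Sum>j\<in>UNIV. A $ i $ j * (x $ j * y $ i))"
    by (rule sum.swap)
  then show ?thesis
    by (simp add: bform_def algebra_simps sum.distrib sum_distrib_left)
qed

lemma bform_commute: "bform A x y = bform A y x"
  by (simp add: bform_eq algebra_simps)

lemma qform_add: "qform A (x + y) = qform A x + qform A y + bform A x y"
  by (simp add: qform_def bform_eq algebra_simps sum.distrib)

lemma qform_scale: "qform A (r *s x) = r\<^sup>2 * qform A x"
  by (simp add: qform_def sum_distrib_left power2_eq_square mult_ac)

lemma qform_zero [simp]: "qform A 0 = 0"
  by (simp add: qform_def)

lemma bform_self: "(2::'a::comm_ring_1) = 0 \<Longrightarrow> bform A x x = (0::'a)"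
  using qform_add[of A x x] qform_scale[of A 2 x] by (simp add: bform_eq mult_2[symmetric] mult.commute)

text \<open>If \<open>u1\<close>, \<open>u2\<close> span a plane \<open>l[1, a]\<close>, then
  \<open>bform A x u2\<close> and \<open>bform A x u1\<close> are \<open>l\<close> times the plane
  coordinates of \<open>x\<close>. For \<open>k = (c + 1) / l\<close> the plane becomes
  \<open>c l [1, a]\<close> and its orthogonal complement is unchanged; no basis adapted to the
  plane is needed.\<close>

definition twist_form :: "'a::comm_ring_1 \<Rightarrow> 'a \<Rightarrow> 'a ^ 'n \<Rightarrow> 'a ^ 'n \<Rightarrow> 'a ^ 'n ^ 'n \<Rightarrow> 'a ^ 'n ^ 'n"
  where "twist_form a k u1 u2 A = (\<chi> i j. A $ i $ j +
    (let p = \<lambda>i. \<Sum>j\<in>UNIV. (A $ i $ j + A $ j $ i) * u2 $ j;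
         r = \<lambda>i. \<Sum>j\<in>UNIV. (A $ i $ j + A $ j $ i) * u1 $ j
     in k * (p i * p j + p i * r j + a * r i * r j)))"

lemma qform_twist_form:
  "qform (twist_form a k u1 u2 A) x = qform A x + k * nform a (bform A x u2) (bform A x u1)"
proof -
  let ?p = "\<lambda>i. \<Sum>j\<in>UNIV. (A $ i $ j + A $ j $ i) * u2 $ j"
  let ?r = "\<lambda>i. \<Sum>j\<in>UNIV. (A $ i $ j + A $ j $ i) * u1 $ j"
  have p: "bform A x u2 = (\<Sum>i\<in>UNIV. x $ i * ?p i)" and r: "bform A x u1 = (\<Sum>i\<in>UNIV. x $ i * ?r i)"
    by (simp_all add: bform_def)
  have "qform (twist_form a k u1 u2 A) x = qform A x + (\<Sum>i\<in>UNIV. \<Sum>j\<in>UNIV.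
      k * ((x $ i * ?p i) * (x $ j * ?p j) + (x $ i * ?p i) * (x $ j * ?r j) + a * ((x $ i * ?r i) * (x $ j * ?r j))))"
    by (simp add: qform_def twist_form_def Let_def distrib_right distrib_left sum.distrib mult_ac)
  also have "\<dots> = qform A x + k * nform a (bform A x u2) (bform A x u1)"
    unfolding nform_def power2_eq_square p r sum_product
    by (simp only: sum.distrib distrib_left sum_distrib_left)
  finally show ?thesis .
qed

text \<open>The inverse \<open>l'\<close> is a parameter because the locale is used over
  \<open>F\<close> and also over \<open>F[s]\<close>, where \<open>l\<close> is a constant
  polynomial.\<close>

locale scaled_nform_plane =
  fixes a l l' :: "'a::comm_ring_1" and A :: "'a ^ 'n::finite ^ 'n" and u1 u2 :: "'a ^ 'n"
  assumes two: "(2::'a) = 0" and unit: "l' * l = 1"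
    and u1: "qform A u1 = l" and u2: "qform A u2 = a * l" and u12: "bform A u1 u2 = l"
begin

lemmas two_simps = char2_simps[OF two]

definition coord1 :: "'a ^ 'n \<Rightarrow> 'a" where "coord1 v = l' * bform A v u2"
definition coord2 :: "'a ^ 'n \<Rightarrow> 'a" where "coord2 v = l' * bform A v u1"
definition rest :: "'a ^ 'n \<Rightarrow> 'a ^ 'n" where "rest v = v + (coord1 v *s u1 + coord2 v *s u2)"

lemma vec_two: "x + x = (0 :: 'a ^ 'n)" "x + (x + y) = (y :: 'a ^ 'n)"
  by (simp_all add: vec_eq_iff two_simps two)

lemma u21: "bform A u2 u1 = l"
  by (simp add: bform_commute[of A u2] u12)

lemma decompose: "v = rest v + (coord1 v *s u1 + coord2 v *s u2)"
  by (simp add: rest_def add.assoc vec_two)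

lemma bform_coord: "bform A v u2 = l * coord1 v" "bform A v u1 = l * coord2 v"
  using unit by (simp_all add: coord1_def coord2_def mult.assoc[symmetric] mult.commute[of l])

lemma rest_orth: "bform A (rest v) u1 = 0" "bform A (rest v) u2 = 0"
  by (simp_all add: rest_def bform_linear u12 u21 bform_self[OF two] bform_coord[of v]
      two_simps mult.commute)

definition twisted :: "'a \<Rightarrow> 'a ^ 'n ^ 'n" where "twisted c = twist_form a (l' * (c + 1)) u1 u2 A"

lemma qform_plane_add:
  assumes "bform A t u1 = 0" "bform A t u2 = 0"
  shows "qform A (t + (x1 *s u1 + x2 *s u2)) = qform A t + l * nform a x1 x2"
  by (simp add: qform_add qform_scale bform_linear u1 u2 u12 assms nform_def algebra_simps power2_eq_square)

lemma bform_plane_add: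
  assumes "bform A t u1 = 0" "bform A t u2 = 0" "bform A t' u1 = 0" "bform A t' u2 = 0"
  shows "bform A (t + (x1 *s u1 + x2 *s u2)) (t' + (y1 *s u1 + y2 *s u2)) =
    bform A t t' + l * (x1 * y2 + x2 * y1)"
  by (simp add: bform_linear u12 u21 bform_self[OF two] assms bform_commute[of A _ t'] algebra_simps)

lemma qform_twisted_add:
  assumes "bform A t u1 = 0" "bform A t u2 = 0"
  shows "qform (twisted c) (t + (x1 *s u1 + x2 *s u2)) = qform A t + c * l * nform a x1 x2"
proof -
  have *: "bform A (t + (x1 *s u1 + x2 *s u2)) u2 = l * x1" "bform A (t + (x1 *s u1 + x2 *s u2)) u1 = l * x2"
    by (simp_all add: bform_linear u12 u21 assms bform_self[OF two] mult.commute)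
  have "l' * (c + 1) * (l\<^sup>2 * nform a x1 x2) = (l' * l) * (c + 1) * l * nform a x1 x2"
    by (simp add: power2_eq_square mult_ac)
  then show ?thesis
    unfolding twisted_def qform_twist_form * nform_scale qform_plane_add[OF assms] unit
    by (simp add: algebra_simps two_simps)
qed

lemma bform_twisted_add:
  assumes t: "bform A t u1 = 0" "bform A t u2 = 0" and t': "bform A t' u1 = 0" "bform A t' u2 = 0"
  shows "bform (twisted c) (t + (x1 *s u1 + x2 *s u2)) (t' + (y1 *s u1 + y2 *s u2)) =
    bform A t t' + c * l * (x1 * y2 + x2 * y1)"
proof -
  let ?v = "t + (x1 *s u1 + x2 *s u2)" and ?w = "t' + (y1 *s u1 + y2 *s u2)"
  have sum: "?v + ?w = (t + t') + ((x1 + y1) *s u1 + (x2 + y2) *s u2)"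
    by (simp add: vec_eq_iff algebra_simps)
  have tt: "bform A (t + t') u1 = 0" "bform A (t + t') u2 = 0"
    using assms by (simp_all add: bform_linear)
  have "bform (twisted c) ?v ?w = qform (twisted c) (?v + ?w) + qform (twisted c) ?v + qform (twisted c) ?w"
    unfolding qform_add[of "twisted c" ?v ?w] by (simp add: two_simps two add.assoc)
  also have "\<dots> = bform A t t' + c * l * (x1 * y2 + x2 * y1)"
    unfolding sum qform_twisted_add[OF t] qform_twisted_add[OF t'] qform_twisted_add[OF tt]
    by (simp add: qform_add nform_def algebra_simps power2_eq_square two_simps)
  finally show ?thesis .
qed

end


section \<open>Conics inside forms and the first dimension count\<close>

definition contains_conic :: "'a::comm_ring_1 \<Rightarrow> 'a \<Rightarrow> 'a ^ 'n ^ 'n \<Rightarrow> bool"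
  where "contains_conic a c A \<longleftrightarrow> (\<exists>m w0 w1 y. m \<noteq> 0 \<and> qform A w0 = m \<and> qform A w1 = a * m \<and>
    bform A w0 w1 = m \<and> qform A y = c * m \<and> bform A w0 y = 0 \<and> bform A w1 y = 0)"

definition pair_scale :: "('a \<Rightarrow> 'b \<Rightarrow> 'b) \<Rightarrow> ('a \<Rightarrow> 'c \<Rightarrow> 'c) \<Rightarrow> 'a \<Rightarrow> 'b \<times> 'c \<Rightarrow> 'b \<times> 'c"
  where "pair_scale s1 s2 r v = (s1 r (fst v), s2 r (snd v))"

lemma pair_scale_simps [simp]: "pair_scale s1 s2 r (x, y) = (s1 r x, s2 r y)"
  by (simp add: pair_scale_def)

lemma vector_space_pair_scale:
  assumes "vector_space s1" "vector_space s2"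
  shows "vector_space (pair_scale s1 s2)"
proof -
  interpret s1: vector_space s1 by fact
  interpret s2: vector_space s2 by fact
  show ?thesis
    by unfold_locales
      (auto simp: pair_scale_def s1.scale_right_distrib s2.scale_right_distrib
        s1.scale_left_distrib s2.scale_left_distrib)
qed

lemma (in vector_space) independent_family:
  assumes fin: "finite I" and *: "\<And>k. (\<Sum>i\<in>I. scale (k i) (f i)) = 0 \<Longrightarrow> \<forall>i\<in>I. k i = 0"
  shows "independent (f ` I)" "card (f ` I) = card I"
proof -
  have inj: "inj_on f I"
  proof (rule inj_onI, rule ccontr)
    fix i j assume ij: "i \<in> I" "j \<in> I" "f i = f j" "i \<noteq> j"
    define k where "k l = (if l = i then 1 else if l = j then - 1 else 0 :: 'a)" for l
    have "(\<Sum>l\<in>I. scale (k l) (f l)) = (\<Sum>l\<in>{i, j}. scale (k l) (f l))"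
      using fin ij by (intro sum.mono_neutral_right) (auto simp: k_def)
    also have "\<dots> = 0"
      using ij by (simp add: k_def)
    finally show False
      using *[of k] ij by (auto simp: k_def)
  qed
  then show "card (f ` I) = card I"
    by (rule card_image)
  show "independent (f ` I)"
  proof (rule independent_if_scalars_zero)
    fix g x assume "(\<Sum>x\<in>f ` I. scale (g x) x) = 0" "x \<in> f ` I"
    then show "g x = 0"
      using *[of "\<lambda>i. g (f i)"] by (auto simp: sum.reindex[OF inj])
  qed (use fin in simp)
qed

lemma (in vector_space) independent3:
  assumes "\<And>r s t. scale r x + scale s y + scale t z = 0 \<Longrightarrow> r = 0 \<and> s = 0 \<and> t = 0"
  shows "independent {x, y, z}" "card {x, y, z} = 3"
proof -
  let ?f = "\<lambda>i::nat. if i = 0 then x else if i = 1 then y else z"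
  have "?f ` {0, 1, 2} = {x, y, z}"
    by auto
  then show "independent {x, y, z}" "card {x, y, z} = 3"
    using independent_family[of "{0, 1, 2}" ?f] assms by (auto simp: add.assoc[symmetric])
qed

lemma (in vector_space) span3: "v \<in> span {x, y, z} \<longleftrightarrow> (\<exists>r s t. v = scale r x + scale s y + scale t z)"
  by (simp add: span_insert[of x] span_insert[of y] span_insert[of z] algebra_simps)

locale conic_in_form =
  fixes a c m :: "'a::comm_ring_1" and A :: "'a ^ 'n::finite ^ 'n" and w0 w1 y :: "'a ^ 'n"
  assumes two: "(2::'a) = 0"
    and w0: "qform A w0 = m" and w1: "qform A w1 = a * m" and w01: "bform A w0 w1 = m"
    and y: "qform A y = c * m" and w0y: "bform A w0 y = 0" and w1y: "bform A w1 y = 0"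
begin

definition conic_vec :: "'a \<Rightarrow> 'a \<Rightarrow> 'a \<Rightarrow> 'a ^ 'n"
  where "conic_vec r0 r1 r2 = r0 *s w0 + r1 *s w1 + r2 *s y"

lemma qform_conic_vec: "qform A (conic_vec r0 r1 r2) = m * qnorm a c (r0, r1, r2, 0)"
  by (simp add: conic_vec_def qform_add qform_scale bform_linear w0 w1 w01 y w0y w1y nform_def
      algebra_simps power2_eq_square)

lemma bform_conic_vec:
  "bform A (conic_vec r0 r1 r2) (conic_vec s0 s1 s2) = m * qpolar c (r0, r1, r2, 0) (s0, s1, s2, 0)"
  by (simp add: conic_vec_def bform_linear w01 w0y w1y bform_self[OF two] bform_commute[of A w1 w0]
      bform_commute[of A y] algebra_simps)

end

text \<open>The norm is multiplicative and \<open>qconj p\<close> divided by the norm of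
  \<open>p\<close> is inverse to \<open>p\<close>, so quotients of norms are norms.\<close>

lemma ex_qnorm_ratio:
  fixes a c :: "'a::field"
  assumes two: "(2::'a) = 0" and "m * qnorm a c p = l * qnorm a c q" "qnorm a c p \<noteq> 0"
  shows "\<exists>r. l * qnorm a c r = m"
proof
  have "qnorm a c (qscale (1 / qnorm a c p) (qmult a c (qconj p) q)) = qnorm a c q / qnorm a c p"
    using assms(3) by (simp add: qnorm_scale qnorm_mult[OF two] qnorm_conj[OF two] power2_eq_square)
  then show "l * qnorm a c (qscale (1 / qnorm a c p) (qmult a c (qconj p) q)) = m"
    using assms(2,3) by (metis mult.commute nonzero_mult_div_cancel_right times_divide_eq_right)
qed

text \<open>
  Twisting the plane \<open>\<lambda>[1, a]\<close> into \<open>c\<lambda>[1, a]\<close> changes the Witt class by \<open>\<lambda> n\<^sub>Q\<close>, so a conic in the twisted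
  form makes the Witt index of (twisted form) \<open>\<perp>\<close> \<open>\<lambda> n\<^sub>Q\<close> too large for the original form to be
  anisotropic.
\<close>

lemma isotropic_if_twisted_contains_conic:
  fixes a c l l' :: "'a::field" and A :: "'a ^ 'n::finite ^ 'n"
  assumes "scaled_nform_plane a l l' A u1 u2"
    and card: "CARD('n) = 4"
    and aniso: "\<And>q. qnorm a c q = 0 \<Longrightarrow> q = 0"
    and conic: "contains_conic a c (scaled_nform_plane.twisted a l' A u1 u2 c)"
  shows "isotropic A"
proof -
  interpret plane: scaled_nform_plane a l l' A u1 u2 by fact
  note two = plane.two
  define B where "B = plane.twisted c"
  obtain m w0 w1 y where m: "m \<noteq> 0" and "conic_in_form a c m B w0 w1 y"
    using conic two by (auto simp: contains_conic_def B_def conic_in_form_def)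
  then interpret conic: conic_in_form a c m B w0 w1 y by simp
  have l: "l \<noteq> 0"
    using plane.unit by auto
  have c: "c \<noteq> 0"
    using aniso[of "(0, 0, 1, 0)"] by (auto simp: nform_def zero_prod_def)
  have norm0: "qnorm a c (r0, r1, r2, r3) = 0 \<longleftrightarrow> r0 = 0 \<and> r1 = 0 \<and> r2 = 0 \<and> r3 = 0" for r0 r1 r2 r3
    using aniso[of "(r0, r1, r2, r3)"] by (auto simp: zero_prod_def)
  have conic_vec0: "conic.conic_vec r0 r1 r2 = 0 \<longleftrightarrow> r0 = 0 \<and> r1 = 0 \<and> r2 = 0" for r0 r1 r2
  proof
    assume "conic.conic_vec r0 r1 r2 = 0"
    then show "r0 = 0 \<and> r1 = 0 \<and> r2 = 0"
      using conic.qform_conic_vec[of r0 r1 r2] m norm0[of r0 r1 r2 0] by simp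
  qed (simp add: conic.conic_vec_def)
  have twisted: "qform B (t + (x1 *s u1 + x2 *s u2)) = qform A t + c * l * nform a x1 x2"
    if "bform A t u1 = 0" "bform A t u2 = 0" for t x1 x2
    using plane.qform_twisted_add[OF that] by (simp add: B_def)
  have plane0: "x1 = 0 \<and> x2 = 0" if "x1 *s u1 + x2 *s u2 = 0" for x1 x2
    using twisted[of 0 x1 x2] that l c norm0[of x1 x2 0 0] by (simp add: bform_linear)

  \<comment> \<open>The only use of dimension 4: since \<open>3 + 2 > 4\<close>, the conic meets the
    twisted plane. The common vector has value \<open>m\<close> times a norm and also
    \<open>l\<close> times a norm, so \<open>m\<close> is a value of
    \<open>l n\<^sub>Q\<close>.\<close>
  have "\<exists>r0 r1 r2 x1 x2. (r0, r1, r2) \<noteq> (0, 0, 0) \<and> conic.conic_vec r0 r1 r2 = x1 *s u1 + x2 *s u2"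
  proof (rule ccontr)
    assume neg: "\<not> ?thesis"
    let ?f = "\<lambda>i::nat. if i = 0 then w0 else if i = 1 then w1 else if i = 2 then y else if i = 3 then u1 else u2"
    have "\<forall>i\<in>{..<5}. k i = 0" if "(\<Sum>i<5. k i *s ?f i) = 0" for k
    proof -
      have sum: "conic.conic_vec (k 0) (k 1) (k 2) + (k 3 *s u1 + k 4 *s u2) = 0"
        using that by (simp add: eval_nat_numeral conic.conic_vec_def add.assoc)
      then have "conic.conic_vec (k 0) (k 1) (k 2) = (- k 3) *s u1 + (- k 4) *s u2"
        by (simp add: vec_eq_iff eq_neg_iff_add_eq_0 algebra_simps)
      then have "(k 0, k 1, k 2) = (0, 0, 0)"
        using neg by blast
      then have "k 0 = 0" "k 1 = 0" "k 2 = 0"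
        by simp_all
      moreover from this have "k 3 = 0" "k 4 = 0"
        using sum plane0[of "k 3" "k 4"] by (auto simp: conic.conic_vec_def)
      ultimately show ?thesis
        by (auto simp: eval_nat_numeral less_Suc_eq)
    qed
    then have "vec.independent (?f ` {..<5})" "card (?f ` {..<5}) = 5"
      using vec.independent_family[of "{..<5}" ?f] by auto
    then show False
      using vec.dim_subset[OF subset_UNIV, of "?f ` {..<5}"] card
      unfolding vec.dim_eq_card_independent[OF \<open>vec.independent (?f ` {..<5})\<close>] vec_dim_card by simp
  qed
  then obtain r0 r1 r2 x1 x2 where r: "(r0, r1, r2) \<noteq> (0, 0, 0)"
    and z: "conic.conic_vec r0 r1 r2 = x1 *s u1 + x2 *s u2"
    by blast
  have "m * qnorm a c (r0, r1, r2, 0) = l * qnorm a c (0, 0, x1, x2)"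
    using conic.qform_conic_vec[of r0 r1 r2] twisted[of 0 x1 x2] z by (simp add: bform_linear)
  moreover have "qnorm a c (r0, r1, r2, 0) \<noteq> 0"
    using r norm0 by auto
  ultimately obtain p where p: "l * qnorm a c p = m"
    using ex_qnorm_ratio[OF two] by blast

  let ?scale = "pair_scale (*s) qscale :: 'a \<Rightarrow> ('a ^ 'n) \<times> 'a quat \<Rightarrow> ('a ^ 'n) \<times> 'a quat"
  interpret E: vector_space ?scale
    by (intro vector_space_pair_scale vector_space_qscale vec.vector_space_axioms)
  define \<sigma> where "\<sigma> r0 r1 r2 = qmult a c (r0, r1, r2, 0) p" for r0 r1 r2
  define \<beta> where "\<beta> v w = bform B (fst v) (fst w) + l * qpolar c (snd v) (snd w)" for v w
  \<comment> \<open>Everything takes place in \<open>B \<perp> l n\<^sub>Q\<close> with polar form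
    \<open>\<beta>\<close>. Right multiplication by \<open>p\<close> maps the conic isometrically
    into \<open>l n\<^sub>Q\<close>, and \<open>P\<close> is its graph, isotropic in characteristic
    2. \<open>J\<close> is the graph matching the plane \<open>c l N\<close> of \<open>B\<close>
    with the \<open>j\<close>-part of \<open>l n\<^sub>Q\<close>. Dividing the orthogonal complement
    of \<open>J\<close> by \<open>J\<close> leaves the rest of \<open>B\<close> plus
    \<open>l N\<close>, which is \<open>A\<close>.\<close>
  define P where "P = {(w0, \<sigma> 1 0 0), (w1, \<sigma> 0 1 0), (y, \<sigma> 0 0 1)}"
  define J where "J = {(u1, (0, 0, 1, 0) :: 'a quat), (u2, (0, 0, 0, 1))}"
  have \<sigma>_lin: "qscale r (\<sigma> 1 0 0) + qscale s (\<sigma> 0 1 0) + qscale t (\<sigma> 0 0 1) = \<sigma> r s t" for r s t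
    unfolding \<sigma>_def qmult_linear(1,3)[symmetric] by simp
  have comb: "?scale r (w0, \<sigma> 1 0 0) + ?scale s (w1, \<sigma> 0 1 0) + ?scale t (y, \<sigma> 0 0 1) =
      (conic.conic_vec r s t, \<sigma> r s t)" for r s t
    by (simp add: conic.conic_vec_def \<sigma>_lin)
  have spanP: "\<exists>r s t. v = (conic.conic_vec r s t, \<sigma> r s t)" if "v \<in> E.span P" for v
    using that comb unfolding P_def E.span3 by simp
  have indP: "E.independent P" "card P = 3"
    unfolding P_def
    by (rule E.independent3; use comb conic_vec0 in \<open>auto simp: zero_prod_def\<close>)+
  have orth: "\<beta> v w = 0" if vw: "v \<in> E.span P" "w \<in> E.span P" for v w
  proof -
    obtain r s t r' s' t' where "v = (conic.conic_vec r s t, \<sigma> r s t)" "w = (conic.conic_vec r' s' t', \<sigma> r' s' t')"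
      using spanP[OF vw(1)] spanP[OF vw(2)] by blast
    then have "\<beta> v w = m * qpolar c (r, s, t, 0) (r', s', t', 0) + l * (qpolar c (r, s, t, 0) (r', s', t', 0) * qnorm a c p)"
      by (simp add: \<beta>_def \<sigma>_def conic.bform_conic_vec qpolar_mult_right[OF two] del: qpolar.simps)
    also have "\<dots> = m * qpolar c (r, s, t, 0) (r', s', t', 0) + m * qpolar c (r, s, t, 0) (r', s', t', 0)"
      unfolding p[symmetric] by (simp add: mult_ac del: qpolar.simps)
    finally show ?thesis
      using plane.two_simps by simp
  qed
  have "\<exists>C. finite C \<and> C \<subseteq> E.span P \<and> E.independent C \<and> card P \<le> card C + card J \<and>
    E.span C \<inter> E.span J = {0} \<and> (\<forall>x\<in>E.span C. \<forall>y\<in>E.span J. \<beta> x y = 0)"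
  proof (rule E.ex_independent_orthogonal_mod)
    show "finite P" "E.independent P" "finite J"
      using indP by (simp_all add: P_def J_def)
  qed (use orth in \<open>auto simp: \<beta>_def bform_linear qpolar_linear algebra_simps pair_scale_def\<close>)
  then obtain C where C: "C \<subseteq> E.span P" "E.independent C" "card P \<le> card C + card J"
    "E.span C \<inter> E.span J = {0}" "\<And>x y. x \<in> E.span C \<Longrightarrow> y \<in> E.span J \<Longrightarrow> \<beta> x y = 0"
    by blast
  have "card J \<le> 2"
    unfolding J_def by (simp add: card_insert_if)
  then have "C \<noteq> {}"
    using C(3) indP(2) by auto
  then obtain x where x: "x \<in> C" by blast
  then have "x \<noteq> 0"
    using C(2) E.dependent_zero by blast
  have xC: "x \<in> E.span C"
    using x by (rule E.span_base)
  obtain r s t where x_eq: "x = (conic.conic_vec r s t, \<sigma> r s t)"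
    using spanP C(1) x by blast
  define v where "v = conic.conic_vec r s t"
  obtain q0 q1 q2 q3 where q: "\<sigma> r s t = (q0, q1, q2, q3)"
    by (cases "\<sigma> r s t")
  note rest = plane.rest_orth[of v] and v_dec = plane.decompose[of v]
  let ?t = "plane.rest v" and ?x1 = "plane.coord1 v" and ?x2 = "plane.coord2 v"
  have bv: "bform B v (y1 *s u1 + y2 *s u2) = c * l * (?x1 * y2 + ?x2 * y1)" for y1 y2
    using plane.bform_twisted_add[OF rest, of 0 c ?x1 ?x2 y1 y2] v_dec
    by (simp add: bform_linear B_def)
  \<comment> \<open>Orthogonality to \<open>J\<close> forces the plane coordinates of
    \<open>v\<close> to equal the \<open>j\<close>-coordinates of the quaternion. Their
    contributions \<open>c l N(q2, q3)\<close> cancel, and what remains is a zero of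
    \<open>A\<close>; it is nonzero because otherwise \<open>x\<close> would lie in the span of
    \<open>J\<close>.\<close>
  have "(u1, 0, 0, 1, 0) \<in> E.span J" "(u2, 0, 0, 0, 1) \<in> E.span J"
    by (auto intro: E.span_base simp: J_def)
  from this[THEN C(5)[OF xC]]
  have "bform B v (1 *s u1 + 0 *s u2) + l * c * q3 = 0" "bform B v (0 *s u1 + 1 *s u2) + l * c * q2 = 0"
    by (simp_all add: \<beta>_def x_eq v_def q mult.assoc)
  then have "l * c * (?x2 + q3) = 0" "l * c * (?x1 + q2) = 0"
    unfolding bv by (simp_all add: algebra_simps)
  then have x23: "?x1 = q2" "?x2 = q3"
    using l c plane.two_simps(3) by (metis add_eq_0_iff mult_eq_0_iff)+
  have "qform B v = m * qnorm a c (r, s, t, 0)"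
    unfolding v_def by (rule conic.qform_conic_vec)
  also have "\<dots> = l * qnorm a c (q0, q1, q2, q3)"
    using p unfolding q[symmetric] \<sigma>_def qnorm_mult[OF two] by auto
  finally have "qform A ?t + c * l * nform a q2 q3 = l * (nform a q0 q1 + c * nform a q2 q3)"
    using twisted[OF rest, of ?x1 ?x2] v_dec x23 by simp
  then have "qform A ?t + l * nform a q0 q1 = 0"
    by (simp add: algebra_simps plane.two_simps)
  then have zero: "qform A (?t + (q0 *s u1 + q1 *s u2)) = 0"
    using plane.qform_plane_add[OF rest] by simp
  show ?thesis
  proof (rule ccontr)
    assume "anisotropic A"
    then have "?t + (q0 *s u1 + q1 *s u2) = 0"
      using zero by (auto simp: isotropic_def)
    moreover have "bform A (?t + (q0 *s u1 + q1 *s u2)) (0 + (y1 *s u1 + y2 *s u2)) = l * (q0 * y2 + q1 * y1)" for y1 y2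
      using plane.bform_plane_add[OF rest, of 0 q0 q1 y1 y2] by (simp add: bform_linear)
    ultimately have "l * (q0 * y2 + q1 * y1) = 0" for y1 y2
      by (metis bform_linear(5))
    from this[of 0 1] this[of 1 0] have q01: "q0 = 0" "q1 = 0"
      using l by auto
    with \<open>?t + _ = 0\<close> have "?t = 0"
      by simp
    then have "v = q2 *s u1 + q3 *s u2"
      using v_dec x23 by simp
    then have "x = ?scale q2 (u1, 0, 0, 1, 0) + ?scale q3 (u2, 0, 0, 0, 1)"
      using x_eq q q01 by (simp add: v_def)
    also have "\<dots> \<in> E.span J"
      by (intro E.span_add E.span_scale E.span_base) (simp_all add: J_def)
    finally show False
      using C(4) xC \<open>x \<noteq> 0\<close> by blast
  qed
qed

section \<open>Zeros over the function field and degree reduction\<close>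

lemma (in scaled_nform_plane) coord_linear:
  "coord1 (x + y) = coord1 x + coord1 y" "coord2 (x + y) = coord2 x + coord2 y"
  "coord1 (r *s x) = r * coord1 x" "coord2 (r *s x) = r * coord2 x"
  "coord1 u1 = 1" "coord1 u2 = 0" "coord2 u1 = 0" "coord2 u2 = 1"
  by (simp_all add: coord1_def coord2_def bform_linear u12 u21 bform_self[OF two] unit unit[unfolded mult.commute[of l']]
      algebra_simps)

lemma (in scaled_nform_plane) rest_linear:
  "rest (x + y) = rest x + rest y" "rest (r *s x) = r *s rest x" "rest u1 = 0" "rest u2 = 0"
  by (simp_all add: rest_def coord_linear vec_two vec_eq_iff two_simps two algebra_simps)

section \<open>Constant vectors and degree bounds over \<open>F[s]\<close>\<close>

definition const_vec :: "'a::comm_ring_1 ^ 'n \<Rightarrow> 'a poly ^ 'n"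
  where "const_vec v = (\<chi> i. [:v $ i:])"

abbreviation const_form :: "'a::comm_ring_1 ^ 'n ^ 'n \<Rightarrow> 'a poly ^ 'n ^ 'n"
  where "const_form A \<equiv> base_change (\<lambda>c. [:c:]) A"

lemma const_mult: "[:x * y:] = [:x:] * [:y:]"
  by (simp add: mult.commute)

lemma const_add: "[:x + y:] = [:x:] + [:y:]"
  by simp

lemma const_sum: "[:sum f S:] = (\<Sum>i\<in>S. [:f i:])"
  by (induction S rule: infinite_finite_induct) (simp_all add: const_add del: add_pCons)

lemma qform_const: "qform (const_form A) (const_vec v) = [:qform A v:]"
  by (simp only: qform_def base_change_def const_vec_def vec_lambda_beta const_sum const_mult)

lemma bform_const: "bform (const_form A) (const_vec v) (const_vec w) = [:bform A v w:]"
  by (simp only: bform_def base_change_def const_vec_def vec_lambda_beta const_sum const_mult const_add)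

lemma twist_form_const:
  "const_form (twist_form a k u1 u2 A) = twist_form [:a:] [:k:] (const_vec u1) (const_vec u2) (const_form A)"
  unfolding twist_form_def base_change_def const_vec_def vec_eq_iff Let_def vec_lambda_beta
  by (simp only: const_add const_mult const_sum) simp

lemma two_poly: "(2::'a::comm_ring_1) = 0 \<Longrightarrow> (2::'a poly) = 0"
  by (metis numeral_poly pCons_0_0)

text \<open>A strict bound that gives the zero polynomial degree minus infinity:
  \<open>poly_lt 0 p\<close> means \<open>p = 0\<close>, which \<open>degree\<close> cannot
  express.\<close>

definition poly_lt :: "nat \<Rightarrow> 'a::zero poly \<Rightarrow> bool"
  where "poly_lt m p \<longleftrightarrow> (\<forall>k\<ge>m. coeff p k = 0)"

lemma poly_lt_iff: "poly_lt m p \<longleftrightarrow> p = 0 \<or> degree p < m"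
proof
  assume *: "poly_lt m p"
  show "p = 0 \<or> degree p < m"
  proof (rule ccontr)
    assume "\<not> ?thesis"
    then have "p \<noteq> 0" "m \<le> degree p"
      by auto
    with * show False
      by (auto simp: poly_lt_def)
  qed
qed (auto simp: poly_lt_def coeff_eq_0)

lemma poly_lt_add: "poly_lt m p \<Longrightarrow> poly_lt m q \<Longrightarrow> poly_lt m (p + q)"
  by (simp add: poly_lt_def)

lemma poly_lt_const: "poly_lt m p \<Longrightarrow> poly_lt m ([:r:] * p)"
  by (simp add: poly_lt_def)

lemma poly_lt_zero [simp]: "poly_lt m 0"
  by (simp add: poly_lt_def)

lemma poly_lt_mono: "poly_lt m p \<Longrightarrow> m \<le> n \<Longrightarrow> poly_lt n p"
  by (simp add: poly_lt_def)

lemma poly_lt_mult_iff: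
  fixes p q :: "'a::idom poly"
  assumes "q \<noteq> 0"
  shows "poly_lt (m + degree q) (q * p) \<longleftrightarrow> poly_lt m p"
proof (cases "p = 0")
  case False
  then have "degree (q * p) = degree q + degree p"
    using assms by (simp add: degree_mult_eq)
  then show ?thesis
    using assms False by (simp add: poly_lt_iff)
qed simp

lemma poly_lt_X: "poly_lt (Suc m) ([:0, 1:] * p) \<longleftrightarrow> poly_lt m (p :: 'a::idom poly)"
  using poly_lt_mult_iff[of "[:0, 1:]" m p] by simp

definition vec_lt :: "nat \<Rightarrow> 'a::zero poly ^ 'n \<Rightarrow> bool"
  where "vec_lt m f \<longleftrightarrow> (\<forall>i. poly_lt m (f $ i))"

lemma vec_lt_add: "vec_lt m f \<Longrightarrow> vec_lt m g \<Longrightarrow> vec_lt m (f + g)"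
  by (simp add: vec_lt_def poly_lt_add)

lemma vec_lt_const: "vec_lt m f \<Longrightarrow> vec_lt m ([:r:] *s f)"
  by (simp add: vec_lt_def poly_lt_const[of _ _ r, simplified])

lemma vec_lt_mono: "vec_lt m f \<Longrightarrow> m \<le> n \<Longrightarrow> vec_lt n f"
  using poly_lt_mono by (auto simp: vec_lt_def)

lemma vec_lt_const_vec: "poly_lt m p \<Longrightarrow> vec_lt m (p *s const_vec u)"
  using poly_lt_const[of m p] by (auto simp: vec_lt_def const_vec_def mult.commute)

lemma poly_lt_sum: "(\<And>i. i \<in> S \<Longrightarrow> poly_lt m (f i)) \<Longrightarrow> poly_lt m (sum f S)"
  by (auto simp: poly_lt_def coeff_sum)

lemma poly_lt_bform: "vec_lt m f \<Longrightarrow> poly_lt m (bform (const_form A) f (const_vec u))"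
proof -
  assume f: "vec_lt m f"
  have "(\<Sum>j\<in>UNIV. (const_form A $ i $ j + const_form A $ j $ i) * const_vec u $ j) =
      [:\<Sum>j\<in>UNIV. (A $ i $ j + A $ j $ i) * u $ j:]" for i
    by (simp only: base_change_def const_vec_def vec_lambda_beta const_sum const_mult const_add)
  then show ?thesis
    using f unfolding bform_def vec_lt_def
    by (intro poly_lt_sum) (simp only: mult.commute[of "f $ _"] poly_lt_const)
qed

text \<open>
  The function field is \<open>F(s)(\<rho>)\<close> with \<open>\<rho>\<^sup>2 = c(s\<^sup>2 + s + a)\<close>; the pair \<open>(f, g)\<close> is the isotropic
  vector \<open>f + \<rho> g\<close>, of degree at most \<open>m\<close> on the conic.
\<close>

definition conic_N :: "'a::comm_ring_1 \<Rightarrow> 'a poly" where "conic_N a = [:a, 1, 1:]"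

definition poly_zero :: "'a::comm_ring_1 \<Rightarrow> 'a \<Rightarrow> nat \<Rightarrow> 'a ^ 'n ^ 'n \<Rightarrow> bool"
  where "poly_zero a c m A \<longleftrightarrow> (\<exists>f g. (f \<noteq> 0 \<or> g \<noteq> 0) \<and> vec_lt (Suc m) f \<and> vec_lt m g \<and>
    qform (const_form A) f = [:c:] * conic_N a * qform (const_form A) g \<and> bform (const_form A) f g = 0)"

lemma conic_N_eq: "conic_N a = [:0, 1:]\<^sup>2 + [:0, 1:] + [:a:]"
  by (simp add: conic_N_def power2_eq_square)

lemma degree_conic_N [simp]: "degree (conic_N a) = 2"
  by (simp add: conic_N_def)

lemma conic_N_nz [simp]: "conic_N a \<noteq> 0"
  by (simp add: conic_N_def)

lemma conic_N_dvd_quadratic: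
  fixes a :: "'a::field"
  assumes "conic_N a dvd [:z, y, x:]"
  shows "y = x" "z = a * x"
proof -
  have "conic_N a dvd [:z, y, x:] - [:x:] * conic_N a"
    using assms by (intro dvd_diff dvd_mult dvd_refl)
  also have "[:z, y, x:] - [:x:] * conic_N a = [:z - a * x, y - x:]"
    by (simp add: conic_N_def)
  finally have dvd: "conic_N a dvd [:z - a * x, y - x:]" .
  have "[:z - a * x, y - x:] = 0"
  proof (rule ccontr)
    assume "[:z - a * x, y - x:] \<noteq> 0"
    then have "2 \<le> degree [:z - a * x, y - x:]"
      using dvd_imp_degree_le[OF dvd] by simp
    also have "\<dots> \<le> 1"
      using degree_pCons_le[of "z - a * x" "[:y - x:]"] by simp
    finally show False by simp
  qed
  then show "y = x" "z = a * x"
    by auto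
qed

lemma qform_linear_const:
  "qform (const_form A) ([:0, 1:] *s const_vec u1 + const_vec u2) = [:qform A u2, bform A u1 u2, qform A u1:]"
  by (simp add: qform_add qform_scale bform_linear qform_const bform_const power2_eq_square)

lemma poly_vec_divide:
  fixes f :: "'a::field poly ^ 'n"
  assumes "vec_lt (m + 2) f"
  shows "\<exists>k u1 u2. vec_lt m k \<and> f = conic_N a *s k + ([:0, 1:] *s const_vec u1 + const_vec u2)"
proof -
  let ?N = "conic_N a"
  have r: "f $ i mod ?N = [:0, 1:] * [:coeff (f $ i mod ?N) 1:] + [:coeff (f $ i mod ?N) 0:]" for i
  proof (rule poly_eqI)
    fix n
    have "degree (f $ i mod ?N) < 2 \<or> f $ i mod ?N = 0"
      using degree_mod_less[of ?N "f $ i"] by auto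
    then have "n \<ge> 2 \<Longrightarrow> coeff (f $ i mod ?N) n = 0"
      by (auto simp: coeff_eq_0)
    then show "coeff (f $ i mod ?N) n = coeff ([:0, 1:] * [:coeff (f $ i mod ?N) 1:] + [:coeff (f $ i mod ?N) 0:]) n"
      by (auto simp: coeff_pCons split: nat.splits)
  qed
  have div: "?N * (f $ i div ?N) + f $ i mod ?N = f $ i" for i
    by (rule mult_div_mod_eq)
  have lt: "poly_lt m (f $ i div ?N)" for i
  proof -
    have "poly_lt (m + 2) (f $ i mod ?N)"
      using degree_mod_less[of ?N "f $ i"] by (auto simp: poly_lt_iff)
    moreover have "poly_lt (m + 2) (f $ i)"
      using assms by (simp add: vec_lt_def)
    ultimately have "poly_lt (m + 2) (f $ i - f $ i mod ?N)"
      by (simp add: poly_lt_def)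
    also have "f $ i - f $ i mod ?N = ?N * (f $ i div ?N)"
      using div[of i] by (simp add: algebra_simps)
    finally show ?thesis
      using poly_lt_mult_iff[of ?N m] by simp
  qed
  show ?thesis
    by (rule exI[of _ "\<chi> i. f $ i div ?N"], rule exI[of _ "\<chi> i. coeff (f $ i mod ?N) 1"],
        rule exI[of _ "\<chi> i. coeff (f $ i mod ?N) 0"])
      (use lt r div in \<open>simp add: vec_lt_def vec_eq_iff const_vec_def\<close>)
qed


lemma poly_lt_one: "poly_lt (Suc m) 1"
  by (auto simp: poly_lt_def)

text \<open>Read \<open>x1 u1 + x2 u2\<close> as \<open>x1 + x2 i\<close> and let
  \<open>\<tau> = s + i\<close>, an element of norm \<open>N\<close>. The plane part of
  \<open>f\<close> is \<open>\<tau> + N (k1 + k2 i) = \<tau> h\<close> with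
  \<open>h = h1 + h2 i = 1 + (s + 1 + i)(k1 + k2 i)\<close>, and that of \<open>g\<close> is
  \<open>\<tau> (n1 + e i)\<close>. Now divide the orthogonal part of \<open>f + \<rho> g\<close> by
  \<open>\<rho>\<close> and its plane part by \<open>c \<tau>\<close>: once \<open>l N\<close> is
  replaced by \<open>c l N\<close>, both contributions to the value are divided by
  \<open>\<rho>^2 = c N\<close>. The result is \<open>f' + \<rho> g'\<close>.\<close>

lemma scaled_nform_plane_reduce:
  fixes a l l' c c' s :: "'a::idom" and A :: "'a ^ 'n::finite ^ 'n"
  assumes "scaled_nform_plane a l l' A u1 u2"
    and N: "N = s\<^sup>2 + s + a" "N \<noteq> 0" and c': "c * c' = 1"
    and k0: "bform A k0 u1 = 0" "bform A k0 u2 = 0" and g0: "bform A g0 u1 = 0" "bform A g0 u2 = 0"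
    and f: "f = N *s k0 + ((s + N * k1) *s u1 + (1 + N * k2) *s u2)" and g: "g = g0 + (g1 *s u1 + g2 *s u2)"
    and eq: "qform A f = c * N * qform A g" and orth: "bform A f g = 0"
    and e: "e = l' * bform A k0 g0 + k1 * g2 + k2 * g1"
    and h1: "h1 = 1 + (s + 1) * k1 + a * k2" and h2: "h2 = k1 + s * k2"
    and n1: "n1 = g2 + (s + 1) * e"
    and f': "f' = g0 + ((c' * h1) *s u1 + (c' * h2) *s u2)"
    and g': "g' = c' *s k0 + ((c' * n1) *s u1 + (c' * e) *s u2)"
    and B: "B = scaled_nform_plane.twisted a l' A u1 u2 c"
  shows "N * e = s * g2 + g1" "s * n1 = g1 + a * e" "s * h2 + h1 + h2 = 1 + N * k2"
    and "qform B f' = c * N * qform B g'" "bform B f' g' = 0"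
proof -
  interpret scaled_nform_plane a l l' A u1 u2 by fact
  have N_k0: "bform A (N *s k0) u1 = 0" "bform A (N *s k0) u2 = 0"
    and c_k0: "bform A (c' *s k0) u1 = 0" "bform A (c' *s k0) u2 = 0"
    by (simp_all add: k0 bform_linear)
  have l: "l \<noteq> 0"
    using unit by auto
  \<comment> \<open>Divisibility of \<open>g1 + g2 i\<close> by \<open>\<tau>\<close> comes from the
    orthogonality of \<open>f\<close> and \<open>g\<close>: it makes \<open>s g2 + g1\<close> a
    multiple of \<open>N\<close>, with quotient \<open>e\<close>.\<close>
  have orth': "N * bform A k0 g0 + l * ((s + N * k1) * g2 + (1 + N * k2) * g1) = 0"
    using orth unfolding f g bform_plane_add[OF N_k0 g0] by (simp add: bform_linear)
  from this have "l' * (N * bform A k0 g0) + (l' * l) * ((s + N * k1) * g2 + (1 + N * k2) * g1) = 0"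
    by (metis distrib_left mult.assoc mult_zero_right)
  then have "N * e + (s * g2 + g1) = 0"
    unfolding unit e by (simp add: algebra_simps)
  then show Ne: "N * e = s * g2 + g1"
    using two_simps(3) by (metis eq_neg_iff_add_eq_0)
  have "s * n1 = s * g2 + (N + a) * e"
    by (simp add: n1 N algebra_simps power2_eq_square two_simps two)
  then show g1: "s * n1 = g1 + a * e"
    by (simp add: algebra_simps Ne two_simps two)
  show f2: "s * h2 + h1 + h2 = 1 + N * k2"
    by (simp add: h1 h2 N algebra_simps power2_eq_square two_simps two)
  have f1: "s * h1 + a * h2 = s + N * k1"
    by (simp add: h1 h2 N algebra_simps power2_eq_square two_simps two)
  have g1': "s * n1 + a * e = g1"
    by (simp add: g1 two_simps two add.assoc)
  have g2: "s * e + n1 + e = g2"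
    by (simp add: n1 algebra_simps two_simps two)
  have Ns: "nform a s 1 = N"
    by (simp add: N nform_def)
  have nf: "nform a (s + N * k1) (1 + N * k2) = N * nform a h1 h2"
    using nform_mult[OF two, of a s h1 1 h2] unfolding Ns f1[symmetric] f2[symmetric] by (simp add: add_ac)
  have ng: "nform a g1 g2 = N * nform a n1 e"
    using nform_mult[OF two, of a s n1 1 e] unfolding Ns g1'[symmetric] g2[symmetric] by (simp add: add_ac)
  have bfg: "(s + N * k1) * g2 + (1 + N * k2) * g1 = N * (h1 * e + h2 * n1)"
  proof -
    have "(s * h1 + a * h2) * (s * e + n1 + e) + (s * h2 + h1 + h2) * (s * n1 + a * e) = N * (h1 * e + h2 * n1)"
      by (simp add: N algebra_simps power2_eq_square two_simps two)
    then show ?thesis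
      unfolding f1 f2 g1' g2 .
  qed
  have "N * (N * qform A k0 + l * nform a h1 h2) = N * (c * (qform A g0 + l * N * nform a n1 e))"
    using eq unfolding f g qform_plane_add[OF N_k0] qform_plane_add[OF g0] nf ng qform_scale
    by (simp add: algebra_simps power2_eq_square)
  then have E1: "N * qform A k0 + l * nform a h1 h2 = c * (qform A g0 + l * N * nform a n1 e)"
    using N(2) by simp
  have "N * (bform A k0 g0 + l * (h1 * e + h2 * n1)) = 0"
    using orth' unfolding bfg by (simp add: algebra_simps)
  then have E2: "bform A k0 g0 + l * (h1 * e + h2 * n1) = 0"
    using N(2) by simp
  have "c * N * qform B g' = (c * c') * (c' * (N * qform A k0) + (c * c') * l * N * nform a n1 e)"
    unfolding B g' qform_twisted_add[OF c_k0] nform_scale qform_scale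
    by (simp add: algebra_simps power2_eq_square)
  also have "N * qform A k0 = c * (qform A g0 + l * N * nform a n1 e) + l * nform a h1 h2"
    unfolding E1[symmetric] by (simp add: two_simps two add.assoc)
  also have "(c * c') * (c' * (c * (qform A g0 + l * N * nform a n1 e) + l * nform a h1 h2) + (c * c') * l * N * nform a n1 e) =
      (c * c') * ((c * c') * (qform A g0 + l * N * nform a n1 e) + c' * l * nform a h1 h2 + (c * c') * l * N * nform a n1 e)"
    by (simp only: algebra_simps)
  also have "\<dots> = qform A g0 + c' * l * nform a h1 h2"
    unfolding c' by (simp add: algebra_simps two_simps two)
  also have "\<dots> = qform A g0 + (c * c') * c' * l * nform a h1 h2"
    unfolding c' by simp
  also have "\<dots> = qform B f'"
    unfolding B f' qform_twisted_add[OF g0] nform_scale by (simp add: power2_eq_square algebra_simps)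
  finally show "qform B f' = c * N * qform B g'" ..
  have "bform B f' g' = c' * bform A k0 g0 + (c * c') * (c' * (l * (h1 * e + h2 * n1)))"
    unfolding B f' g' bform_twisted_add[OF g0 c_k0]
    by (simp add: bform_linear bform_commute[of A g0 k0] algebra_simps)
  also have "\<dots> = c' * (bform A k0 g0 + l * (h1 * e + h2 * n1))"
    unfolding c' by (simp add: algebra_simps)
  finally show "bform B f' g' = 0"
    unfolding E2 by simp
qed

text \<open>
  Rost's degree reduction: modulo \<open>s\<^sup>2 + s + a\<close> the vector \<open>f\<close> is a zero of the form over \<open>F(i)\<close>, which
  splits off a plane \<open>\<lambda>[1, a]\<close>. There \<open>f\<close> and \<open>g\<close> become divisible by \<open>s + i\<close>, and this
  factor can be cancelled after twisting the plane by \<open>c\<close>.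
\<close>

lemma poly_zero_reduce:
  fixes a c :: "'a::field" and A :: "'a ^ 'n::finite ^ 'n"
  assumes two: "(2::'a) = 0" and c: "c \<noteq> 0" and aniso: "anisotropic A"
    and zero: "poly_zero a c (m + 2) A"
  shows "poly_zero a c (m + 1) A \<or> (\<exists>l u1 u2. scaled_nform_plane a l (1 / l) A u1 u2 \<and>
    poly_zero a c (m + 1) (scaled_nform_plane.twisted a (1 / l) A u1 u2 c))"
proof -
  let ?A = "const_form A" and ?N = "conic_N a" and ?X = "[:0, 1:] :: 'a poly"
  obtain f g where nz: "f \<noteq> 0 \<or> g \<noteq> 0" and "vec_lt (m + 3) f" and gm: "vec_lt (m + 2) g"
    and eq: "qform ?A f = [:c:] * ?N * qform ?A g" and orth: "bform ?A f g = 0"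
    using zero by (auto simp: poly_zero_def eval_nat_numeral)
  then obtain k u1 u2 where km: "vec_lt (m + 1) k"
    and f: "f = ?N *s k + (?X *s const_vec u1 + const_vec u2)"
    using poly_vec_divide[of "m + 1" f a] by (auto simp: numeral_3_eq_3)
  define l where "l = qform A u1"
  let ?r = "?X *s const_vec u1 + const_vec u2"
  \<comment> \<open>Modulo \<open>N\<close> the value of the remainder agrees with that of
    \<open>f\<close>, which is divisible by \<open>N\<close>. Being quadratic in \<open>s\<close>,
    it is a constant multiple \<open>l N\<close>; its coefficients say that \<open>u1\<close>,
    \<open>u2\<close> span \<open>l[1, a]\<close>.\<close>
  have "qform ?A ?r = ?N * ([:c:] * qform ?A g - ?N * qform ?A k - bform ?A k ?r)"
    using eq unfolding f qform_add[of _ "?N *s k" ?r] qform_scale bform_linear(3)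
    by (simp add: algebra_simps power2_eq_square)
  then have "?N dvd [:qform A u2, bform A u1 u2, qform A u1:]"
    unfolding qform_linear_const by (metis dvd_triv_left)
  from conic_N_dvd_quadratic[OF this]
  have u: "qform A u1 = l" "bform A u1 u2 = l" "qform A u2 = a * l"
    by (simp_all add: l_def)
  show ?thesis
  proof (cases "l = 0")
    case True
    \<comment> \<open>Here the twist is unnecessary: \<open>f = N k\<close> gives
      \<open>f + \<rho> g = \<rho> (g + \<rho> k / c)\<close>, and the factor \<open>\<rho>\<close>
      is dropped.\<close>
    then have "u1 = 0" "u2 = 0"
      using aniso u by (auto simp: isotropic_def)
    then have fk: "f = ?N *s k"
      by (simp add: f const_vec_def vec_eq_iff)
    have "?N * (?N * qform ?A k) = ?N * ([:c:] * qform ?A g)"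
      using eq unfolding fk qform_scale by (simp add: power2_eq_square algebra_simps)
    then have *: "?N * qform ?A k = [:c:] * qform ?A g"
      by (rule mult_left_cancel[OF conic_N_nz, THEN iffD1])
    have "?N * bform ?A k g = 0"
      using orth unfolding fk bform_linear .
    then have "bform ?A k g = 0"
      by simp
    then have orth': "bform ?A g ([:1 / c:] *s k) = 0"
      by (simp only: bform_linear bform_commute[of _ g k]) simp
    have "[:c:] * ?N * qform ?A ([:1 / c:] *s k) = [:c:] * [:1 / c:]\<^sup>2 * (?N * qform ?A k)"
      by (simp only: qform_scale mult_ac)
    also have "\<dots> = qform ?A g"
      unfolding * using c by (simp add: power2_eq_square)
    finally have eq': "qform ?A g = [:c:] * ?N * qform ?A ([:1 / c:] *s k)" ..
    have "vec_lt (m + 1) ([:1 / c:] *s k)"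
      using km by (rule vec_lt_const)
    moreover have "g \<noteq> 0 \<or> [:1 / c:] *s k \<noteq> 0"
      using nz fk c by auto
    ultimately have "poly_zero a c (m + 1) A"
      using gm eq' orth' unfolding poly_zero_def by fastforce
    then show ?thesis ..
  next
    case False
    have plane: "scaled_nform_plane a l (1 / l) A u1 u2"
      using two False u by unfold_locales simp_all
    interpret P: scaled_nform_plane "[:a:]" "[:l:]" "[:1 / l:]" ?A "const_vec u1" "const_vec u2"
      using two_poly[OF two] False u by unfold_locales (simp_all add: qform_const bform_const)
    define B where "B = scaled_nform_plane.twisted a (1 / l) A u1 u2 c"
    have B: "const_form B = P.twisted [:c:]"
      unfolding B_def scaled_nform_plane.twisted_def[OF plane] P.twisted_def twist_form_const by (simp add: one_pCons)
    have ci: "[:c:] * [:1 / c:] = (1 :: 'a poly)"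
      using c by simp
    define k1 k2 g1 g2 where k_def: "k1 = P.coord1 k" "k2 = P.coord2 k" "g1 = P.coord1 g" "g2 = P.coord2 g"
    define k0 g0 where k0_def: "k0 = P.rest k" "g0 = P.rest g"
    have f_dec: "P.rest f = ?N *s k0" "P.coord1 f = ?X + ?N * k1" "P.coord2 f = 1 + ?N * k2"
      by (simp_all add: f k_def k0_def P.rest_linear P.coord_linear add.commute)
    have f_eq: "f = ?N *s k0 + ((?X + ?N * k1) *s const_vec u1 + (1 + ?N * k2) *s const_vec u2)"
      using P.decompose[of f] unfolding f_dec .
    have g_eq: "g = g0 + (g1 *s const_vec u1 + g2 *s const_vec u2)"
      using P.decompose[of g] by (simp add: k_def k0_def)
    have k0_orth: "bform ?A k0 (const_vec u1) = 0" "bform ?A k0 (const_vec u2) = 0"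
      and g0_orth: "bform ?A g0 (const_vec u1) = 0" "bform ?A g0 (const_vec u2) = 0"
      by (simp_all add: k0_def P.rest_orth)
    define e where "e = [:1 / l:] * bform ?A k0 g0 + k1 * g2 + k2 * g1"
    define h1 h2 where h_def: "h1 = 1 + (?X + 1) * k1 + [:a:] * k2" "h2 = k1 + ?X * k2"
    define n1 where "n1 = g2 + (?X + 1) * e"
    define f' where "f' = g0 + (([:1 / c:] * h1) *s const_vec u1 + ([:1 / c:] * h2) *s const_vec u2)"
    define g' where "g' = [:1 / c:] *s k0 + (([:1 / c:] * n1) *s const_vec u1 + ([:1 / c:] * e) *s const_vec u2)"
    note red = scaled_nform_plane_reduce[OF P.scaled_nform_plane_axioms conic_N_eq conic_N_nz ci k0_orth
        g0_orth f_eq g_eq eq orth e_def h_def n1_def f'_def g'_def B]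

    have coord_lt: "poly_lt n (P.coord1 v)" "poly_lt n (P.coord2 v)" if "vec_lt n v" for n v
      unfolding P.coord1_def P.coord2_def by (intro poly_lt_const poly_lt_bform that)+
    have rest_lt: "vec_lt n (P.rest v)" if "vec_lt n v" for n v
      unfolding P.rest_def by (intro vec_lt_add vec_lt_const_vec coord_lt that)
    have k_lt: "poly_lt (m + 1) k1" "poly_lt (m + 1) k2" "vec_lt (m + 1) k0"
      and g_lt: "poly_lt (m + 2) g1" "poly_lt (m + 2) g2" "vec_lt (m + 2) g0"
      using coord_lt[OF km] coord_lt[OF gm] rest_lt[OF km] rest_lt[OF gm] by (simp_all add: k_def k0_def)
    \<comment> \<open>The gain in degree: \<open>N e\<close> has degree at most \<open>m + 2\<close>
      and \<open>s n1\<close> at most \<open>m + 1\<close>, so \<open>e\<close> and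
      \<open>n1\<close> have degree at most \<open>m\<close>.\<close>
    have "poly_lt (m + 3) (?X * g2 + g1)"
      using g_lt poly_lt_X[of "m + 2" g2] poly_lt_mono[OF g_lt(1), of "m + 3"]
      by (intro poly_lt_add) (simp_all add: eval_nat_numeral)
    then have e_lt: "poly_lt (m + 1) e"
      using poly_lt_mult_iff[of ?N "m + 1" e] unfolding red(1)[symmetric] by (simp add: eval_nat_numeral)
    have "poly_lt (m + 2) (?X * n1)"
      unfolding red(2) by (intro poly_lt_add g_lt poly_lt_const poly_lt_mono[OF e_lt]) simp
    then have n1_lt: "poly_lt (m + 1) n1"
      using poly_lt_X[of "m + 1" n1] by simp
    have X_lt: "poly_lt (m + 2) (?X * p)" if "poly_lt (m + 1) p" for p
      using poly_lt_X[of "m + 1" p] that by simp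
    have h_lt: "poly_lt (m + 2) h1" "poly_lt (m + 2) h2"
      unfolding h_def distrib_right mult_1_left
      using k_lt(1,2)[THEN poly_lt_mono, of "m + 2"] poly_lt_one[of "m + 1"]
      by (intro poly_lt_add X_lt k_lt poly_lt_const; simp)+
    have "vec_lt (Suc (m + 1)) f'"
      unfolding f'_def using h_lt g_lt(3) by (intro vec_lt_add vec_lt_const_vec poly_lt_const) simp_all
    moreover have "vec_lt (m + 1) g'"
      unfolding g'_def using e_lt n1_lt k_lt(3)
      by (intro vec_lt_add vec_lt_const_vec poly_lt_const vec_lt_const)
    moreover have "f' \<noteq> 0"
    proof
      assume f'0: "f' = 0"
      have "bform ?A f' (0 + (y1 *s const_vec u1 + y2 *s const_vec u2)) =
          [:l:] * (([:1 / c:] * h1) * y2 + ([:1 / c:] * h2) * y1)" for y1 y2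
        unfolding f'_def P.bform_plane_add[OF g0_orth bform_linear(5) bform_linear(5)]
        by (simp add: bform_linear)
      from this[of 0 1] this[of 1 0] have "h1 = 0" "h2 = 0"
        unfolding f'0 using False c by (simp_all add: bform_linear)
      \<comment> \<open>With \<open>h = 0\<close> also \<open>\<tau> h = 0\<close>, but the
        \<open>i\<close>-coordinate of \<open>\<tau> h\<close> is \<open>1 + N k2\<close>, and
        \<open>N\<close> is not a unit.\<close>
      then have "?N * k2 = - 1"
        using red(3) by (simp add: add_eq_0_iff)
      then have "?N * (- k2) = 1"
        by simp
      then have "?N dvd 1"
        by (metis dvd_triv_left)
      then show False
        using dvd_imp_degree_le[of ?N 1] by simp
    qed
    ultimately have "poly_zero a c (m + 1) B"
      unfolding poly_zero_def using red(4,5) by blast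
    then show ?thesis
      using plane B_def by blast
  qed
qed


section \<open>Zeros of degree 0 and 1, and the induction on the degree\<close>

lemma poly_lt_one_iff: "poly_lt (Suc 0) p \<longleftrightarrow> p = [:coeff p 0:]"
  by (auto simp: poly_lt_def poly_eq_iff coeff_pCons split: nat.splits) (metis Suc_le_D)

lemma vec_lt_zero_iff: "vec_lt 0 f \<longleftrightarrow> f = 0"
  by (auto simp: vec_lt_def poly_lt_def vec_eq_iff poly_eq_iff)

lemma vec_lt_oneD: "vec_lt (Suc 0) f \<Longrightarrow> \<exists>u. f = const_vec u"
  by (rule exI[of _ "\<chi> i. coeff (f $ i) 0"])
    (simp add: vec_lt_def poly_lt_one_iff const_vec_def vec_eq_iff)

lemma vec_lt_twoD: "vec_lt 2 f \<Longrightarrow> \<exists>u v. f = [:0, 1:] *s const_vec u + const_vec v"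
proof -
  assume f: "vec_lt 2 f"
  have "f $ i = [:0, 1:] * [:coeff (f $ i) 1:] + [:coeff (f $ i) 0:]" for i
  proof (rule poly_eqI)
    fix n show "coeff (f $ i) n = coeff ([:0, 1:] * [:coeff (f $ i) 1:] + [:coeff (f $ i) 0:]) n"
      using f by (auto simp: vec_lt_def poly_lt_def coeff_pCons split: nat.splits)
  qed
  then show ?thesis
    by (intro exI[of _ "\<chi> i. coeff (f $ i) 1"] exI[of _ "\<chi> i. coeff (f $ i) 0"])
      (simp add: vec_eq_iff const_vec_def)
qed

lemma const_vec_eq_0_iff: "const_vec u = 0 \<longleftrightarrow> u = 0"
  by (simp add: const_vec_def vec_eq_iff)

lemma poly_zero_0_imp_isotropic:
  assumes "poly_zero a c 0 A" shows "isotropic A"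
proof -
  obtain f where "f \<noteq> 0" "vec_lt (Suc 0) f" "qform (const_form A) f = 0"
    using assms by (auto simp: poly_zero_def vec_lt_zero_iff)
  then obtain u where "const_vec u \<noteq> 0" "qform (const_form A) (const_vec u) = 0"
    using vec_lt_oneD by blast
  then show ?thesis
    by (auto simp: isotropic_def qform_const const_vec_eq_0_iff)
qed

lemma poly_zero_1_imp_contains_conic:
  fixes a c :: "'a::field"
  assumes aniso: "anisotropic A" and c: "c \<noteq> 0" and "poly_zero a c 1 A"
  shows "contains_conic a c A"
proof -
  let ?A = "const_form A" and ?X = "[:0, 1:] :: 'a poly"
  obtain f g where nz: "f \<noteq> 0 \<or> g \<noteq> 0" and "vec_lt 2 f" "vec_lt (Suc 0) g"
    and eq: "qform ?A f = [:c:] * conic_N a * qform ?A g" and orth: "bform ?A f g = 0"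
    using assms(3) by (auto simp: poly_zero_def numeral_2_eq_2)
  then obtain u1 u2 v where f: "f = ?X *s const_vec u1 + const_vec u2" and g: "g = const_vec v"
    using vec_lt_twoD vec_lt_oneD by metis
  define m where "m = c * qform A v"
  have "[:qform A u2, bform A u1 u2, qform A u1:] = [:a * m, m, m:]"
    using eq unfolding f g qform_linear_const qform_const by (simp add: conic_N_def m_def mult_ac)
  then have u: "qform A u1 = m" "qform A u2 = a * m" "bform A u1 u2 = m"
    by auto
  have "[:bform A u2 v, bform A u1 v:] = 0"
    using orth unfolding f g by (simp add: bform_linear bform_const)
  then have uv: "bform A u1 v = 0" "bform A u2 v = 0"
    by auto
  have "m \<noteq> 0"
  proof
    assume "m = 0"
    then have "u1 = 0" "u2 = 0" "v = 0"
      using aniso u c by (auto simp: isotropic_def m_def)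
    then show False
      using nz by (simp add: f g const_vec_def vec_eq_iff)
  qed
  \<comment> \<open>The value of \<open>v\<close> is \<open>m / c\<close>; rescaling by
    \<open>c\<close> gives the \<open>c m\<close> required of the third vector of the conic.\<close>
  moreover have "qform A (c *s v) = c * m"
    by (simp add: qform_scale m_def power2_eq_square)
  ultimately show ?thesis
    using u uv unfolding contains_conic_def
    by (intro exI[of _ m] exI[of _ u1] exI[of _ u2] exI[of _ "c *s v"]) (simp add: bform_linear)
qed

text \<open>Split the isotropic vector as \<open>t + x\<close> with \<open>x\<close> in the plane.
  Then \<open>t\<close> has value \<open>c m\<close> in \<open>A\<close> for
  \<open>m = l N(x)\<close>, and since \<open>N\<close> is multiplicative the plane
  \<open>l N\<close> is also \<open>m N\<close>, with basis \<open>x\<close>,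
  \<open>i x\<close>.\<close>

lemma contains_conic_if_twisted_isotropic:
  fixes a c :: "'a::field"
  assumes "scaled_nform_plane a l l' A u1 u2" and c: "c \<noteq> 0"
    and N: "\<And>x y. nform a x y = 0 \<Longrightarrow> x = 0 \<and> y = 0"
    and aniso: "anisotropic A" and iso: "isotropic (scaled_nform_plane.twisted a l' A u1 u2 c)"
  shows "contains_conic a c A"
proof -
  interpret scaled_nform_plane a l l' A u1 u2 by fact
  have l: "l \<noteq> 0"
    using unit by auto
  obtain v where v: "v \<noteq> 0" "qform (twisted c) v = 0"
    using iso by (auto simp: isotropic_def)
  define t x1 x2 where "t = rest v" and "x1 = coord1 v" and "x2 = coord2 v"
  have v_eq: "v = t + (x1 *s u1 + x2 *s u2)"
    using decompose[of v] by (simp add: t_def x1_def x2_def)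
  have t: "bform A t u1 = 0" "bform A t u2 = 0"
    by (simp_all add: t_def rest_orth)
  define m where "m = l * nform a x1 x2"
  have "qform A t + c * m = 0"
    using v(2) unfolding v_eq qform_twisted_add[OF t] by (simp add: m_def mult.assoc)
  then have qt: "qform A t = c * m"
    using two_simps(3) by (metis eq_neg_iff_add_eq_0)
  have m: "m \<noteq> 0"
  proof
    assume "m = 0"
    then have "x1 = 0" "x2 = 0" "t = 0"
      using l N[of x1 x2] qt aniso by (auto simp: m_def isotropic_def)
    then show False
      using v(1) v_eq by simp
  qed
  \<comment> \<open>\<open>?w1\<close> is \<open>i\<close> times \<open>?w0\<close>. The summand 0
    is the orthogonal part, so that \<open>qform_plane_add\<close> and
    \<open>bform_plane_add\<close> apply literally.\<close>
  let ?w0 = "0 + (x1 *s u1 + x2 *s u2)" and ?w1 = "0 + ((a * x2) *s u1 + (x1 + x2) *s u2)"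
  have z: "bform A 0 u1 = 0" "bform A 0 u2 = 0"
    by (simp_all add: bform_linear)
  have "nform a (a * x2) (x1 + x2) = a * nform a x1 x2"
    using nform_mult[OF two, of a 0 x1 1 x2] by (simp add: nform_def add_ac)
  then have "qform A ?w0 = m" "qform A ?w1 = a * m"
    unfolding qform_plane_add[OF z] by (simp_all add: m_def)
  moreover have "bform A ?w0 ?w1 = m"
    unfolding bform_plane_add[OF z z]
    by (simp add: m_def bform_linear nform_def algebra_simps power2_eq_square)
  moreover have "bform A ?w0 t = 0" "bform A ?w1 t = 0"
    using t by (simp_all add: bform_linear bform_commute[of A _ t])
  ultimately show ?thesis
    using m qt unfolding contains_conic_def by blast
qed

theorem poly_zero_imp_contains_conic:
  fixes a c :: "'a::field" and A :: "'a ^ 'n::finite ^ 'n"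
  assumes two: "(2::'a) = 0" and card: "CARD('n) = 4"
    and Q: "\<And>q. qnorm a c q = 0 \<Longrightarrow> q = 0"
    and "anisotropic A" "poly_zero a c m A"
  shows "contains_conic a c A"
proof -
  have N: "x = 0 \<and> y = 0" if "nform a x y = 0" for x y
    using Q[of "(x, y, 0, 0)"] that by (simp add: zero_prod_def)
  have c: "c \<noteq> 0"
    using Q[of "(0, 0, 1, 0)"] by (auto simp: nform_def zero_prod_def)
  show ?thesis
    using assms(4,5)
  proof (induction m arbitrary: A rule: less_induct)
    case (less m)
    consider "m = 0" | "m = 1" | n where "m = n + 2"
      by (metis One_nat_def add_2_eq_Suc' not0_implies_Suc)
    then show ?case
    proof cases
      case 1
      then show ?thesis
        using less.prems poly_zero_0_imp_isotropic by blast
    next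
      case 2
      then show ?thesis
        using less.prems poly_zero_1_imp_contains_conic c by blast
    next
      case 3
      from poly_zero_reduce[OF two c less.prems(1)] less.prems(2)
      consider "poly_zero a c (n + 1) A"
        | l u1 u2 where "scaled_nform_plane a l (1 / l) A u1 u2"
          "poly_zero a c (n + 1) (scaled_nform_plane.twisted a (1 / l) A u1 u2 c)"
        unfolding 3 by blast
      then show ?thesis
      proof cases
        case 1
        then show ?thesis
          using less.IH[of "n + 1" A] less.prems(1) 3 by simp
      next
        case plane: 2
        let ?B = "scaled_nform_plane.twisted a (1 / l) A u1 u2 c"
        \<comment> \<open>The induction hypothesis serves only to refute anisotropy of the twisted
          form: a conic in it would make \<open>A\<close> isotropic by the dimension count. The
          conic in \<open>A\<close> then comes from a zero of \<open>?B\<close> over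
          \<open>F\<close> itself.\<close>
        have "isotropic ?B"
        proof (rule ccontr)
          assume "anisotropic ?B"
          then have "contains_conic a c ?B"
            using less.IH[of "n + 1" ?B] plane(2) 3 by simp
          then show False
            using isotropic_if_twisted_contains_conic[OF plane(1) card Q] less.prems(1) by blast
        qed
        then show ?thesis
          using contains_conic_if_twisted_isotropic[OF plane(1) c N less.prems(1)] by blast
      qed
    qed
  qed
qed

section \<open>The function field of the conic\<close>

definition ring_hom_fun :: "('a::comm_ring_1 \<Rightarrow> 'b::comm_ring_1) \<Rightarrow> bool"
  where "ring_hom_fun h \<longleftrightarrow> h 0 = 0 \<and> h 1 = 1 \<and> (\<forall>x y. h (x + y) = h x + h y) \<and> (\<forall>x y. h (x * y) = h x * h y)"

definition eval_hom :: "('a::comm_ring_1 \<Rightarrow> 'b::comm_ring_1) \<Rightarrow> 'b \<Rightarrow> 'a poly \<Rightarrow> 'b"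
  where "eval_hom h x p = poly (map_poly h p) x"

lemma eval_hom_simps:
  assumes "ring_hom_fun h"
  shows "eval_hom h x 0 = 0" "eval_hom h x (pCons c p) = h c + x * eval_hom h x p" "eval_hom h x [:c:] = h c"
  using assms by (simp_all add: eval_hom_def ring_hom_fun_def map_poly_pCons)

lemma ring_hom_eval_hom:
  assumes h: "ring_hom_fun h"
  shows "ring_hom_fun (eval_hom h x)"
proof -
  have add: "eval_hom h x (p + q) = eval_hom h x p + eval_hom h x q" for p q
  proof -
    have "map_poly h (p + q) = map_poly h p + map_poly h q"
      using h by (intro poly_eqI) (simp add: coeff_map_poly ring_hom_fun_def)
    then show ?thesis
      by (simp add: eval_hom_def)
  qed
  have smult: "eval_hom h x (smult c p) = h c * eval_hom h x p" for c p
  proof -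
    have "map_poly h (smult c p) = smult (h c) (map_poly h p)"
      using h by (intro poly_eqI) (simp add: coeff_map_poly ring_hom_fun_def)
    then show ?thesis
      by (simp add: eval_hom_def)
  qed
  have "eval_hom h x (p * q) = eval_hom h x p * eval_hom h x q" for p q
  proof (induction p)
    case (pCons c p)
    then show ?case
      using h by (simp add: mult_pCons_left add smult eval_hom_simps ring_hom_fun_def algebra_simps)
  qed (simp add: eval_hom_simps[OF h])
  moreover have "eval_hom h x 1 = 1"
    using h eval_hom_simps(3)[OF h, of x 1] by (simp add: one_pCons ring_hom_fun_def)
  ultimately show ?thesis
    using add eval_hom_simps(1)[OF h] by (simp add: ring_hom_fun_def)
qed

context
  fixes h :: "'a::comm_ring_1 \<Rightarrow> 'b::comm_ring_1"
  assumes h: "ring_hom_fun h"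
begin

lemma hom_simps: "h 0 = 0" "h 1 = 1" "h (x + y) = h x + h y" "h (x * y) = h x * h y"
  using h by (simp_all add: ring_hom_fun_def)

lemma hom_sum: "h (sum f S) = (\<Sum>i\<in>S. h (f i))"
  by (induction S rule: infinite_finite_induct) (simp_all add: hom_simps)

lemma hom_qform: "h (qform A x) = qform (base_change h A) (\<chi> i. h (x $ i))"
  by (simp add: qform_def base_change_def hom_sum hom_simps)

lemma hom_bform: "h (bform A x y) = bform (base_change h A) (\<chi> i. h (x $ i)) (\<chi> i. h (y $ i))"
  by (simp add: bform_def base_change_def hom_sum hom_simps)

end

lemma field_hom_ring_hom: "field_hom \<iota> \<Longrightarrow> ring_hom_fun \<iota>"
  unfolding field_hom_def ring_hom_fun_def using add_cancel_right_right[of "\<iota> 0" "\<iota> 0"]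
  by (metis add_0)

lemma field_hom_eq_0_iff: "field_hom \<iota> \<Longrightarrow> \<iota> x = 0 \<longleftrightarrow> x = 0"
proof -
  assume "field_hom \<iota>"
  note hom = hom_simps[OF field_hom_ring_hom[OF this]]
  have "\<iota> x * \<iota> (inverse x) = 1" if "x \<noteq> 0"
    using hom(4)[of x "inverse x"] hom(2) that by simp
  then show ?thesis
    using hom(1) by force
qed

lemma eval2_eq: "eval2 \<iota> x y = eval_hom (eval_hom \<iota> x) y"
  by (simp add: eval2_def[abs_def] eval_hom_def[abs_def])

text \<open>
  \<open>q\<close> is the homogenisation \<open>y\<^sup>M p(x/y)\<close>, and the second evaluation substitutes \<open>x = s y\<close> in \<open>F[s][y]\<close>.
\<close>

lemma ex_homogenisation:
  fixes \<iota> :: "'a::field \<Rightarrow> 'b::field" and x y :: 'b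
  assumes \<iota>: "field_hom \<iota>" and y: "y \<noteq> 0"
  shows "\<exists>M q. eval2 \<iota> x y q = y ^ M * eval_hom \<iota> (x / y) p \<and>
    eval_hom (eval_hom (\<lambda>c. [:[:c:]:]) [:0, [:0, 1:]:]) [:0, 1:] q = monom p M"
proof (induction p)
  case 0
  then show ?case
    by (intro exI[of _ 0]) (simp add: eval2_eq eval_hom_def)
next
  case (pCons c p)
  let ?k = "\<lambda>c::'a. [:[:c:]:]" and ?X = "[:0, [:0, 1:]:] :: 'a poly poly" and ?Y = "[:0, 1:] :: 'a poly poly"
  have k: "ring_hom_fun ?k"
    by (simp add: ring_hom_fun_def one_pCons mult.commute)
  note \<iota> = field_hom_ring_hom[OF assms(1)]
  note one = hom_simps(2)[OF ring_hom_eval_hom[OF \<iota>]] hom_simps(2)[OF ring_hom_eval_hom[OF k]]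
  note hom_\<iota> = hom_simps[OF ring_hom_eval_hom[OF ring_hom_eval_hom[OF \<iota>]]]
    and hom_k = hom_simps[OF ring_hom_eval_hom[OF ring_hom_eval_hom[OF k]]]
    and ev_\<iota> = eval_hom_simps[OF \<iota>] eval_hom_simps[OF ring_hom_eval_hom[OF \<iota>]]
    and ev_k = eval_hom_simps[OF k] eval_hom_simps[OF ring_hom_eval_hom[OF k]]
  obtain M q where q: "eval2 \<iota> x y q = y ^ M * eval_hom \<iota> (x / y) p"
    "eval_hom (eval_hom ?k ?X) ?Y q = monom p M"
    using pCons.IH by blast
  have Ypow: "eval_hom (eval_hom \<iota> x) y ([:0, 1:] ^ n) = y ^ n" "eval_hom (eval_hom ?k ?X) ?Y ([:0, 1:] ^ n) = ?Y ^ n" for n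
    by (induction n) (simp_all add: hom_\<iota> hom_k ev_\<iota> ev_k hom_simps[OF \<iota>] one del: mult_pCons_left)
  let ?q = "[:[:c:]:] * [:0, 1:] ^ Suc M + [:[:0, 1:]:] * q"
  have "eval2 \<iota> x y ?q = y ^ Suc M * eval_hom \<iota> (x / y) (pCons c p)"
    using q(1) y unfolding eval2_eq hom_\<iota> Ypow
    by (simp add: ev_\<iota> hom_simps[OF \<iota>] field_simps)
  moreover have "eval_hom (eval_hom ?k ?X) ?Y ?q = monom (pCons c p) (Suc M)"
  proof -
    have "eval_hom (eval_hom ?k ?X) ?Y ?q = ?k c * ?Y ^ Suc M + ?X * monom p M"
      unfolding hom_k Ypow q(2) by (simp add: ev_k del: mult_pCons_left)
    also have "\<dots> = monom (pCons c p) (Suc M)"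
    proof (rule poly_eqI)
      fix n
      have "?Y ^ Suc M = monom 1 (Suc M)"
        by (simp add: monom_altdef)
      then show "coeff (?k c * ?Y ^ Suc M + ?X * monom p M) n = coeff (monom (pCons c p) (Suc M)) n"
        by (cases n) (auto simp: mult_monom)
    qed
    finally show ?thesis .
  qed
  ultimately show ?case
    by blast
qed

text \<open>If \<open>p \<noteq> 0\<close>, the quotient has degree \<open>M - 2\<close>, and its
  lowest term times \<open>c\<close> survives in the product in a degree below
  \<open>M\<close>.\<close>

lemma quadratic_dvd_monom_imp_zero:
  fixes c d p :: "'a::idom"
  assumes "[:c, 0, d:] dvd monom p M" "c \<noteq> 0" "d \<noteq> 0"
  shows "p = 0"
proof (rule ccontr)
  assume p: "p \<noteq> 0"
  obtain H where H: "monom p M = [:c, 0, d:] * H"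
    using assms(1) by blast
  then have nz: "H \<noteq> 0"
    using p by auto
  have "degree (monom p M) = degree [:c, 0, d:] + degree H"
    unfolding H using nz assms(3) by (intro degree_mult_eq) auto
  then have "M = 2 + degree H"
    using p assms(3) by (simp add: degree_monom_eq)
  define k where "k = (LEAST k. coeff H k \<noteq> 0)"
  have lead: "coeff H (degree H) \<noteq> 0"
    using nz by simp
  have k: "coeff H k \<noteq> 0"
    unfolding k_def using lead by (rule LeastI)
  have "k \<le> degree H"
    unfolding k_def using lead by (rule Least_le)
  have below: "coeff H j = 0" if "j < k" for j
    using not_less_Least[OF that[unfolded k_def]] by simp
  have "coeff ([:c, 0, d:] * H) k = c * coeff H k"
    using below by (auto simp: coeff_pCons split: nat.splits)
  then have "coeff (monom p M) k \<noteq> 0"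
    unfolding H using k assms(2) by (simp del: mult_pCons_left)
  then show False
    using \<open>M = 2 + degree H\<close> \<open>k \<le> degree H\<close> by simp
qed

section \<open>The function field as \<open>F(s)(\<rho>)\<close>\<close>

locale conic_function_field =
  fixes a c :: "'a::field" and \<iota> :: "'a \<Rightarrow> 'b::field" and x y :: 'b
  assumes two: "(2::'a) = 0" and c: "c \<noteq> 0" and \<iota>: "field_hom \<iota>"
    and zero: "eval2 \<iota> x y p = 0 \<longleftrightarrow> conic_poly a c dvd p"
    and frac: "\<exists>p q. eval2 \<iota> x y q \<noteq> 0 \<and> k = eval2 \<iota> x y p / eval2 \<iota> x y q"
begin

lemmas \<iota>_ring = field_hom_ring_hom[OF \<iota>]
lemmas \<iota>_simps = hom_simps[OF \<iota>_ring]

lemma two_K: "(2::'b) = 0"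
  using \<iota>_simps(3)[of 1 1] two \<iota>_simps by simp

lemma point: "x\<^sup>2 + x * y + \<iota> a * y\<^sup>2 = \<iota> c"
proof -
  have "eval2 \<iota> x y (conic_poly a c) = 0"
    unfolding zero by simp
  then have "x\<^sup>2 + x * y + \<iota> a * y\<^sup>2 + \<iota> c = 0"
    by (simp add: eval2_eq conic_poly_def eval_hom_simps ring_hom_eval_hom \<iota>_ring \<iota>_simps
        power2_eq_square algebra_simps)
  then show ?thesis
    using char2_simps(3)[OF two_K] by (metis eq_neg_iff_add_eq_0)
qed

text \<open>If the conic equation divided the polynomial \<open>y\<close>, comparison of the two
  lowest coefficients in \<open>y\<close> would make \<open>x^2 + c\<close> a unit of
  \<open>F[x]\<close>.\<close>

lemma y_nz: "y \<noteq> 0"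
proof
  assume "y = 0"
  then have "eval2 \<iota> x y [:0, 1:] = 0"
    by (simp add: eval2_eq eval_hom_simps ring_hom_eval_hom \<iota>_ring \<iota>_simps)
  then have "conic_poly a c dvd [:0, 1:]"
    unfolding zero .
  then obtain H where "[:0, 1:] = conic_poly a c * H"
    by blast
  then have "coeff ([:0, 1:] :: 'a poly poly) 0 = coeff (conic_poly a c * H) 0"
    by simp
  then have "[:c, 0, 1:] * coeff H 0 = 0"
    by (simp add: conic_poly_def)
  then have H0: "coeff H 0 = 0"
    by (simp del: mult_pCons_left)
  have "coeff ([:0, 1:] :: 'a poly poly) 1 = coeff (conic_poly a c * H) 1"
    using \<open>[:0, 1:] = conic_poly a c * H\<close> by simp
  then have "[:c, 0, 1:] * coeff H 1 = 1"
    using H0 by (simp add: conic_poly_def)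
  from this[symmetric] have "[:c, 0, 1:] dvd 1"
    by (rule dvdI)
  then show False
    using dvd_imp_degree_le[of "[:c, 0, 1:]" 1] by simp
qed

definition s where "s = x / y"
text \<open>In homogeneous coordinates \<open>s = x / y\<close> and \<open>\<rho> = c z / y\<close>.
  Dividing the equation of the conic by \<open>y^2\<close> gives
  \<open>s^2 + s + a = c / y^2\<close>, whence \<open>\<rho>^2 = c (s^2 + s + a)\<close>.\<close>

definition \<rho> where "\<rho> = \<iota> c / y"

abbreviation ev where "ev \<equiv> eval_hom \<iota> s"

lemmas ev_ring = ring_hom_eval_hom[OF \<iota>_ring, of s]
lemmas ev_simps = hom_simps[OF ev_ring]

lemma \<rho>_sq: "\<rho>\<^sup>2 = ev ([:c:] * conic_N a)"
proof -
  have "ev ([:c:] * conic_N a) = \<iota> c * (s\<^sup>2 + s + \<iota> a)"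
    by (simp add: ev_simps conic_N_def eval_hom_simps[OF \<iota>_ring] \<iota>_simps power2_eq_square
        algebra_simps del: mult_pCons_left)
  also have "\<dots> = \<iota> c * ((x\<^sup>2 + x * y + \<iota> a * y\<^sup>2) / y\<^sup>2)"
    using y_nz by (simp add: s_def field_simps power2_eq_square)
  also have "\<dots> = \<rho>\<^sup>2"
    unfolding point by (simp add: \<rho>_def power2_eq_square)
  finally show ?thesis ..
qed

text \<open>Homogenising a relation \<open>p(s) = 0\<close> gives a multiple of the conic equation.
  Under \<open>x = s y\<close> that equation becomes \<open>c + (s^2 + s + a) y^2\<close>, which
  would have to divide the monomial \<open>p y^M\<close>.\<close>

lemma s_transcendental: "ev p = 0 \<Longrightarrow> p = 0"
proof -
  assume p: "ev p = 0"
  let ?k = "\<lambda>c::'a. [:[:c:]:]" and ?X = "[:0, [:0, 1:]:] :: 'a poly poly" and ?Y = "[:0, 1:] :: 'a poly poly"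
  have k: "ring_hom_fun ?k"
    by (simp add: ring_hom_fun_def one_pCons mult.commute)
  obtain M q where q: "eval2 \<iota> x y q = y ^ M * ev p" "eval_hom (eval_hom ?k ?X) ?Y q = monom p M"
    using ex_homogenisation[OF \<iota> y_nz] unfolding s_def by blast
  then have "conic_poly a c dvd q"
    using p zero by simp
  then obtain H where "q = conic_poly a c * H"
    by blast
  then have "monom p M = eval_hom (eval_hom ?k ?X) ?Y (conic_poly a c) * eval_hom (eval_hom ?k ?X) ?Y H"
    unfolding q(2)[symmetric] hom_simps(4)[OF ring_hom_eval_hom[OF ring_hom_eval_hom[OF k]], symmetric]
    by simp
  also have "eval_hom (eval_hom ?k ?X) ?Y (conic_poly a c) = [:[:c:], 0, conic_N a:]"
    by (simp add: conic_poly_def eval_hom_simps ring_hom_eval_hom k conic_N_def one_pCons)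
  finally have "[:[:c:], 0, conic_N a:] dvd monom p M"
    by (rule dvdI)
  then show "p = 0"
    by (rule quadratic_dvd_monom_imp_zero) (use c in simp_all)
qed

text \<open>The derivative of \<open>c(s\<^sup>2 + s + a)\<close> is \<open>c\<close>, so this is not a quotient of squares.\<close>

lemma independent_one_rho:
  assumes "ev f + \<rho> * ev g = 0" shows "f = 0" "g = 0"
proof -
  have "ev f = \<rho> * ev g"
    using assms char2_simps(3)[OF two_K] by (metis eq_neg_iff_add_eq_0)
  then have "(ev f)\<^sup>2 = \<rho>\<^sup>2 * (ev g)\<^sup>2"
    by (simp add: power_mult_distrib)
  then have "ev (f * f) = ev ([:c:] * conic_N a * (g * g))"
    unfolding \<rho>_sq by (simp only: ev_simps power2_eq_square)
  then have "ev (f * f + [:c:] * conic_N a * (g * g)) = 0"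
    by (simp only: ev_simps(3) char2_simps(1)[OF two_K])
  then have "f * f + [:c:] * conic_N a * (g * g) = 0"
    by (rule s_transcendental)
  then have eq: "f * f = [:c:] * conic_N a * (g * g)"
    using char2_simps(3)[OF two_poly[OF two]] by (metis eq_neg_iff_add_eq_0)
  have sq: "pderiv (q * q) = 0" for q :: "'a poly"
    by (simp add: pderiv_mult char2_simps(1)[OF two_poly[OF two]] mult.commute)
  have "pderiv (f * f) = [:c:] * (g * g)"
    unfolding eq pderiv_mult[of _ "g * g"] sq
    by (simp add: pderiv_smult conic_N_def pderiv_pCons char2_simps[OF two] two one_pCons)
  then have "[:c:] * (g * g) = 0"
    unfolding sq by simp
  then show "g = 0"
    using c by simp
  then show "f = 0"
    using eq by simp
qed

definition affine :: "'b set" where "affine = {ev f + \<rho> * ev g | f g. True}"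

lemma affineI: "ev f + \<rho> * ev g \<in> affine"
  by (auto simp: affine_def)

lemma affine_ev: "ev f \<in> affine"
  using affineI[of f 0] by (simp add: ev_simps)

lemma affine_one: "1 \<in> affine"
  using affine_ev[of 1] by (simp add: ev_simps)

lemma affine_\<rho>: "\<rho> \<in> affine"
  using affineI[of 0 1] by (simp add: ev_simps)

lemma affine_add: "u \<in> affine \<Longrightarrow> v \<in> affine \<Longrightarrow> u + v \<in> affine"
proof -
  assume "u \<in> affine" "v \<in> affine"
  then obtain f g f' g' where "u = ev f + \<rho> * ev g" "v = ev f' + \<rho> * ev g'"
    by (auto simp: affine_def)
  then have "u + v = ev (f + f') + \<rho> * ev (g + g')"
    by (simp add: ev_simps algebra_simps)
  then show ?thesis
    by (simp add: affineI)
qed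

lemma affine_mult: "u \<in> affine \<Longrightarrow> v \<in> affine \<Longrightarrow> u * v \<in> affine"
proof -
  assume "u \<in> affine" "v \<in> affine"
  then obtain f g f' g' where uv: "u = ev f + \<rho> * ev g" "v = ev f' + \<rho> * ev g'"
    by (auto simp: affine_def)
  have "u * v = (ev f * ev f' + \<rho>\<^sup>2 * (ev g * ev g')) + \<rho> * (ev f * ev g' + ev g * ev f')"
    unfolding uv by (simp only: algebra_simps power2_eq_square)
  also have "\<dots> = ev (f * f' + [:c:] * conic_N a * (g * g')) + \<rho> * ev (f * g' + g * f')"
    unfolding \<rho>_sq by (simp only: ev_simps)
  finally have eq: "u * v = \<dots>" .
  show ?thesis
    unfolding eq by (rule affineI)
qed

text \<open>The elements \<open>S\<close> with a denominator in \<open>F[s] + \<rho> F[s]\<close>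
  are closed under sums, products and quotients. They include the constants, \<open>s\<close> and
  \<open>\<rho>\<close>, hence \<open>y = c / \<rho>\<close> and \<open>x = s y\<close>, and so the
  whole field.\<close>

lemma ex_denominator: "\<exists>b\<in>affine. b \<noteq> 0 \<and> b * k \<in> affine"
proof -
  define S where "S = {k. \<exists>b\<in>affine. b \<noteq> 0 \<and> b * k \<in> affine}"
  have aff: "affine \<subseteq> S"
    unfolding S_def by (auto intro!: bexI[of _ 1] affine_one)
  have add: "u + v \<in> S" if "u \<in> S" "v \<in> S" for u v
  proof -
    obtain b b' where "b \<in> affine" "b' \<in> affine" "b \<noteq> 0" "b' \<noteq> 0" "b * u \<in> affine" "b' * v \<in> affine"
      using \<open>u \<in> S\<close> \<open>v \<in> S\<close> by (auto simp: S_def)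
    then have "b * b' \<in> affine" "b * b' \<noteq> 0" "b' * (b * u) + b * (b' * v) \<in> affine"
      by (auto intro: affine_add affine_mult)
    then show ?thesis
      unfolding S_def by (auto intro!: bexI[of _ "b * b'"] simp: algebra_simps)
  qed
  have mult: "u * v \<in> S" if "u \<in> S" "v \<in> S" for u v
  proof -
    obtain b b' where "b \<in> affine" "b' \<in> affine" "b \<noteq> 0" "b' \<noteq> 0" "b * u \<in> affine" "b' * v \<in> affine"
      using \<open>u \<in> S\<close> \<open>v \<in> S\<close> by (auto simp: S_def)
    then have "b * b' \<in> affine" "b * b' \<noteq> 0" "(b * u) * (b' * v) \<in> affine"
      by (auto intro: affine_mult)
    then show ?thesis
      unfolding S_def by (auto intro!: bexI[of _ "b * b'"] simp: algebra_simps)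
  qed
  have div: "u / v \<in> S" if "u \<in> S" "v \<in> S" "v \<noteq> 0" for u v
  proof -
    obtain b b' where "b \<in> affine" "b' \<in> affine" "b \<noteq> 0" "b' \<noteq> 0" "b * u \<in> affine" "b' * v \<in> affine"
      using \<open>u \<in> S\<close> \<open>v \<in> S\<close> by (auto simp: S_def)
    then have "b * (b' * v) \<in> affine" "b * (b' * v) \<noteq> 0" "(b * (b' * v)) * (u / v) \<in> affine"
      using affine_mult[of b' "b * u"] \<open>v \<noteq> 0\<close> affine_mult[of b "b' * v"] by (auto simp: mult_ac)
    then show ?thesis
      unfolding S_def by blast
  qed
  have \<iota>_S: "\<iota> r \<in> S" for r
    using affine_ev[of "[:r:]"] aff by (auto simp: eval_hom_simps[OF \<iota>_ring])
  have "\<rho> \<in> S" "\<rho> \<noteq> 0"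
    using affine_\<rho> aff y_nz c by (auto simp: \<rho>_def field_hom_eq_0_iff[OF \<iota>])
  then have y: "y \<in> S"
    using div[OF \<iota>_S[of c] \<open>\<rho> \<in> S\<close>] y_nz c by (simp add: \<rho>_def field_hom_eq_0_iff[OF \<iota>])
  have "s \<in> S"
    using affine_ev[of "[:0, 1:]"] aff by (auto simp: eval_hom_simps[OF \<iota>_ring] \<iota>_simps)
  then have x: "x \<in> S"
    using mult[OF \<open>s \<in> S\<close> y] y_nz by (simp add: s_def)
  have "eval_hom \<iota> x q \<in> S" for q
    by (induction q) (use \<iota>_S[of 0] \<iota>_S in \<open>auto simp: eval_hom_simps[OF \<iota>_ring] \<iota>_simps intro!: add mult x\<close>)
  then have "eval2 \<iota> x y p \<in> S" for p
    by (induction p) (use \<iota>_S[of 0] in \<open>auto simp: eval2_eq eval_hom_simps[OF ring_hom_eval_hom[OF \<iota>_ring]] \<iota>_simps intro!: add mult y\<close>)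
  then have "k \<in> S"
    using frac[of k] div by metis
  then show ?thesis
    by (simp add: S_def)
qed

lemma ex_common_denominator:
  "finite I \<Longrightarrow> \<exists>b\<in>affine. b \<noteq> 0 \<and> (\<forall>i\<in>I. b * v i \<in> affine)"
proof (induction I rule: finite_induct)
  case empty
  then show ?case
    using affine_one by (auto intro!: bexI[of _ 1])
next
  case (insert i I)
  then obtain b where b: "b \<in> affine" "b \<noteq> 0" "\<And>j. j \<in> I \<Longrightarrow> b * v j \<in> affine"
    by blast
  obtain b' where b': "b' \<in> affine" "b' \<noteq> 0" "b' * v i \<in> affine"
    using ex_denominator by blast
  have "b * b' * v j \<in> affine" if "j \<in> insert i I" for j
  proof (cases "j = i")
    case True
    then show ?thesis
      using affine_mult[OF b(1) b'(3)] by (simp add: mult_ac)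
  next
    case False
    then show ?thesis
      using affine_mult[OF b'(1) b(3)[of j]] that by (simp add: mult_ac)
  qed
  then show ?case
    using b b' by (intro bexI[of _ "b * b'"]) (auto intro: affine_mult)
qed

text \<open>After denominators are cleared the vector is \<open>f + \<rho> g\<close>; independence
  of 1 and \<open>\<rho>\<close> splits the vanishing of its value into the two polynomial
  equations.\<close>

lemma isotropic_imp_poly_zero:
  fixes A :: "'a ^ 'n::finite ^ 'n"
  assumes "isotropic (base_change \<iota> A)"
  shows "\<exists>m. poly_zero a c m A"
proof -
  let ?A = "base_change \<iota> A"
  obtain v where v: "v \<noteq> 0" "qform ?A v = 0"
    using assms by (auto simp: isotropic_def)
  obtain b where b: "b \<noteq> 0" "\<And>i. b * v $ i \<in> affine"
    using ex_common_denominator[of UNIV "\<lambda>i. v $ i"] by auto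
  then have "\<forall>i. \<exists>f g. b * v $ i = ev f + \<rho> * ev g"
    by (auto simp: affine_def)
  then obtain f0 g0 where fg: "\<And>i. b * v $ i = ev (f0 i) + \<rho> * ev (g0 i)"
    by metis
  define f g where "f = (\<chi> i. f0 i)" and "g = (\<chi> i. g0 i)"
  let ?f = "\<chi> i. ev (f $ i)" and ?g = "\<chi> i. ev (g $ i)"
  have bv: "b *s v = ?f + \<rho> *s ?g"
    by (simp add: vec_eq_iff fg f_def g_def)
  have A: "?A = base_change ev (const_form A)"
    by (simp add: base_change_def eval_hom_simps[OF \<iota>_ring])
  have "0 = qform ?A (b *s v)"
    using v by (simp add: qform_scale)
  also have "\<dots> = ev (qform (const_form A) f) + \<rho>\<^sup>2 * ev (qform (const_form A) g) + \<rho> * ev (bform (const_form A) f g)"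
    unfolding bv qform_add qform_scale bform_linear A
    by (simp add: hom_qform[OF ev_ring] hom_bform[OF ev_ring])
  also have "\<dots> = ev (qform (const_form A) f + [:c:] * conic_N a * qform (const_form A) g) + \<rho> * ev (bform (const_form A) f g)"
    unfolding \<rho>_sq by (simp only: ev_simps)
  finally have "ev (qform (const_form A) f + [:c:] * conic_N a * qform (const_form A) g) + \<rho> * ev (bform (const_form A) f g) = 0" ..
  from independent_one_rho[OF this]
  have "qform (const_form A) f + [:c:] * conic_N a * qform (const_form A) g = 0"
    and "bform (const_form A) f g = 0" .
  moreover from this(1) have "qform (const_form A) f = [:c:] * conic_N a * qform (const_form A) g"
    using char2_simps(3)[OF two_poly[OF two]] by (metis eq_neg_iff_add_eq_0)
  moreover have "f \<noteq> 0 \<or> g \<noteq> 0"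
  proof (rule ccontr)
    assume "\<not> ?thesis"
    then have "b *s v = 0"
      unfolding bv by (simp add: vec_eq_iff ev_simps)
    then show False
      using b(1) v(1) by (simp add: vec_eq_iff)
  qed
  moreover define m where "m = Suc (Max (range (\<lambda>i. max (degree (f $ i)) (degree (g $ i)))))"
  have "max (degree (f $ i)) (degree (g $ i)) < m" for i
    unfolding m_def less_Suc_eq_le by (intro Max_ge) auto
  then have "vec_lt m f" "vec_lt m g"
    by (auto simp: vec_lt_def poly_lt_iff)
  ultimately show ?thesis
    unfolding poly_zero_def by (intro exI[of _ m] exI[of _ f] exI[of _ g]) (auto intro: vec_lt_mono)
qed

end

section \<open>Quaternion algebras with a common plane\<close>

text \<open>Equal trace and norm give a zero of the Albert form
  \<open>[1, b] \<perp> c[1, a] \<perp> bc[1, a + b]\<close> of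
  \<open>[a, c) \<otimes> [a + b, bc)\<close>. Its multiple by \<open>c\<close> is isometric to the
  Albert form of \<open>[a, b) \<otimes> [b, c)\<close>.\<close>

lemma equal_norm_trace_imp_not_division_algebra:
  fixes a b c :: "'a::field"
  assumes char: "CHAR('a) = 2" and c: "c \<noteq> 0"
    and eq: "qnorm a c (q0, r, q2, q3) = qnorm (a + b) (b * c) (p0, r, p2, p3)"
    and nz: "\<not> (q0 = p0 \<and> (r, q2, q3, p2, p3) = (0, 0, 0, 0, 0))"
  shows "\<not> division_algebra (tensor_table (quaternion a b) (quaternion b c))"
proof (rule albert_isotropic_imp_not_division_algebra[OF char])
  have two: "(2::'a) = 0"
    using of_nat_CHAR[where ?'a = 'a] char by simp
  note two_simps = char2_simps[OF two] two
  \<comment> \<open>The substitution is the isometry of \<open>[1, a] \<perp> b[1, a + b]\<close>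
    onto \<open>[1, a + b] \<perp> b[1, a]\<close> that sends \<open>(q2, q3, p2, p3)\<close> to
    \<open>(q2 + b p3, q3, p2 + q3, p3)\<close>, applied to coordinates scaled by
    \<open>c\<close>.\<close>
  have "nform (a + b) (c * q2 + b * (c * p3)) (c * q3) + b * nform a (c * p2 + c * q3) (c * p3) + c * nform b (q0 + p0) r =
      c * (qnorm a c (q0, r, q2, q3) + qnorm (a + b) (b * c) (p0, r, p2, p3))"
    by (simp add: nform_def power2_eq_square algebra_simps two_simps)
  also have "\<dots> = 0"
    unfolding eq by (simp add: two_simps)
  finally show "nform (a + b) (c * q2 + b * (c * p3)) (c * q3) + b * nform a (c * p2 + c * q3) (c * p3) + c * nform b (q0 + p0) r = 0" .
  show "(c * q2 + b * (c * p3), c * q3, c * p2 + c * q3, c * p3, q0 + p0, r) \<noteq> (0, 0, 0, 0, 0, 0)"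
  proof
    assume "(c * q2 + b * (c * p3), c * q3, c * p2 + c * q3, c * p3, q0 + p0, r) = (0, 0, 0, 0, 0, 0)"
    then have "q2 = 0" "q3 = 0" "p2 = 0" "p3 = 0" "r = 0" "q0 + p0 = 0"
      using c by auto
    moreover from this(6) have "q0 = p0"
      using two_simps(3) by (metis eq_neg_iff_add_eq_0)
    ultimately show False
      using nz by simp
  qed
qed

text \<open>An isometry of planes matches values and polar values. The trace of \<open>p\<close>
  times the conjugate of \<open>p'\<close> is the polar value of \<open>p\<close> and
  \<open>p'\<close>, and the norm is the product of their norms, so this product and its scaled
  counterpart in \<open>[a, c)\<close> have equal trace and norm. They cannot be equal scalars,
  since then \<open>p\<close> and \<open>p'\<close> would be proportional.\<close>

lemma two_plane_imp_not_division_algebra: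
  fixes a b c :: "'a::field"
  assumes char: "CHAR('a) = 2" and c: "c \<noteq> 0"
    and norm: "\<And>k l. m * qnorm a c (qscale k q + qscale l q') =
      qnorm (a + b) (b * c) (k * u + l * u', 0, k * s + l * s', k * t + l * t')"
    and aniso: "\<And>u s t. qnorm (a + b) (b * c) (u, 0, s, t) = 0 \<Longrightarrow> u = 0 \<and> s = 0 \<and> t = 0"
    and indep: "\<And>k l. (k * u + l * u', k * s + l * s', k * t + l * t') = (0, 0, 0) \<Longrightarrow> k = 0 \<and> l = 0"
  shows "\<not> division_algebra (tensor_table (quaternion a b) (quaternion b c))"
proof -
  have two: "(2::'a) = 0"
    using of_nat_CHAR[where ?'a = 'a] char by simp
  note two_simps = char2_simps[OF two] two
  let ?a = "a + b" and ?c = "b * c"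
  let ?p = "(u, 0, s, t)" and ?p' = "(u', 0, s', t')"
  have one: "qscale 1 x = x" "qscale 0 x = 0" for x :: "'a quat"
    by (cases x; simp add: zero_prod_def)+
  have n: "m * qnorm a c q = qnorm ?a ?c ?p" and n': "m * qnorm a c q' = qnorm ?a ?c ?p'"
    and "m * qnorm a c (q + q') = qnorm ?a ?c (?p + ?p')"
    using norm[of 1 0] norm[of 0 1] norm[of 1 1] by (simp_all add: one del: qnorm.simps)
  then have polar: "m * qpolar c q q' = qpolar ?c ?p ?p'"
    unfolding qnorm_add[OF two] distrib_left by (metis add_left_cancel)
  obtain q0 q1 q2 q3 where q: "qscale m (qmult a c q (qconj q')) = (q0, q1, q2, q3)"
    by (rule prod_cases4)
  obtain p0 p1 p2 p3 where p: "qmult ?a ?c ?p (qconj ?p') = (p0, p1, p2, p3)"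
    by (rule prod_cases4)
  have "q1 = m * qpolar c q q'"
    using qmult_conj_trace[OF two, of a c q q'] q
    by (cases "qmult a c q (qconj q')") auto
  moreover have "p1 = qpolar ?c ?p ?p'"
    using qmult_conj_trace[OF two, of ?a ?c ?p ?p'] unfolding p by simp
  ultimately have "p1 = q1"
    using polar by simp
  have "qnorm a c (q0, q1, q2, q3) = (m * qnorm a c q) * (m * qnorm a c q')"
    unfolding q[symmetric] qnorm_scale qnorm_mult[OF two] qnorm_conj[OF two]
    by (simp add: power2_eq_square)
  also have "\<dots> = qnorm ?a ?c (p0, p1, p2, p3)"
    unfolding p[symmetric] qnorm_mult[OF two] qnorm_conj[OF two] n n' ..
  finally have eq: "qnorm a c (q0, q1, q2, q3) = qnorm ?a ?c (p0, q1, p2, p3)"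
    unfolding \<open>p1 = q1\<close> .
  show ?thesis
  proof (rule equal_norm_trace_imp_not_division_algebra[OF char c eq])
    show "\<not> (q0 = p0 \<and> (q1, q2, q3, p2, p3) = (0, 0, 0, 0, 0))"
    proof
      assume "q0 = p0 \<and> (q1, q2, q3, p2, p3) = (0, 0, 0, 0, 0)"
      then have p': "qmult ?a ?c ?p (qconj ?p') = (p0, 0, 0, 0)"
        using p \<open>p1 = q1\<close> by simp
      have "qscale p0 ?p' = qmult ?a ?c (qmult ?a ?c ?p (qconj ?p')) ?p'"
        unfolding p' qmult_scalar[OF two] ..
      also have "\<dots> = qscale (qnorm ?a ?c ?p') ?p"
        unfolding qmult_assoc[OF two] qmult_conj[OF two] qmult_scalar[OF two] ..
      finally have "(qnorm ?a ?c ?p' * u + p0 * u', qnorm ?a ?c ?p' * s + p0 * s', qnorm ?a ?c ?p' * t + p0 * t') = (0, 0, 0)"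
        by (simp add: two_simps del: qnorm.simps)
      from indep[OF this] have "u' = 0" "s' = 0" "t' = 0"
        using aniso[of u' s' t'] by blast+
      then show False
        using indep[of 0 1] by simp
    qed
  qed
qed

section \<open>The Pfister form as a left module over \<open>Q\<close>\<close>

definition pnorm :: "'a::comm_ring_1 \<Rightarrow> 'a \<Rightarrow> 'a \<Rightarrow> 'a quat \<times> 'a quat \<Rightarrow> 'a"
  where "pnorm a b c z = qnorm a c (fst z) + b * qnorm a c (snd z)"

definition ppolar :: "'a::comm_ring_1 \<Rightarrow> 'a \<Rightarrow> 'a quat \<times> 'a quat \<Rightarrow> 'a quat \<times> 'a quat \<Rightarrow> 'a"
  where "ppolar b c z w = qpolar c (fst z) (fst w) + b * qpolar c (snd z) (snd w)"

definition pmult :: "'a::comm_ring_1 \<Rightarrow> 'a \<Rightarrow> 'a quat \<Rightarrow> 'a quat \<times> 'a quat \<Rightarrow> 'a quat \<times> 'a quat"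
  where "pmult a c g z = (qmult a c g (fst z), qmult a c g (snd z))"

abbreviation pscale :: "'a::comm_ring_1 \<Rightarrow> 'a quat \<times> 'a quat \<Rightarrow> 'a quat \<times> 'a quat"
  where "pscale \<equiv> pair_scale qscale qscale"

lemma ppolar_linear:
  "ppolar b c (x + x') y = ppolar b c x y + ppolar b c x' y"
  "ppolar b c x (y + y') = ppolar b c x y + ppolar b c x y'"
  "ppolar b c (pscale r x) y = r * ppolar b c x y"
  "ppolar b c x (pscale r y) = r * ppolar b c x y"
  by (simp_all add: ppolar_def pair_scale_def qpolar_linear algebra_simps)

lemma ppolar_commute: "ppolar b c x y = ppolar b c y x"
  by (simp add: ppolar_def qpolar_commute)

lemma pmult_linear:
  "pmult a c (g + g') z = pmult a c g z + pmult a c g' z"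
  "pmult a c (qscale r g) z = pscale r (pmult a c g z)"
  by (simp_all add: pmult_def pair_scale_def qmult_linear)

context
  fixes a b c :: "'a::comm_ring_1"
  assumes two: "(2::'a) = 0"
begin

lemma pnorm_add: "pnorm a b c (x + y) = pnorm a b c x + pnorm a b c y + ppolar b c x y"
  by (simp add: pnorm_def ppolar_def qnorm_add[OF two] algebra_simps)

lemma pnorm_pmult: "pnorm a b c (pmult a c g z) = qnorm a c g * pnorm a b c z"
  by (simp add: pnorm_def pmult_def qnorm_mult[OF two] algebra_simps)

lemma ppolar_pmult_same: "ppolar b c (pmult a c g z) (pmult a c h z) = qpolar c g h * pnorm a b c z"
  by (simp add: ppolar_def pnorm_def pmult_def qpolar_mult_right[OF two] algebra_simps)

lemma ppolar_pmult: "ppolar b c (pmult a c g z) w =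
    qpolar c g (qmult a c (fst w) (qconj (fst z)) + qscale b (qmult a c (snd w) (qconj (snd z))))"
  by (simp add: ppolar_def pmult_def qpolar_adjoint[OF two] qpolar_linear)

end

lemma qpolar_nondegenerate:
  fixes c :: "'a::field"
  assumes "c \<noteq> 0" "\<And>g. qpolar c g q = 0"
  shows "q = 0"
  using assms(1) assms(2)[of "(1, 0, 0, 0)"] assms(2)[of "(0, 1, 0, 0)"]
    assms(2)[of "(0, 0, 1, 0)"] assms(2)[of "(0, 0, 0, 1)"]
  by (cases q) (simp add: zero_prod_def)

text \<open>By adjunction and nondegeneracy of the norm, \<open>w = (w1, w2)\<close> is orthogonal
  to \<open>Q z\<close>, \<open>z = (x, y)\<close>, iff \<open>w1\<close> times the conjugate of
  \<open>x\<close> equals \<open>b w2\<close> times the conjugate of \<open>y\<close>. So one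
  component determines the norm of the other, and the value of \<open>w\<close> is a fixed multiple
  of one quaternion norm.\<close>

lemma pmult_orthogonal_complement:
  fixes a b c :: "'a::field"
  assumes two: "(2::'a) = 0" and aniso: "\<And>z. pnorm a b c z = 0 \<Longrightarrow> z = 0"
    and b: "b \<noteq> 0" and c: "c \<noteq> 0" and z: "z \<noteq> 0"
  shows "\<exists>m f. f \<in> {fst, snd} \<and>
    (\<forall>w. (\<forall>g. ppolar b c (pmult a c g z) w = 0) \<longrightarrow> pnorm a b c w = m * qnorm a c (f w))"
proof -
  obtain x y where z_eq: "z = (x, y)"
    by (cases z)
  have Q: "q = 0" if "qnorm a c q = 0" for q
    using aniso[of "(q, 0)"] that by (auto simp: pnorm_def zero_prod_def)
  have orth: "qmult a c w1 (qconj x) + qscale b (qmult a c w2 (qconj y)) = 0"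
    if "\<And>g. ppolar b c (pmult a c g z) (w1, w2) = 0" for w1 w2
    using that unfolding ppolar_pmult[OF two] z_eq fst_conv snd_conv
    by (rule qpolar_nondegenerate[OF c])
  have norm: "qnorm a c w1 * qnorm a c x = b\<^sup>2 * (qnorm a c w2 * qnorm a c y)"
    if "\<And>g. ppolar b c (pmult a c g z) (w1, w2) = 0" for w1 w2
  proof -
    have "qmult a c w1 (qconj x) = - qscale b (qmult a c w2 (qconj y))"
      unfolding eq_neg_iff_add_eq_0 by (rule orth[OF that])
    also have "\<dots> = qscale b (qmult a c w2 (qconj y))"
      by (cases "qmult a c w2 (qconj y)") (simp add: char2_simps[OF two])
    finally show ?thesis
      using qnorm_mult[OF two, of a c w1 "qconj x"]
      by (simp add: qnorm_scale qnorm_mult[OF two] qnorm_conj[OF two])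
  qed
  show ?thesis
  proof (cases "x = 0")
    case False
    then have nx: "qnorm a c x \<noteq> 0"
      using Q by blast
    have "pnorm a b c (w1, w2) = b * (qnorm a c x + b * qnorm a c y) / qnorm a c x * qnorm a c w2"
      if "\<And>g. ppolar b c (pmult a c g z) (w1, w2) = 0" for w1 w2
    proof -
      have "qnorm a c w1 = b\<^sup>2 * (qnorm a c w2 * qnorm a c y) / qnorm a c x"
        unfolding norm[OF that, symmetric] using nx by simp
      then show ?thesis
        using nx by (simp only: pnorm_def fst_conv snd_conv) (simp add: field_simps power2_eq_square)
    qed
    then have "pnorm a b c w = b * (qnorm a c x + b * qnorm a c y) / qnorm a c x * qnorm a c (snd w)"
      if "\<forall>g. ppolar b c (pmult a c g z) w = 0" for w
      by (metis that prod.collapse)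
    then show ?thesis
      by blast
  next
    case True
    have "y \<noteq> 0"
    proof
      assume "y = 0"
      then show False
        using z True unfolding z_eq zero_prod_def by simp
    qed
    then have ny: "qnorm a c y \<noteq> 0"
      using Q by blast
    have zero: "qnorm a c (0 :: 'a quat) = 0"
      by (simp add: zero_prod_def)
    have "pnorm a b c (w1, w2) = 1 * qnorm a c w1"
      if "\<And>g. ppolar b c (pmult a c g z) (w1, w2) = 0" for w1 w2
      using norm[OF that] ny b True by (simp add: pnorm_def zero)
    then have "pnorm a b c w = 1 * qnorm a c (fst w)"
      if "\<forall>g. ppolar b c (pmult a c g z) w = 0" for w
      by (metis that prod.collapse)
    then show ?thesis
      by blast
  qed
qed

section \<open>The Pfister neighbour\<close>

lemma qform_orth_sum:
  "qform (A \<bottom>\<bottom> B) v = qform A (\<chi> i. v $ Inl i) + qform B (\<chi> i. v $ Inr i)"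
proof -
  have sum: "(\<Sum>k\<in>UNIV. f k) = (\<Sum>i\<in>UNIV. f (Inl i)) + (\<Sum>j\<in>UNIV. f (Inr j))" for f :: "'b + 'c \<Rightarrow> 'a"
    unfolding UNIV_Plus_UNIV[symmetric] by (subst sum.Plus) (simp_all add: comp_def)
  show ?thesis
    by (simp add: qform_def sum orth_sum_def)
qed

lemma qform_scale_form: "qform (scale_form c A) v = c * qform A v"
  by (simp add: qform_def scale_form_def sum_distrib_left mult.assoc)

lemma qform_binary_form: "qform (binary_form \<alpha>) v = nform \<alpha> (v $ 1) (v $ 2)"
  by (simp add: qform_def binary_form_def sum_2 nform_def power2_eq_square)

lemma qform_unary_form: "qform (unary_form c) v = c * (v $ 1)\<^sup>2"
  by (simp add: qform_def unary_form_def power2_eq_square)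

lemma base_change_forms:
  assumes h: "ring_hom_fun h"
  shows "base_change h (A \<bottom>\<bottom> B) = base_change h A \<bottom>\<bottom> base_change h B"
    and "base_change h (scale_form c C) = scale_form (h c) (base_change h C)"
    and "base_change h (binary_form \<alpha>) = binary_form (h \<alpha>)"
    and "base_change h (unary_form c) = unary_form (h c)"
  by (auto simp: vec_eq_iff base_change_def orth_sum_def scale_form_def binary_form_def unary_form_def
      hom_simps[OF h] forall_2 split: sum.split)

abbreviation (input) neighbour_form :: "'a::comm_ring_1 \<Rightarrow> 'a \<Rightarrow> 'a \<Rightarrow> 'a ^ ((2 + 2) + 1) ^ ((2 + 2) + 1)"
  where "neighbour_form a b c \<equiv>
    scale_form c (binary_form (a + b)) \<bottom>\<bottom> scale_form b (binary_form a) \<bottom>\<bottom> unary_form 1"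

lemma qform_neighbour_form: "qform (neighbour_form a b c) v =
    c * nform (a + b) (v $ Inl (Inl 1)) (v $ Inl (Inl 2)) + b * nform a (v $ Inl (Inr 1)) (v $ Inl (Inr 2)) + (v $ Inr 1)\<^sup>2"
  by (simp add: qform_orth_sum qform_scale_form qform_binary_form qform_unary_form)

lemma neighbour_vec_eq_0_iff: "v = 0 \<longleftrightarrow> v $ Inl (Inl 1) = 0 \<and> v $ Inl (Inl 2) = 0 \<and>
    v $ Inl (Inr 1) = 0 \<and> v $ Inl (Inr 2) = 0 \<and> v $ Inr 1 = 0"
  for v :: "'a::zero ^ ((2 + 2) + 1)"
  unfolding vec_eq_iff split_sum_all forall_2 forall_1 by simp

text \<open>\<open>c[1, a + b]\<close> differs from \<open>c[1, a]\<close> by \<open>b c\<close>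
  times the square of the second coordinate. The second component supplies this by repeating that
  coordinate at \<open>j\<close>.\<close>

definition neighbour_embed :: "'a::comm_ring_1 ^ ((2 + 2) + 1) \<Rightarrow> 'a quat \<times> 'a quat"
  where "neighbour_embed v = ((v $ Inr 1, 0, v $ Inl (Inl 1), v $ Inl (Inl 2)),
    (v $ Inl (Inr 1), v $ Inl (Inr 2), v $ Inl (Inl 2), 0))"

lemma pnorm_neighbour_embed: "pnorm a b c (neighbour_embed v) = qform (neighbour_form a b c) v"
  by (simp add: pnorm_def neighbour_embed_def qform_neighbour_form nform_def power2_eq_square algebra_simps)

lemma neighbour_embed_linear:
  "neighbour_embed (v + w) = neighbour_embed v + neighbour_embed w"
  "neighbour_embed (r *s v) = pscale r (neighbour_embed v)"
  by (simp_all add: neighbour_embed_def)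

lemma ppolar_neighbour_embed:
  fixes a b c :: "'a::comm_ring_1"
  assumes two: "(2::'a) = 0"
  shows "ppolar b c (neighbour_embed v) (neighbour_embed w) = bform (neighbour_form a b c) v w"
  using pnorm_add[OF two, of a b c "neighbour_embed v" "neighbour_embed w"]
  unfolding neighbour_embed_linear[symmetric] pnorm_neighbour_embed qform_add
  by (metis add_left_cancel)

text \<open>The orthogonal complement of \<open>neighbour_form a b c\<close> in \<open>n\<^sub>Q \<perp> b n\<^sub>Q\<close> is the pure part of \<open>[a + b, bc)\<close>.\<close>

definition complement_embed :: "'a::comm_ring_1 \<Rightarrow> 'a \<Rightarrow> 'a \<Rightarrow> 'a \<Rightarrow> 'a quat \<times> 'a quat"
  where "complement_embed b u s t = ((u, 0, b * t, 0), (0, 0, s, t))"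

lemma pnorm_complement_embed:
  "pnorm a b c (complement_embed b u s t) = qnorm (a + b) (b * c) (u, 0, s, t)"
  by (simp add: pnorm_def complement_embed_def nform_def power2_eq_square algebra_simps)

lemma ppolar_neighbour_complement:
  fixes b c :: "'a::comm_ring_1"
  assumes two: "(2::'a) = 0"
  shows "ppolar b c (neighbour_embed v) (complement_embed b u s t) = 0"
  by (simp add: ppolar_def complement_embed_def neighbour_embed_def algebra_simps char2_simps[OF two] two)

lemma complement_embed_linear:
  "complement_embed b (u + u') (s + s') (t + t') = complement_embed b u s t + complement_embed b u' s' t'"
  "complement_embed b (r * u) (r * s) (r * t) = pscale r (complement_embed b u s t)"
  by (simp_all add: complement_embed_def algebra_simps)

lemma quat_zero_iff: "(x0, x1, x2, x3) = (0 :: 'a::zero quat) \<longleftrightarrow> x0 = 0 \<and> x1 = 0 \<and> x2 = 0 \<and> x3 = 0"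
  by (simp add: zero_prod_def)

lemma complement_embed_eq_0_iff: "complement_embed b u s t = 0 \<longleftrightarrow> u = 0 \<and> s = 0 \<and> t = 0"
  unfolding complement_embed_def zero_prod_def[where ?'a = "'a quat"] prod.inject quat_zero_iff by auto

text \<open>The 4-dimensional space \<open>Q z0\<close> carries the form \<open>m n\<^sub>Q\<close>,
  and its complement in \<open>\<pi>\<close> a multiple of \<open>n\<^sub>Q\<close>. A dimension
  count places a plane of the pure part of \<open>[a + b, bc)\<close> isometrically into that
  complement.\<close>

lemma contains_conic_imp_not_division_algebra:
  fixes a b c :: "'a::field"
  assumes char: "CHAR('a) = 2" and b: "b \<noteq> 0" and c: "c \<noteq> 0"
    and aniso: "\<And>z. pnorm a b c z = 0 \<Longrightarrow> z = 0"
    and conic: "contains_conic a c (neighbour_form a b c)"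
  shows "\<not> division_algebra (tensor_table (quaternion a b) (quaternion b c))"
proof -
  have two: "(2::'a) = 0"
    using of_nat_CHAR[where ?'a = 'a] char by simp
  note two_simps = char2_simps[OF two]
  obtain m w0 w1 y where m: "m \<noteq> 0" and "conic_in_form a c m (neighbour_form a b c) w0 w1 y"
    using conic two by (auto simp: contains_conic_def conic_in_form_def)
  then interpret conic: conic_in_form a c m "neighbour_form a b c" w0 w1 y by simp
  define e where "e r0 r1 r2 = neighbour_embed (conic.conic_vec r0 r1 r2)" for r0 r1 r2
  let ?f = "complement_embed b"
  define z0 where "z0 = e 1 0 0"
  have e_lin: "e (r0 + s0) (r1 + s1) (r2 + s2) = e r0 r1 r2 + e s0 s1 s2"
    "e (k * r0) (k * r1) (k * r2) = pscale k (e r0 r1 r2)" for r0 r1 r2 s0 s1 s2 k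
    unfolding e_def neighbour_embed_linear[symmetric] conic.conic_vec_def
    by (rule arg_cong[of _ _ neighbour_embed]; simp add: vec_eq_iff algebra_simps)+
  have pe: "pnorm a b c (e r0 r1 r2) = m * qnorm a c (r0, r1, r2, 0)" for r0 r1 r2
    unfolding e_def pnorm_neighbour_embed by (rule conic.qform_conic_vec)
  have pee: "ppolar b c (e r0 r1 r2) (e s0 s1 s2) = m * qpolar c (r0, r1, r2, 0) (s0, s1, s2, 0)"
    for r0 r1 r2 s0 s1 s2
    unfolding e_def ppolar_neighbour_embed[OF two, of b c _ _ a] by (rule conic.bform_conic_vec)
  have pef: "ppolar b c (e r0 r1 r2) (?f u s t) = 0" for r0 r1 r2 u s t
    unfolding e_def by (rule ppolar_neighbour_complement[OF two])
  have pz0: "pnorm a b c z0 = m"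
    unfolding z0_def pe by (simp add: nform_def)
  have zero: "pnorm a b c 0 = 0"
    using pnorm_complement_embed[of a b c 0 0 0] unfolding complement_embed_eq_0_iff[THEN iffD2, of 0 0 0 b]
    by (simp add: complement_embed_def zero_prod_def)
  have "z0 \<noteq> 0"
    using pz0 m zero by auto

  let ?scale = "pair_scale pscale qscale :: 'a \<Rightarrow> ('a quat \<times> 'a quat) \<times> 'a quat \<Rightarrow> ('a quat \<times> 'a quat) \<times> 'a quat"
  interpret pv: vector_space "pscale :: 'a \<Rightarrow> _"
    by (intro vector_space_pair_scale vector_space_qscale)
  interpret E: vector_space ?scale
    by (intro vector_space_pair_scale vector_space_qscale)
  \<comment> \<open>The general element of the 6-space \<open>P\<close> in
    \<open>\<pi> \<perp> m n\<^sub>Q\<close>. The conic parts cancel in the value, so it equals that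
    of the pure quaternion \<open>(u, s, t)\<close> of \<open>[a + b, bc)\<close>.\<close>
  define elt where "elt r0 r1 r2 u s t = (e r0 r1 r2 + ?f u s t, (r0, r1, r2, 0 :: 'a))" for r0 r1 r2 u s t
  have elt_lin: "elt (r0 + s0) (r1 + s1) (r2 + s2) (u + u') (s + s') (t + t') = elt r0 r1 r2 u s t + elt s0 s1 s2 u' s' t'"
    "elt (k * r0) (k * r1) (k * r2) (k * u) (k * s) (k * t) = ?scale k (elt r0 r1 r2 u s t)"
    for r0 r1 r2 s0 s1 s2 k u u' s s' t t'
  proof -
    show "elt (r0 + s0) (r1 + s1) (r2 + s2) (u + u') (s + s') (t + t') = elt r0 r1 r2 u s t + elt s0 s1 s2 u' s' t'"
      unfolding elt_def e_lin complement_embed_linear by (simp add: algebra_simps)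
    show "elt (k * r0) (k * r1) (k * r2) (k * u) (k * s) (k * t) = ?scale k (elt r0 r1 r2 u s t)"
      unfolding elt_def e_lin complement_embed_linear
      by (simp add: pv.scale_right_distrib)
  qed
  have elt_0: "r0 = 0 \<and> r1 = 0 \<and> r2 = 0 \<and> u = 0 \<and> s = 0 \<and> t = 0" if "elt r0 r1 r2 u s t = 0" for r0 r1 r2 u s t
  proof -
    have r: "(r0, r1, r2, 0) = (0 :: 'a quat)" and "e r0 r1 r2 + ?f u s t = 0"
      using arg_cong[OF that, of snd] arg_cong[OF that, of fst] by (simp_all add: elt_def)
    moreover have "e 0 0 0 = 0"
      using aniso[of "e 0 0 0"] unfolding pe by simp
    ultimately show ?thesis
      unfolding quat_zero_iff using complement_embed_eq_0_iff by auto
  qed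
  define \<beta> where "\<beta> v w = ppolar b c (fst v) (fst w) + m * qpolar c (snd v) (snd w)" for v w
  define B where "B i = (if i = 0 then elt 1 0 0 0 0 0 else if i = 1 then elt 0 1 0 0 0 0
    else if i = 2 then elt 0 0 1 0 0 0 else if i = 3 then elt 0 0 0 1 0 0
    else if i = 4 then elt 0 0 0 0 1 0 else elt 0 0 0 0 0 1)" for i :: nat
  define P where "P = B ` {..<6}"
  \<comment> \<open>The graph of \<open>g \<mapsto> g z0\<close>, isotropic of dimension at most 4
    because \<open>z0\<close> has value \<open>m\<close>.\<close>
  define J where "J = (\<lambda>g. (pmult a c g z0, g)) ` {(1, 0, 0, 0), (0, 1, 0, 0), (0, 0, 1, 0), (0, 0, 0, 1)}"
  have comb: "(\<Sum>i<6. ?scale (k i) (B i)) = elt (k 0) (k 1) (k 2) (k 3) (k 4) (k 5)" for k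
    by (simp add: eval_nat_numeral B_def elt_lin[symmetric])
  have indP: "E.independent P" "card P = 6"
  proof -
    have "\<forall>i\<in>{..<6}. k i = 0" if "(\<Sum>i<6. ?scale (k i) (B i)) = 0" for k
      using elt_0[OF that[unfolded comb]] by (auto simp: eval_nat_numeral less_Suc_eq)
    then show "E.independent P" "card P = 6"
      using E.independent_family[of "{..<6}" B] by (simp_all add: P_def)
  qed
  have spanP: "\<exists>r0 r1 r2 u s t. v = elt r0 r1 r2 u s t" if "v \<in> E.span P" for v
    using that
  proof (induction rule: E.span_induct_alt)
    case base
    then show ?case
      using elt_lin(2)[of 0 0 0 0 0 0 0] by (metis E.scale_zero_left)
  next
    case (step k x v)
    then obtain i where "x = B i"
      by (auto simp: P_def)
    then obtain r0 r1 r2 u s t where x: "x = elt r0 r1 r2 u s t"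
      unfolding B_def by (simp split: if_splits)
    obtain r0' r1' r2' u' s' t' where v: "v = elt r0' r1' r2' u' s' t'"
      using step.IH by blast
    show ?case
      unfolding x v elt_lin(2)[symmetric] elt_lin(1)[symmetric] by blast
  qed
  have spanJ: "v = (pmult a c (snd v) z0, snd v)" if "v \<in> E.span J" for v
    using that
  proof (induction rule: E.span_induct_alt)
    case base
    have "pmult a c 0 z0 = 0"
      using pmult_linear(1)[of a c 0 0 z0] by simp
    then show ?case
      by (simp add: zero_prod_def)
  next
    case (step k x v)
    have "x = (pmult a c (snd x) z0, snd x)"
      using step.hyps(1) by (auto simp: J_def)
    then show ?case
      using step.IH by (metis (no_types, lifting) fst_conv snd_conv pair_scale_simps pmult_linear add_Pair prod.collapse)
  qed
  have inJ: "(pmult a c g z0, g) \<in> E.span J" for g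
  proof -
    obtain g0 g1 g2 g3 where g: "g = (g0, g1, g2, g3)"
      by (rule prod_cases4)
    let ?j = "\<lambda>g. (pmult a c g z0, g)"
    have j_lin: "?j (x + y) = ?j x + ?j y" "?j (qscale k x) = ?scale k (?j x)" for x y k
      by (simp_all add: pmult_linear)
    have "g = qscale g0 (1, 0, 0, 0) + (qscale g1 (0, 1, 0, 0) + (qscale g2 (0, 0, 1, 0) + qscale g3 (0, 0, 0, 1)))"
      by (simp add: g)
    then have "?j g = ?scale g0 (?j (1, 0, 0, 0)) + (?scale g1 (?j (0, 1, 0, 0)) + (?scale g2 (?j (0, 0, 1, 0)) + ?scale g3 (?j (0, 0, 0, 1))))"
      by (metis j_lin)
    also have "\<dots> \<in> E.span J"
      unfolding J_def by (intro E.span_add E.span_scale E.span_base) auto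
    finally show ?thesis .
  qed

  \<comment> \<open>\<open>P\<close> is not isotropic, so orthogonality holds only against
    \<open>P \<inter> J\<close>: an element of \<open>J\<close> has value 0, hence its pure part
    vanishes by anisotropy. What is left lies in the isotropic 3-space, which is orthogonal to all
    of \<open>P\<close>.\<close>
  have orth: "\<beta> v w = 0" if v: "v \<in> E.span P" and w: "w \<in> E.span P" "w \<in> E.span J" for v w
  proof -
    obtain r0 r1 r2 u s t where v_eq: "v = elt r0 r1 r2 u s t"
      using spanP[OF v] by blast
    obtain r0' r1' r2' u' s' t' where w_eq: "w = elt r0' r1' r2' u' s' t'"
      using spanP[OF w(1)] by blast
    have "pnorm a b c (fst w) = qnorm a c (snd w) * m"
      using arg_cong[OF spanJ[OF w(2)], of fst] by (simp add: pnorm_pmult[OF two] pz0)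
    then have "m * qnorm a c (r0', r1', r2', 0) + pnorm a b c (?f u' s' t') = qnorm a c (r0', r1', r2', 0) * m"
      unfolding w_eq elt_def fst_conv snd_conv pnorm_add[OF two] pe pef by simp
    then have "pnorm a b c (?f u' s' t') = 0"
      by (simp add: mult.commute)
    then have f0: "?f u' s' t' = 0"
      by (rule aniso)
    have "\<beta> v w = m * qpolar c (r0, r1, r2, 0) (r0', r1', r2', 0) + m * qpolar c (r0, r1, r2, 0) (r0', r1', r2', 0)"
      unfolding \<beta>_def v_eq w_eq elt_def fst_conv snd_conv f0 add_0_right ppolar_linear pee
        ppolar_commute[of b c "?f u s t"] pef by simp
    then show ?thesis
      unfolding two_simps(1) .
  qed
  have "\<exists>C. finite C \<and> C \<subseteq> E.span P \<and> E.independent C \<and> card P \<le> card C + card J \<and>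
    E.span C \<inter> E.span J = {0} \<and> (\<forall>x\<in>E.span C. \<forall>y\<in>E.span J. \<beta> x y = 0)"
  proof (rule E.ex_independent_orthogonal_mod)
    show "finite P" "E.independent P" "finite J"
      using indP by (simp_all add: P_def J_def)
  qed (use orth in \<open>auto simp: \<beta>_def ppolar_linear qpolar_linear algebra_simps pair_scale_def[of pscale qscale]\<close>)
  then obtain C where C: "finite C" "C \<subseteq> E.span P" "E.independent C" "card P \<le> card C + card J"
    "E.span C \<inter> E.span J = {0}" "\<And>x y. x \<in> E.span C \<Longrightarrow> y \<in> E.span J \<Longrightarrow> \<beta> x y = 0"
    by blast
  have "card J \<le> 4"
    unfolding J_def by (rule order_trans[OF card_image_le]) (simp_all add: card_insert_if)
  then have "2 \<le> card C"
    using C(4) indP(2) by simp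
  then obtain x x' where xx': "x \<in> C" "x' \<in> C" "x \<noteq> x'"
    using C(1) by (metis card_le_Suc0_iff_eq not_less_eq_eq numeral_2_eq_2)
  have indep2: "k = 0 \<and> l = 0" if "?scale k x + ?scale l x' = 0" for k l
  proof -
    have ind: "E.independent {x, x'}"
      using C(3) xx' E.independent_mono by (metis empty_subsetI insert_subset)
    let ?g = "\<lambda>v. if v = x then k else l"
    have "(\<Sum>v\<in>{x, x'}. ?scale (?g v) v) = 0"
      using that xx'(3) by simp
    from E.independentD[OF ind _ _ this, of x] E.independentD[OF ind _ _ this, of x']
    have "?g x = 0" "?g x' = 0"
      by blast+
    then show ?thesis
      using xx'(3) by (metis (full_types))
  qed
  obtain r0 r1 r2 u s t where x_eq: "x = elt r0 r1 r2 u s t"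
    using spanP xx' C(2) by blast
  obtain r0' r1' r2' u' s' t' where x'_eq: "x' = elt r0' r1' r2' u' s' t'"
    using spanP xx' C(2) by blast
  \<comment> \<open>Subtracts the element of \<open>J\<close> with the same second component. On
    vectors orthogonal to \<open>J\<close> this lands in the complement of \<open>Q z0\<close> and
    keeps the value; its kernel is the span of \<open>J\<close>, which meets that of
    \<open>C\<close> trivially.\<close>
  define Y where "Y v = fst v + pmult a c (snd v) z0" for v
  have Y_lin: "Y (v + w) = Y v + Y w" "Y (?scale k v) = pscale k (Y v)" for v w k
    by (simp_all add: Y_def pmult_linear pv.scale_right_distrib pair_scale_def[of pscale qscale] add_ac)
  have Y_orth: "ppolar b c (pmult a c g z0) (Y v) = 0" if "v \<in> E.span C" for g v
  proof -
    have "\<beta> v (pmult a c g z0, g) = 0"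
      using C(6)[OF that inJ] .
    then have "ppolar b c (pmult a c g z0) (fst v) + m * qpolar c g (snd v) = 0"
      by (simp add: \<beta>_def ppolar_commute qpolar_commute)
    then show ?thesis
      unfolding Y_def ppolar_linear ppolar_pmult_same[OF two, of b c a] pz0 by (simp add: mult.commute)
  qed
  have Y_norm: "pnorm a b c (Y (elt r0 r1 r2 u s t)) = qnorm (a + b) (b * c) (u, 0, s, t)"
    if "elt r0 r1 r2 u s t \<in> E.span C" for r0 r1 r2 u s t
  proof -
    let ?v = "elt r0 r1 r2 u s t" and ?r = "(r0, r1, r2, 0)"
    have "ppolar b c (pmult a c ?r z0) (fst ?v + pmult a c ?r z0) = 0"
      using Y_orth[OF that, of ?r] by (simp add: Y_def elt_def)
    then have "ppolar b c (pmult a c ?r z0) (fst ?v) = 0"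
      unfolding ppolar_linear ppolar_pmult_same[OF two, of b c a] qpolar_self[OF two] by simp
    then have "pnorm a b c (Y ?v) = pnorm a b c (fst ?v) + qnorm a c ?r * m"
      unfolding Y_def pnorm_add[OF two] ppolar_commute[of b c "fst ?v"] pnorm_pmult[OF two] pz0
      by (simp add: elt_def)
    also have "\<dots> = pnorm a b c (?f u s t) + (m * qnorm a c ?r + m * qnorm a c ?r)"
      unfolding elt_def fst_conv pnorm_add[OF two] pe pef by (simp add: mult.commute add.commute)
    finally show ?thesis
      unfolding two_simps(1) pnorm_complement_embed by simp
  qed
  have inC: "?scale k x + ?scale l x' \<in> E.span C" for k l
    using xx' by (intro E.span_add E.span_scale E.span_base)
  have combC: "?scale k x + ?scale l x' = elt (k * r0 + l * r0') (k * r1 + l * r1') (k * r2 + l * r2')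
      (k * u + l * u') (k * s + l * s') (k * t + l * t')" for k l
    unfolding x_eq x'_eq elt_lin ..
  obtain n f where f: "f \<in> {fst, snd}" and nf: "\<And>w. (\<And>g. ppolar b c (pmult a c g z0) w = 0) \<Longrightarrow> pnorm a b c w = n * qnorm a c (f w)"
    using pmult_orthogonal_complement[OF two aniso b c \<open>z0 \<noteq> 0\<close>] by meson
  have f_lin: "f (v + w) = f v + f w" "f (pscale k v) = qscale k (f v)" for v w k
    using f by (auto simp: pair_scale_def)
  have aniso': "u = 0 \<and> s = 0 \<and> t = 0" if "qnorm (a + b) (b * c) (u, 0, s, t) = 0" for u s t
    using that aniso complement_embed_eq_0_iff unfolding pnorm_complement_embed[symmetric] by blast
  show ?thesis
  proof (rule two_plane_imp_not_division_algebra[OF char c])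
    fix k l
    let ?v = "?scale k x + ?scale l x'"
    have "n * qnorm a c (f (Y ?v)) = pnorm a b c (Y ?v)"
      using nf[OF Y_orth[OF inC]] by simp
    also have "\<dots> = qnorm (a + b) (b * c) (k * u + l * u', 0, k * s + l * s', k * t + l * t')"
      using inC[of k l] unfolding combC by (rule Y_norm)
    finally show "n * qnorm a c (qscale k (f (Y x)) + qscale l (f (Y x'))) = 
      qnorm (a + b) (b * c) (k * u + l * u', 0, k * s + l * s', k * t + l * t')"
      unfolding Y_lin f_lin .
  next
    fix k l
    assume 0: "(k * u + l * u', k * s + l * s', k * t + l * t') = (0, 0, 0)"
    let ?v = "?scale k x + ?scale l x'"
    have "pnorm a b c (Y ?v) = qnorm (a + b) (b * c) (k * u + l * u', 0, k * s + l * s', k * t + l * t')"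
      using inC[of k l] unfolding combC by (rule Y_norm)
    then have "Y ?v = 0"
      using 0 aniso by simp
    moreover have "- z = z" for z :: "'a quat \<times> 'a quat"
      by (simp add: prod_eq_iff two_simps)
    ultimately have "fst ?v = pmult a c (snd ?v) z0"
      unfolding Y_def by (metis eq_neg_iff_add_eq_0)
    then have "?v \<in> E.span J"
      using inJ[of "snd ?v"] by (metis prod.collapse)
    then have "?v = 0"
      using C(5) inC[of k l] by blast
    then show "k = 0 \<and> l = 0"
      by (rule indep2)
  qed (use aniso' in blast)
qed

section \<open>Hyperplanes and minimality\<close>

lemma qform_eq_matrix: "qform A x = (\<Sum>i\<in>UNIV. x $ i * (A *v x) $ i)"
  by (simp add: qform_def matrix_vector_mult_def sum_distrib_left mult_ac)

lemma sum_matrix_vector_adjoint: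
  fixes P :: "'a::comm_ring_1 ^ 'm ^ 'n"
  shows "(\<Sum>i\<in>UNIV. (P *v z) $ i * w $ i) = (\<Sum>j\<in>UNIV. z $ j * (transpose P *v w) $ j)"
proof -
  have "(\<Sum>i\<in>UNIV. (P *v z) $ i * w $ i) = (\<Sum>i\<in>UNIV. \<Sum>j\<in>UNIV. P $ i $ j * z $ j * w $ i)"
    by (simp add: matrix_vector_mult_def sum_distrib_right)
  also have "\<dots> = (\<Sum>j\<in>UNIV. \<Sum>i\<in>UNIV. P $ i $ j * z $ j * w $ i)"
    by (rule sum.swap)
  finally show ?thesis
    by (simp add: matrix_vector_mult_def transpose_def sum_distrib_left mult_ac)
qed

abbreviation pull_form :: "'a::comm_ring_1 ^ 'm ^ 'n \<Rightarrow> 'a ^ 'n ^ 'n \<Rightarrow> 'a ^ 'm ^ 'm"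
  where "pull_form P A \<equiv> transpose P ** (A ** P)"

lemma qform_pull_form: "qform (pull_form P A) z = qform A (P *v z)"
  unfolding qform_eq_matrix matrix_vector_mul_assoc[symmetric] sum_matrix_vector_adjoint ..

lemma bform_pull_form: "bform (pull_form P A) z w = bform A (P *v z) (P *v w)"
  using qform_add[of "pull_form P A" z w] qform_add[of A "P *v z" "P *v w"]
  unfolding qform_pull_form matrix_vector_right_distrib by simp

lemma contains_conic_pull_form: "contains_conic a c (pull_form P A) \<Longrightarrow> contains_conic a c A"
  unfolding contains_conic_def qform_pull_form bform_pull_form by blast

lemma base_change_pull_form:
  assumes "ring_hom_fun h"
  shows "base_change h (pull_form P A) = pull_form (\<chi> i j. h (P $ i $ j)) (base_change h A)"
  by (simp add: vec_eq_iff base_change_def matrix_matrix_mult_def transpose_def hom_sum[OF assms] hom_simps[OF assms])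

text \<open>Enlarging a proper subspace to a hyperplane loses nothing for isotropy, and an injective
  matrix turns the restricted form into one indexed by a type of size 4, as the dimension count
  requires.\<close>

lemma ex_hyperplane_parametrisation:
  fixes W :: "('a::field ^ 'n) set"
  assumes W: "vec.subspace W" "W \<noteq> UNIV" and card: "CARD('n) = Suc CARD('m::finite)"
  shows "\<exists>P :: 'a ^ 'm ^ 'n. (\<forall>z. P *v z = 0 \<longrightarrow> z = 0) \<and> W \<subseteq> range ((*v) P)"
proof -
  obtain S0 where S0: "S0 \<subseteq> W" "vec.independent S0" "W \<subseteq> vec.span S0"
    by (rule vec.maximal_independent_subset)
  obtain T where T: "S0 \<subseteq> T" "vec.independent T" "UNIV \<subseteq> vec.span T"
    by (rule vec.maximal_independent_subset_extend[OF subset_UNIV S0(2)])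
  have "card T = CARD('n)"
    using vec.basis_card_eq_dim[OF subset_UNIV T(3,2)] unfolding vec_dim_card .
  have "S0 \<noteq> T"
    using T(3) W(2) vec.span_minimal[OF S0(1) W(1)] by blast
  then obtain t where t: "t \<in> T" "t \<notin> S0"
    using T(1) by blast
  define S where "S = T - {t}"
  have indS: "vec.independent S"
    unfolding S_def by (rule vec.independent_mono[OF T(2)]) blast
  have finT: "finite T"
    using \<open>card T = CARD('n)\<close> card by (intro card_ge_0_finite) simp
  then have "finite S" "card S = CARD('m)"
    using t \<open>card T = CARD('n)\<close> card by (simp_all add: S_def)
  then obtain h :: "'m \<Rightarrow> 'a ^ 'n" where h: "bij_betw h UNIV S"
    using finite_same_card_bij[of "UNIV :: 'm set" S] by auto
  define P :: "'a ^ 'm ^ 'n" where "P = (\<chi> k i. h i $ k)"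
  have P: "P *v z = (\<Sum>i\<in>UNIV. z $ i *s h i)" for z
    by (simp add: vec_eq_iff P_def matrix_vector_mult_def mult.commute)
  have reindex: "(\<Sum>v\<in>S. u v *s v) = P *v (\<chi> i. u (h i))" for u
    unfolding P using sum.reindex_bij_betw[OF h, of "\<lambda>v. u v *s v"] by simp
  have "z = 0" if "P *v z = 0" for z
  proof -
    define u where "u = (\<lambda>v. z $ (inv_into UNIV h v))"
    have uh: "u (h i) = z $ i" for i
      using h by (simp add: u_def bij_betw_def)
    have "(\<Sum>v\<in>S. u v *s v) = 0"
      unfolding reindex uh using that by simp
    then have "u v = 0" if "v \<in> S" for v
      using vec.independentD[OF indS \<open>finite S\<close> subset_refl _ that] by blast
    then have "z $ i = 0" for i
      unfolding uh[symmetric] using bij_betw_apply[OF h UNIV_I] .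
    then show ?thesis
      by (simp add: vec_eq_iff)
  qed
  moreover have "W \<subseteq> vec.span S"
    using S0(3) vec.span_mono[of S0 S] T(1) t unfolding S_def by blast
  moreover have "vec.span S \<subseteq> range ((*v) P)"
    unfolding vec.span_finite[OF \<open>finite S\<close>] reindex by blast
  ultimately show ?thesis
    by blast
qed

section \<open>Anisotropy over \<open>F\<close>, isotropy over \<open>F\<^sub>Q\<close>, and
  minimality\<close>

lemma pnorm_anisotropic:
  fixes a b c :: "'f::field"
  assumes two: "(2::'f) = 0" and "b \<noteq> 0" "c \<noteq> 0"
    and "kato_milne_symbol a [b, c] \<noteq> \<one>\<^bsub>kato_milne 2\<^esub>" and zero: "pnorm a b c z = 0"
  shows "z = 0"
proof -
  obtain x0 x1 x2 x3 x4 x5 x6 x7 where z: "z = ((x0, x1, x2, x3), (x4, x5, x6, x7))"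
    by (metis prod_cases4 prod.exhaust)
  \<comment> \<open>The same 8-dimensional form read as \<open>n \<perp> c n\<close> with
    \<open>n\<close> the norm form of \<open>[a, b)\<close>; hence the reordered
    coordinates.\<close>
  have "nform a x0 x1 + b * nform a x4 x5 + c * (nform a x2 x3 + b * nform a x6 x7) = 0"
    using zero by (simp add: z pnorm_def algebra_simps)
  from pfister_isotropic_imp_trivial_symbol[OF assms(1-3) this]
  have "(x0, x1, x4, x5, x2, x3, x6, x7) = (0, 0, 0, 0, 0, 0, 0, 0)"
    using assms(4) trivial_symbol_iff by blast
  then show ?thesis
    unfolding z by (simp add: prod_eq_iff)
qed

lemma neighbour_form_anisotropic:
  assumes "\<And>z. pnorm a b c z = 0 \<Longrightarrow> z = 0"
  shows "anisotropic (neighbour_form a b c)"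
proof -
  have "v = 0" if "qform (neighbour_form a b c) v = 0" for v
  proof -
    have "neighbour_embed v = 0"
      using assms that unfolding pnorm_neighbour_embed[symmetric] by blast
    then show ?thesis
      unfolding neighbour_vec_eq_0_iff by (simp add: neighbour_embed_def prod_eq_iff)
  qed
  then show ?thesis
    by (auto simp: isotropic_def)
qed

lemma neighbour_form_isotropic:
  fixes a b c x y :: "'a::field"
  assumes two: "(2::'a) = 0" and point: "nform a x y = c" and c: "c \<noteq> 0"
  shows "isotropic (neighbour_form a b c)"
proof -
  \<comment> \<open>The conjugate point \<open>(x + y, y)\<close> has the same
    \<open>N\<close>-value \<open>c\<close>, so the first block contributes
    \<open>c^2 + b c y^2\<close>. The second block is \<open>y\<close> times the point and cancels
    \<open>b c y^2\<close>; the last coordinate \<open>c\<close> cancels \<open>c^2\<close>.\<close>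
  define v :: "'a ^ ((2 + 2) + 1)" where "v = (\<chi> k. case k of
      Inl (Inl i) \<Rightarrow> if i = 1 then x + y else y
    | Inl (Inr i) \<Rightarrow> if i = 1 then y * x else y\<^sup>2
    | Inr i \<Rightarrow> c)"
  have "qform (neighbour_form a b c) v = c * (nform a x y + b * y\<^sup>2) + b * (y\<^sup>2 * nform a x y) + c\<^sup>2"
    by (simp add: qform_neighbour_form v_def nform_def power2_eq_square algebra_simps char2_simps[OF two] two)
  also have "\<dots> = 0"
    unfolding point by (simp add: power2_eq_square algebra_simps char2_simps[OF two] two)
  finally have "qform (neighbour_form a b c) v = 0" .
  moreover have "v $ Inr 1 \<noteq> 0"
    using c by (simp add: v_def)
  then have "v \<noteq> 0"
    by auto
  ultimately show ?thesis
    by (auto simp: isotropic_def)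
qed

lemma subform_becomes_isotropic_imp_not_division_algebra:
  fixes a b c :: "'f::field" and \<iota> :: "'f \<Rightarrow> 'k::field"
  assumes char: "CHAR('f) = 2" and b: "b \<noteq> 0" and K: "conic_function_field a c \<iota> x y"
    and aniso: "\<And>z. pnorm a b c z = 0 \<Longrightarrow> z = 0"
    and W: "vec.subspace W" "W \<noteq> UNIV" and iso: "subform_becomes_isotropic \<iota> (neighbour_form a b c) W"
  shows "\<not> division_algebra (tensor_table (quaternion a b) (quaternion b c))"
proof -
  interpret conic_function_field a c \<iota> x y by fact
  let ?A = "neighbour_form a b c"
  have "CARD((2 + 2) + 1) = Suc CARD(4)"
    by simp
  from ex_hyperplane_parametrisation[OF W this]
  obtain P :: "'f ^ 4 ^ ((2 + 2) + 1)" where inj: "\<And>z. P *v z = 0 \<Longrightarrow> z = 0" and range: "W \<subseteq> range ((*v) P)"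
    by blast
  define PK where "PK = (\<chi> i j. \<iota> (P $ i $ j))"
  obtain v where v: "v \<in> vec.span ((\<lambda>w. \<chi> i. \<iota> (w $ i)) ` W)" "v \<noteq> 0" "qform (base_change \<iota> ?A) v = 0"
    using iso unfolding subform_becomes_isotropic_def by blast
  have "(\<chi> i. \<iota> ((P *v z) $ i)) = PK *v (\<chi> i. \<iota> (z $ i))" for z
    by (simp add: vec_eq_iff PK_def matrix_vector_mult_def hom_sum[OF \<iota>_ring] \<iota>_simps)
  \<comment> \<open>The range of \<open>PK\<close> is a subspace over the function field, so it
    contains the span of the image of \<open>W\<close> and with it the isotropic vector.\<close>
  then have "(\<lambda>w. \<chi> i. \<iota> (w $ i)) ` W \<subseteq> range ((*v) PK)"
    using range by blast
  moreover have "vec.subspace (range ((*v) PK))"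
    by (rule vec.subspace_image) (rule vec.subspace_UNIV)
  ultimately have "v \<in> range ((*v) PK)"
    using v(1) vec.span_minimal by blast
  then obtain z where z: "v = PK *v z"
    by blast
  have "isotropic (base_change \<iota> (pull_form P ?A))"
    unfolding base_change_pull_form[OF \<iota>_ring] isotropic_def qform_pull_form PK_def[symmetric]
    using v(2,3) z by (intro exI[of _ z]) auto
  then obtain m where m: "poly_zero a c m (pull_form P ?A)"
    using isotropic_imp_poly_zero by blast
  have "anisotropic (pull_form P ?A)"
    using neighbour_form_anisotropic[OF aniso] inj unfolding isotropic_def qform_pull_form by blast
  moreover have "q = 0" if "qnorm a c q = 0" for q
  proof -
    have "qnorm a c 0 = 0"
      by (simp add: zero_prod_def)
    then have "(q, 0 :: 'f quat) = 0"
      using that by (intro aniso) (simp add: pnorm_def)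
    from arg_cong[OF this, of fst] show ?thesis
      by simp
  qed
  ultimately have "contains_conic a c (pull_form P ?A)"
    using poly_zero_imp_contains_conic[OF two _ _ _ m] by simp
  then have "contains_conic a c ?A"
    by (rule contains_conic_pull_form)
  then show ?thesis
    using contains_conic_imp_not_division_algebra[OF char b c aniso] by blast
qed

theorem proposition4p1:
  fixes a b c :: "'f::field"
  assumes "CHAR('f) = 2"
    and "b \<noteq> 0" and "c \<noteq> 0"
    and "kato_milne_symbol a [b, c] \<noteq> \<one>\<^bsub>kato_milne 2\<^esub>"
  shows "let \<phi>\<^sub>1 = scale_form c (binary_form (a + b)) \<bottom>\<bottom> scale_form b (binary_form a) \<bottom>\<bottom> unary_form 1
    in anisotropic \<phi>\<^sub>1 \<and>
       (\<forall>\<iota> :: 'f \<Rightarrow> 'k::field. is_function_field a c \<iota> \<longrightarrow>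
          isotropic (base_change \<iota> \<phi>\<^sub>1) \<and>
          (division_algebra (tensor_table (quaternion a b) (quaternion b c)) \<longrightarrow> minimal_form \<iota> \<phi>\<^sub>1))"
proof -
  have two: "(2::'f) = 0"
    using of_nat_CHAR[where ?'a = 'f] assms(1) by simp
  note aniso = pnorm_anisotropic[OF two assms(2-4)]
  have "isotropic (base_change \<iota> (neighbour_form a b c)) \<and>
      (division_algebra (tensor_table (quaternion a b) (quaternion b c)) \<longrightarrow> minimal_form \<iota> (neighbour_form a b c))"
    if ff: "is_function_field a c \<iota>" for \<iota> :: "'f \<Rightarrow> 'k"
  proof -
    obtain x y where "field_hom \<iota>" "\<And>p. eval2 \<iota> x y p = 0 \<longleftrightarrow> conic_poly a c dvd p"
      "\<And>k. \<exists>p q. eval2 \<iota> x y q \<noteq> 0 \<and> k = eval2 \<iota> x y p / eval2 \<iota> x y q"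
      using ff unfolding is_function_field_def by blast
    then have K: "conic_function_field a c \<iota> x y"
      using two assms(3) by unfold_locales
    then interpret conic_function_field a c \<iota> x y .
    have "base_change \<iota> (neighbour_form a b c) = neighbour_form (\<iota> a) (\<iota> b) (\<iota> c)"
      by (simp add: base_change_forms[OF \<iota>_ring] \<iota>_simps)
    moreover have "\<iota> c \<noteq> 0"
      using assms(3) field_hom_eq_0_iff[OF \<iota>] by simp
    ultimately have "isotropic (base_change \<iota> (neighbour_form a b c))"
      using neighbour_form_isotropic[OF two_K] point by (simp add: nform_def)
    then show ?thesis
      using neighbour_form_anisotropic[OF aniso]
        subform_becomes_isotropic_imp_not_division_algebra[OF assms(1,2) K aniso]
      unfolding minimal_form_def by blast
  qed
  then show ?thesis
    unfolding Let_def using neighbour_form_anisotropic[OF aniso] by blast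
qed

end
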